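(* Let $d\in\{1,2,3\}$, let $\Omega\subset\mathbb{R}^d$ be a bounded Lipschitz domain, let $f,g\in L^2(\Omega)$ and $\boldsymbol f,\boldsymbol g\in[L^2(\Omega)]^d$, and let $A\colon\Omega\to\mathbb{R}^{d\times d}_{\rm sym}$ and $b\colon\Omega\times\mathbb{R}\to\mathbb{R}$. Assume the following. (RHS) If $d\ge2$, there is $p>d$ such that $\boldsymbol f,\boldsymbol g\in[L^p(\Omega)]^d$ and $f,g\in L^q(\Omega)$, where $1/q:=1/p+1/d$. (ELL) $A\in L^\infty(\Omega;\mathbb{R}^{d\times d}_{\rm sym})$ with $0<\mu_0:=\inf_{x\in\Omega}\lambda_{\min}(A(x))\le\mu_1:=\sup_{x\in\Omega}\lambda_{\max}(A(x))<\infty$. (CAR) For all $j\in\mathbb{N}_0$, $x\mapsto\partial_\xi^j b(x,\xi)$ is measurable on $\Omega$ for every $\xi\in\mathbb{R}$, and $\xi\mapsto\partial_\xi^j b(x,\xi)$ is smooth for every $x\in\Omega$. (MON) $b'(x,\xi):=\partial_\xi b(x,\xi)\ge0$ and $b(x,0)=0$ for all $x\in\Omega$, $\xi\in\mathbb{R}$. (GC) There are $n\in\mathbb{N}$ with $n\ge2$ (and $n\le5$ if $d=3$) and $R>0$ such that $|\partial_\xi^k b(x,\xi)|\le R(1+|\xi|^{n-k})$ for all $x\in\Omega$, $\xi\in\mathbb{R}$, $0\le k\le n$. Let $u\in H^1_0(\Omega)$ be the solution of the primal problem and $u_H\in\mathcal X_H$ its finite element approximation. Then $$|G(u)-G(u_H)|\le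 C_{\rm est}\Big[\|u-u_H\|_A\,\|z[u_H]-z_H[u_H]\|_A+\|u-u_H\|_A^2\Big],$$ where the constant $C_{\rm est}>0$ depends only on $|\Omega|$, $d$, $\|u\|_{L^\infty(\Omega)}$, $n$, $R$, $p$, $f$, $\boldsymbol f$, $g$, $\boldsymbol g$, and $\mu_0$.
   Context: Notation: $\langle v,w\rangle:=\int_\Omega vw\,dx$ (also for vector fields, with the Euclidean product); $b(v)$ denotes $x\mapsto b(x,v(x))$, and likewise $b'(v)$; $a(v,w):=\langle A\nabla v,\nabla w\rangle$ and $\|v\|_A:=a(v,v)^{1/2}$ on $H^1_0(\Omega)$. Goal functional: $G(v):=\int_\Omega gv\,dx+\int_\Omega\boldsymbol g\cdot\nabla v\,dx$. Primal problem: $u\in H^1_0(\Omega)$ is the unique solution of $a(u,v)+\langle b(u),v\rangle=\langle f,v\rangle+\langle\boldsymbol f,\nabla v\rangle$ for all $v\in H^1_0(\Omega)$. Discretization: for a conforming simplicial triangulation $\mathcal T_H$ of $\Omega$ and a fixed polynomial degree $m\in\mathbb{N}$, $\mathcal X_H:=\{v_H\in H^1_0(\Omega): v_H|_T\text{ is a polynomial of degree}\le m\text{ for all }T\in\mathcal T_H\}$, and $u_H\in\mathcal X_H$ is the unique solution of $a(u_H,v_H)+\langle b(u_H),v_H\rangle=\langle f,v_H\rangle+\langle\boldsymbol f,\nabla v_H\rangle$ for all $v_H\in\mathcal X_H$. (Practical) dual problem: for $w\in H^1_0(\Omega)$, $z[w]\in H^1_0(\Omega)$ and $z_H[w]\in\mathcal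 X_H$ are the unique solutions of $a(z[w],v)+\langle b'(w)z[w],v\rangle=G(v)$ for all $v\in H^1_0(\Omega)$ and $a(z_H[w],v_H)+\langle b'(w)z_H[w],v_H\rangle=G(v_H)$ for all $v_H\in\mathcal X_H$. *)

theory Defs
  imports "HOL-Analysis.Analysis" "HOL-Probability.Essential_Supremum"
begin

text \<open>Functions on a domain \<open>\<Omega>\<close> are total functions whose values outside \<open>\<Omega>\<close> are ignored: all
  integrals and measurability statements refer to \<^term>\<open>lebesgue_on \<Omega>\<close>. Elements of \<open>L\<^sup>p\<close> and Sobolev
  spaces are represented by functions, not by classes modulo null sets.\<close>

text \<open>Near each boundary point, \<open>\<Omega>\<close> is the part above the graph of a Lipschitz function \<open>\<gamma>\<close> on the
  hyperplane orthogonal to a unit vector \<open>\<nu>\<close>.\<close>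

definition bounded_Lipschitz_domain :: "(real ^ 'd) set \<Rightarrow> bool" where
  "bounded_Lipschitz_domain \<Omega> \<longleftrightarrow>
     open \<Omega> \<and> connected \<Omega> \<and> bounded \<Omega> \<and> \<Omega> \<noteq> {} \<and>
     (\<forall>x \<in> frontier \<Omega>. \<exists>\<nu> r L \<gamma>. norm \<nu> = 1 \<and> 0 < r \<and> L-lipschitz_on {y. \<nu> \<bullet> y = 0} \<gamma> \<and>
        \<Omega> \<inter> ball x r = {y \<in> ball x r. \<gamma> (y - (\<nu> \<bullet> y) *\<^sub>R \<nu>) < \<nu> \<bullet> y})"

primrec times_cont_diff :: "nat \<Rightarrow> ('a::euclidean_space \<Rightarrow> real) \<Rightarrow> bool" where
  "times_cont_diff 0 h \<longleftrightarrow> continuous_on UNIV h"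
| "times_cont_diff (Suc k) h \<longleftrightarrow> h differentiable_on UNIV \<and>
     (\<forall>i\<in>Basis. times_cont_diff k (\<lambda>x. frechet_derivative h (at x) i))"

definition smooth :: "('a::euclidean_space \<Rightarrow> real) \<Rightarrow> bool" where
  "smooth h \<longleftrightarrow> (\<forall>k. times_cont_diff k h)"

definition test_functions :: "(real ^ 'd) set \<Rightarrow> (real ^ 'd \<Rightarrow> real) set" where
  "test_functions \<Omega> =
     {\<phi>. smooth \<phi> \<and> compact (closure {x. \<phi> x \<noteq> 0}) \<and> closure {x. \<phi> x \<noteq> 0} \<subseteq> \<Omega>}"

definition Lp :: "real \<Rightarrow> (real ^ 'd) set \<Rightarrow> (real ^ 'd \<Rightarrow> 'b::euclidean_space) set" where
  "Lp p \<Omega> = {h \<in> borel_measurable (lebesgue_on \<Omega>).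
               integrable (lebesgue_on \<Omega>) (\<lambda>x. norm (h x) powr p)}"

definition Linf :: "(real ^ 'd) set \<Rightarrow> (real ^ 'd \<Rightarrow> 'b::euclidean_space) set" where
  "Linf \<Omega> = {h \<in> borel_measurable (lebesgue_on \<Omega>). \<exists>K. AE x in lebesgue_on \<Omega>. norm (h x) \<le> K}"

text \<open>Extended-real valued, so that speaking of \<open>\<parallel>u\<parallel>\<close> does not presuppose \<open>u \<in> L\<^sup>\<infinity>(\<Omega>)\<close>.\<close>

definition Linf_norm :: "(real ^ 'd) set \<Rightarrow> (real ^ 'd \<Rightarrow> real) \<Rightarrow> ereal" where
  "Linf_norm \<Omega> h = esssup (lebesgue_on \<Omega>) (\<lambda>x. ereal \<bar>h x\<bar>)"

definition ip :: "(real ^ 'd) set \<Rightarrow> (real ^ 'd \<Rightarrow> 'b::euclidean_space) \<Rightarrow> (real ^ 'd \<Rightarrow> 'b) \<Rightarrow> real" where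
  "ip \<Omega> v w = (LINT x|lebesgue_on \<Omega>. v x \<bullet> w x)"

definition has_weak_gradient ::
    "(real ^ 'd) set \<Rightarrow> (real ^ 'd \<Rightarrow> real) \<Rightarrow> (real ^ 'd \<Rightarrow> real ^ 'd) \<Rightarrow> bool" where
  "has_weak_gradient \<Omega> v V \<longleftrightarrow>
     (\<forall>\<phi> \<in> test_functions \<Omega>. \<forall>i.
        (LINT x|lebesgue_on \<Omega>. v x * frechet_derivative \<phi> (at x) (axis i 1)) =
        - (LINT x|lebesgue_on \<Omega>. V x $ i * \<phi> x))"

definition H1 :: "(real ^ 'd) set \<Rightarrow> (real ^ 'd \<Rightarrow> real) set" where
  "H1 \<Omega> = {v \<in> Lp 2 \<Omega>. \<exists>V \<in> Lp 2 \<Omega>. has_weak_gradient \<Omega> v V}"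

text \<open>For \<open>v \<in> H\<^sup>1(\<Omega>)\<close> the choice is unique up to a null set.\<close>

definition grad :: "(real ^ 'd) set \<Rightarrow> (real ^ 'd \<Rightarrow> real) \<Rightarrow> (real ^ 'd \<Rightarrow> real ^ 'd)" where
  "grad \<Omega> v = (SOME V. V \<in> Lp 2 \<Omega> \<and> has_weak_gradient \<Omega> v V)"

definition H1_norm :: "(real ^ 'd) set \<Rightarrow> (real ^ 'd \<Rightarrow> real) \<Rightarrow> real" where
  "H1_norm \<Omega> v = sqrt (ip \<Omega> v v + ip \<Omega> (grad \<Omega> v) (grad \<Omega> v))"

definition H10 :: "(real ^ 'd) set \<Rightarrow> (real ^ 'd \<Rightarrow> real) set" where
  "H10 \<Omega> = {v \<in> H1 \<Omega>. \<exists>\<phi> :: nat \<Rightarrow> real ^ 'd \<Rightarrow> real.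
      (\<forall>k. \<phi> k \<in> test_functions \<Omega>) \<and> (\<lambda>k. H1_norm \<Omega> (\<lambda>x. v x - \<phi> k x)) \<longlonglongrightarrow> 0}"

definition polynomial_le :: "nat \<Rightarrow> (real ^ 'd \<Rightarrow> real) \<Rightarrow> bool" where
  "polynomial_le m P \<longleftrightarrow> (\<exists>c :: ('d \<Rightarrow> nat) \<Rightarrow> real.
     \<forall>x. P x = (\<Sum>\<alpha> | sum \<alpha> UNIV \<le> m. c \<alpha> * (\<Prod>i\<in>UNIV. (x $ i) ^ \<alpha> i)))"

text \<open>The library notion \<^const>\<open>triangulation\<close> is a finite family of closed simplices, any two of which
  meet in a common (possibly empty) face; here all of them are nondegenerate.\<close>

definition conforming_triangulation_of ::
    "(real ^ 'd) set set \<Rightarrow> (real ^ 'd) set \<Rightarrow> bool" where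
  "conforming_triangulation_of \<T> \<Omega> \<longleftrightarrow>
     triangulation \<T> \<and> (\<forall>T\<in>\<T>. int CARD('d) simplex T) \<and> \<Union>\<T> = closure \<Omega>"

definition fem_space :: "(real ^ 'd) set \<Rightarrow> (real ^ 'd) set set \<Rightarrow> nat \<Rightarrow> (real ^ 'd \<Rightarrow> real) set" where
  "fem_space \<Omega> \<T> m = {v \<in> H10 \<Omega>.
     \<forall>T\<in>\<T>. \<exists>P. polynomial_le m P \<and> (AE x in lebesgue_on T. v x = P x)}"

definition RHS :: "(real ^ 'd) set \<Rightarrow> real \<Rightarrow> (real ^ 'd \<Rightarrow> real) \<Rightarrow> (real ^ 'd \<Rightarrow> real ^ 'd) \<Rightarrow>
    (real ^ 'd \<Rightarrow> real) \<Rightarrow> (real ^ 'd \<Rightarrow> real ^ 'd) \<Rightarrow> bool" where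
  "RHS \<Omega> p f ff g gg \<longleftrightarrow>
     (CARD('d) \<ge> 2 \<longrightarrow>
        (let q = 1 / (1 / p + 1 / real CARD('d)) in
           p > real CARD('d) \<and> ff \<in> Lp p \<Omega> \<and> gg \<in> Lp p \<Omega> \<and> f \<in> Lp q \<Omega> \<and> g \<in> Lp q \<Omega>))"

definition eigenvalues :: "real ^ 'd ^ 'd \<Rightarrow> real set" where
  "eigenvalues B = {l. \<exists>v. v \<noteq> 0 \<and> B *v v = l *\<^sub>R v}"

definition ELL :: "(real ^ 'd) set \<Rightarrow> (real ^ 'd \<Rightarrow> real ^ 'd ^ 'd) \<Rightarrow> real \<Rightarrow> real \<Rightarrow> bool" where
  "ELL \<Omega> A \<mu>0 \<mu>1 \<longleftrightarrow>
     A \<in> Linf \<Omega> \<and> (\<forall>x\<in>\<Omega>. transpose (A x) = A x) \<and>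
     ereal \<mu>0 = (INF x\<in>\<Omega>. ereal (Min (eigenvalues (A x)))) \<and>
     ereal \<mu>1 = (SUP x\<in>\<Omega>. ereal (Max (eigenvalues (A x)))) \<and>
     0 < \<mu>0 \<and> \<mu>0 \<le> \<mu>1"

definition dxi :: "nat \<Rightarrow> (real ^ 'd \<Rightarrow> real \<Rightarrow> real) \<Rightarrow> real ^ 'd \<Rightarrow> real \<Rightarrow> real" where
  "dxi j b x = (deriv ^^ j) (b x)"

definition CAR :: "(real ^ 'd) set \<Rightarrow> (real ^ 'd \<Rightarrow> real \<Rightarrow> real) \<Rightarrow> bool" where
  "CAR \<Omega> b \<longleftrightarrow> (\<forall>j.
     (\<forall>\<xi>. (\<lambda>x. dxi j b x \<xi>) \<in> borel_measurable (lebesgue_on \<Omega>)) \<and>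
     (\<forall>x\<in>\<Omega>. smooth (dxi j b x)))"

definition MON :: "(real ^ 'd) set \<Rightarrow> (real ^ 'd \<Rightarrow> real \<Rightarrow> real) \<Rightarrow> bool" where
  "MON \<Omega> b \<longleftrightarrow> (\<forall>x\<in>\<Omega>. \<forall>\<xi>. 0 \<le> dxi 1 b x \<xi> \<and> b x 0 = 0)"

definition GC :: "(real ^ 'd) set \<Rightarrow> (real ^ 'd \<Rightarrow> real \<Rightarrow> real) \<Rightarrow> nat \<Rightarrow> real \<Rightarrow> bool" where
  "GC \<Omega> b n R \<longleftrightarrow>
     2 \<le> n \<and> (CARD('d) = 3 \<longrightarrow> n \<le> 5) \<and> 0 < R \<and>
     (\<forall>x\<in>\<Omega>. \<forall>\<xi>. \<forall>k\<le>n. \<bar>dxi k b x \<xi>\<bar> \<le> R * (1 + \<bar>\<xi>\<bar> ^ (n - k)))"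

definition a_form :: "(real ^ 'd) set \<Rightarrow> (real ^ 'd \<Rightarrow> real ^ 'd ^ 'd) \<Rightarrow>
    (real ^ 'd \<Rightarrow> real) \<Rightarrow> (real ^ 'd \<Rightarrow> real) \<Rightarrow> real" where
  "a_form \<Omega> A v w = ip \<Omega> (\<lambda>x. A x *v grad \<Omega> v x) (grad \<Omega> w)"

definition norm_A :: "(real ^ 'd) set \<Rightarrow> (real ^ 'd \<Rightarrow> real ^ 'd ^ 'd) \<Rightarrow> (real ^ 'd \<Rightarrow> real) \<Rightarrow> real" where
  "norm_A \<Omega> A v = sqrt (a_form \<Omega> A v v)"

definition lin_functional :: "(real ^ 'd) set \<Rightarrow> (real ^ 'd \<Rightarrow> real) \<Rightarrow> (real ^ 'd \<Rightarrow> real ^ 'd) \<Rightarrow>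
    (real ^ 'd \<Rightarrow> real) \<Rightarrow> real" where
  "lin_functional \<Omega> h hh v = ip \<Omega> h v + ip \<Omega> hh (grad \<Omega> v)"

text \<open>The space \<open>X\<close> of trial and test functions is \<^term>\<open>H10 \<Omega>\<close> for the continuous problems and
  \<^term>\<open>fem_space \<Omega> \<T> m\<close> for the discrete ones.\<close>

definition primal_solution :: "(real ^ 'd \<Rightarrow> real) set \<Rightarrow> (real ^ 'd) set \<Rightarrow>
    (real ^ 'd \<Rightarrow> real ^ 'd ^ 'd) \<Rightarrow> (real ^ 'd \<Rightarrow> real \<Rightarrow> real) \<Rightarrow>
    (real ^ 'd \<Rightarrow> real) \<Rightarrow> (real ^ 'd \<Rightarrow> real ^ 'd) \<Rightarrow> (real ^ 'd \<Rightarrow> real) \<Rightarrow> bool" where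
  "primal_solution X \<Omega> A b f ff u \<longleftrightarrow> u \<in> X \<and>
     (\<forall>v\<in>X. a_form \<Omega> A u v + ip \<Omega> (\<lambda>x. b x (u x)) v = lin_functional \<Omega> f ff v)"

definition dual_solution :: "(real ^ 'd \<Rightarrow> real) set \<Rightarrow> (real ^ 'd) set \<Rightarrow>
    (real ^ 'd \<Rightarrow> real ^ 'd ^ 'd) \<Rightarrow> (real ^ 'd \<Rightarrow> real \<Rightarrow> real) \<Rightarrow>
    (real ^ 'd \<Rightarrow> real) \<Rightarrow> (real ^ 'd \<Rightarrow> real ^ 'd) \<Rightarrow>
    (real ^ 'd \<Rightarrow> real) \<Rightarrow> (real ^ 'd \<Rightarrow> real) \<Rightarrow> bool" where
  "dual_solution X \<Omega> A b g gg w z \<longleftrightarrow> z \<in> X \<and>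
     (\<forall>v\<in>X. a_form \<Omega> A z v + ip \<Omega> (\<lambda>x. dxi 1 b x (w x) * z x) v = lin_functional \<Omega> g gg v)"

text \<open>Data \<open>f, \<^bold>f, g, \<^bold>g\<close> given on \<open>\<Omega>\<close> are identified with their extensions by zero. This makes
  "a constant depending only on \<open>|\<Omega>|\<close> and these data" meaningful while \<open>\<Omega>\<close> varies.\<close>

definition zero_outside :: "(real ^ 'd) set \<Rightarrow> (real ^ 'd \<Rightarrow> 'b::euclidean_space) \<Rightarrow> bool" where
  "zero_outside \<Omega> h \<longleftrightarrow> (\<forall>x. x \<notin> \<Omega> \<longrightarrow> h x = 0)"

end

theory Submission
  imports Defs
begin

text \<open>With \<open>e = u - u\<^sub>H\<close>, the dual problem tested with \<open>e\<close> and Galerkin orthogonality give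
  \<open>G(e) = a(e, z - z\<^sub>H) + \<langle>b(u) - b(u\<^sub>H), z - z\<^sub>H\<rangle> + \<langle>b'(u\<^sub>H) e - (b(u) - b(u\<^sub>H)), z\<rangle>\<close>.
  By the growth condition the last two terms are integrals of products of \<open>n + 1\<close> factors among
  \<open>1 + |u| + |u\<^sub>H|\<close>, \<open>e\<close>, \<open>z - z\<^sub>H\<close> and \<open>z\<close>, with two of the factors equal to \<open>e\<close> or
  \<open>z - z\<^sub>H\<close>. The embedding of \<open>H\<^sup>1\<^sub>0(\<Omega>)\<close> into \<open>L\<^bsup>n+1\<^esup>(\<Omega>)\<close> (critical for \<open>d = 3\<close>, \<open>n = 5\<close>)
  has a constant depending only on \<open>|\<Omega>|\<close>, and monotonicity bounds the energy norms
  of \<open>u\<close>, \<open>u\<^sub>H\<close> and \<open>z\<close> in terms of the data, so that no pointwise bound on any solution enters.\<close>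

section \<open>Smooth bump functions and the fundamental lemma of the calculus of variations\<close>

text \<open>The constant is chosen before \<Omega>, so every auxiliary constant has to be an
  explicit expression in the volume, the data and the structural parameters; a Poincare or embedding
  constant obtained by compactness would depend on the shape of the domain. Functions in
  \<open>H10\<close> are limits of test functions, which extend by zero to the whole space, and
  there the inequalities come from integration along coordinate lines. Two features of the
  definitions shape the rest. \<open>grad\<close> is an arbitrary choice among weak gradients, so
  even its additivity holds only almost everywhere and rests on the fundamental lemma, hence on a
  supply of smooth bumps. And vectors are indexed by an arbitrary type with one, two or three
  elements, so iterated integrals require an explicit change of coordinates. The exponent n + 1
  arises because all nonlinear terms have the same total degree: a derivative of b of order k costs
  n - k powers of the weight and is multiplied by k + 1 further functions.\<close>

lemma times_cont_diff_closed:
  fixes S :: "('a::euclidean_space \<Rightarrow> real) set"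
  assumes S: "\<And>h. h \<in> S \<Longrightarrow> \<exists>h'. \<forall>x. (h has_derivative h' x) (at x) \<and> (\<forall>i\<in>Basis. (\<lambda>x. h' x i) \<in> S)"
    and "h \<in> S"
  shows "times_cont_diff k h"
  using \<open>h \<in> S\<close>
proof (induction k arbitrary: h)
  case 0
  then obtain h' where "\<And>x. (h has_derivative h' x) (at x)" using S by blast
  then have "h differentiable_on UNIV"
    unfolding differentiable_on_def differentiable_def by auto
  then show ?case by (simp add: differentiable_imp_continuous_on)
next
  case (Suc k)
  then obtain h' where h': "\<And>x. (h has_derivative h' x) (at x)"
    and in_S: "\<And>i. i \<in> Basis \<Longrightarrow> (\<lambda>x. h' x i) \<in> S" using S by blast
  have "h differentiable_on UNIV"
    using h' unfolding differentiable_on_def differentiable_def by auto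
  moreover have "frechet_derivative h (at x) = h' x" for x
    using h' by (metis frechet_derivative_at)
  ultimately show ?case using Suc.IH in_S by simp
qed

text \<open>The flat function exp(-1/t), multiplied by t^-m because differentiation creates such
  factors: over all \<open>m\<close> the family is closed under differentiation up to linear
  combinations.\<close>

definition flat_exp :: "nat \<Rightarrow> real \<Rightarrow> real" where
  "flat_exp m t = (if t \<le> 0 then 0 else inverse t ^ m * exp (- inverse t))"

text \<open>A single term of the exponential series at 1/t. The order m + 2, and not m, is used
  because the resulting bound t^2 still tends to zero after division by t, which settles the
  derivative at the junction t = 0.\<close>

lemma flat_exp_le:
  assumes "0 < t" shows "flat_exp m t \<le> fact (m + 2) * t\<^sup>2"
proof -
  let ?s = "inverse t"
  have "?s ^ (m + 2) /\<^sub>R fact (m + 2) \<le> exp ?s"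
    unfolding exp_def
    using sum_le_suminf[OF summable_exp_generic[of ?s], of "{m + 2}"] assms by simp
  then have "?s ^ m \<le> fact (m + 2) * t\<^sup>2 * exp ?s"
    using assms by (simp add: field_simps power_add power2_eq_square del: fact_Suc)
  then show ?thesis
    using assms by (simp add: flat_exp_def exp_minus field_simps del: fact_Suc)
qed

lemma flat_exp_has_derivative:
  "(flat_exp m has_real_derivative (flat_exp (m + 2) t - real m * flat_exp (m + 1) t)) (at t)"
proof -
  consider "t < 0" | "t = 0" | "t > 0" by linarith
  then show ?thesis
  proof cases
    case 1
    have "((\<lambda>_. 0) has_real_derivative 0) (at t)" by simp
    then have "(flat_exp m has_real_derivative 0) (at t)"
      by (rule has_field_derivative_transform_within_open[where S="{..<0}"])
        (use 1 in \<open>auto simp: flat_exp_def\<close>)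
    then show ?thesis using 1 by (simp add: flat_exp_def)
  next
    case 2
    have "((\<lambda>h. flat_exp m h / h) \<longlongrightarrow> 0) (at 0)"
    proof (rule Lim_null_comparison)
      show "\<forall>\<^sub>F h in at 0. norm (flat_exp m h / h) \<le> fact (m + 2) * \<bar>h\<bar>"
      proof (rule always_eventually, rule allI)
        fix h :: real
        show "norm (flat_exp m h / h) \<le> fact (m + 2) * \<bar>h\<bar>"
        proof (cases "h \<le> 0")
          case False
          then have "flat_exp m h \<le> fact (m + 2) * h\<^sup>2" "0 \<le> flat_exp m h"
            using flat_exp_le[of h m] by (auto simp: flat_exp_def)
          then show ?thesis using False by (simp add: divide_simps power2_eq_square mult.assoc)
        next
          case True
          have "0 \<le> fact (m + 2) * \<bar>h\<bar>" by (intro mult_nonneg_nonneg) auto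
          with True show ?thesis by (simp add: flat_exp_def del: fact_Suc)
        qed
      qed
      show "((\<lambda>h::real. fact (m + 2) * \<bar>h\<bar>) \<longlongrightarrow> 0) (at 0)"
        by (auto intro!: tendsto_eq_intros)
    qed
    then show ?thesis using 2 by (simp add: has_field_derivative_iff flat_exp_def)
  next
    case 3
    have "((\<lambda>t. inverse t ^ m * exp (- inverse t)) has_real_derivative
        (inverse t ^ (m + 2) * exp (- inverse t) - real m * (inverse t ^ (m + 1) * exp (- inverse t)))) (at t)"
    proof (cases m)
      case (Suc k)
      have "((\<lambda>t. inverse t ^ Suc k * exp (- inverse t)) has_real_derivative
          (1 + real k) * (- (inverse t ^ Suc (Suc 0)) * inverse t ^ k) * exp (- inverse t)
          + exp (- inverse t) * (- (- (inverse t ^ Suc (Suc 0)))) * inverse t ^ Suc k) (at t)"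
        using 3 by (intro DERIV_mult DERIV_power_Suc DERIV_inverse DERIV_fun_exp DERIV_minus) auto
      then show ?thesis
        unfolding Suc by (rule DERIV_cong) (simp add: algebra_simps power2_eq_square)
    qed (use 3 in \<open>auto intro!: derivative_eq_intros simp: field_simps power2_eq_square\<close>)
    then have "(flat_exp m has_real_derivative
        (inverse t ^ (m + 2) * exp (- inverse t) - real m * (inverse t ^ (m + 1) * exp (- inverse t)))) (at t)"
      by (rule has_field_derivative_transform_within_open[where S="{0<..}"])
        (use 3 in \<open>auto simp: flat_exp_def\<close>)
    then show ?thesis using 3 by (simp add: flat_exp_def)
  qed
qed

text \<open>A class of functions containing the bumps and closed under partial derivatives, so that smoothness
  follows from differentiability of its members.\<close>

inductive_set bump_alg :: "('a::euclidean_space \<Rightarrow> real) set" where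
  const: "(\<lambda>_. c) \<in> bump_alg"
| inner: "(\<lambda>x. x \<bullet> v) \<in> bump_alg"
| add: "h \<in> bump_alg \<Longrightarrow> k \<in> bump_alg \<Longrightarrow> (\<lambda>x. h x + k x) \<in> bump_alg"
| mult: "h \<in> bump_alg \<Longrightarrow> k \<in> bump_alg \<Longrightarrow> (\<lambda>x. h x * k x) \<in> bump_alg"
| flat: "h \<in> bump_alg \<Longrightarrow> (\<lambda>x. flat_exp m (h x)) \<in> bump_alg"

text \<open>Rule induction mirrors the differentiation rules; the generator \<open>flat\<close> has
  to be available for every \<open>m\<close>, since its own derivative uses m + 1 and m + 2.\<close>

lemma bump_alg_derivative:
  fixes h :: "'a::euclidean_space \<Rightarrow> real"
  assumes "h \<in> bump_alg"
  shows "\<exists>h'. \<forall>x. (h has_derivative h' x) (at x) \<and> (\<forall>i\<in>Basis. (\<lambda>x. h' x i) \<in> bump_alg)"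
  using assms
proof induction
  case (const c)
  show ?case by (rule exI[of _ "\<lambda>x i. 0"]) (auto intro: bump_alg.const)
next
  case (inner v)
  show ?case by (rule exI[of _ "\<lambda>x i. i \<bullet> v"])
    (auto intro!: bump_alg.const derivative_eq_intros)
next
  case (add h k)
  then obtain h' k' where "\<And>x. (h has_derivative h' x) (at x)" "\<And>x. (k has_derivative k' x) (at x)"
    "\<And>i. i \<in> Basis \<Longrightarrow> (\<lambda>x. h' x i) \<in> bump_alg" "\<And>i. i \<in> Basis \<Longrightarrow> (\<lambda>x. k' x i) \<in> bump_alg" by blast
  then show ?case
    by (intro exI[of _ "\<lambda>x i. h' x i + k' x i"]) (auto intro!: bump_alg.add derivative_intros)
next
  case (mult h k)
  then obtain h' k' where "\<And>x. (h has_derivative h' x) (at x)" "\<And>x. (k has_derivative k' x) (at x)"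
    "\<And>i. i \<in> Basis \<Longrightarrow> (\<lambda>x. h' x i) \<in> bump_alg" "\<And>i. i \<in> Basis \<Longrightarrow> (\<lambda>x. k' x i) \<in> bump_alg" by blast
  then show ?case using mult.hyps
    by (intro exI[of _ "\<lambda>x i. h x * k' x i + h' x i * k x"])
      (auto intro!: bump_alg.add bump_alg.mult has_derivative_mult)
next
  case (flat h m)
  then obtain h' where h': "\<And>x. (h has_derivative h' x) (at x)"
    "\<And>i. i \<in> Basis \<Longrightarrow> (\<lambda>x. h' x i) \<in> bump_alg" by blast
  let ?d = "\<lambda>x. flat_exp (m + 2) (h x) + (- real m) * flat_exp (m + 1) (h x)"
  have "((\<lambda>x. flat_exp m (h x)) has_derivative (\<lambda>i. h' x i * ?d x)) (at x)" for x
    using DERIV_compose_FDERIV[OF flat_exp_has_derivative h'(1)[of x], of m] by simp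
  moreover have "?d \<in> bump_alg"
    by (intro bump_alg.intros flat.hyps)
  ultimately show ?case using h'(2)
    by (intro exI[of _ "\<lambda>x i. h' x i * ?d x"]) (fastforce intro: bump_alg.mult)
qed

lemma smooth_bump_alg: "h \<in> bump_alg \<Longrightarrow> smooth h"
  unfolding smooth_def using times_cont_diff_closed[of bump_alg h] bump_alg_derivative by blast

lemma bump_alg_prod:
  "finite I \<Longrightarrow> (\<And>i. i \<in> I \<Longrightarrow> h i \<in> bump_alg) \<Longrightarrow> (\<lambda>x. \<Prod>i\<in>I. h i x) \<in> bump_alg"
  by (induction I rule: finite_induct) (auto intro: bump_alg.intros)

text \<open>\<open>c\<close> is a steepness: for c > 0 the function is positive exactly on the open
  box, and as c grows it increases to the indicator of the box. Smooth approximation of indicators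
  is thus obtained without convolution.\<close>

definition box_bump :: "real \<Rightarrow> 'a \<Rightarrow> 'a \<Rightarrow> 'a::euclidean_space \<Rightarrow> real" where
  "box_bump c a b x =
     (\<Prod>i\<in>Basis. flat_exp 0 (c * (x \<bullet> i - a \<bullet> i)) * flat_exp 0 (c * (b \<bullet> i - x \<bullet> i)))"

lemma flat_exp_0_bounds: "0 \<le> flat_exp 0 t" "flat_exp 0 t \<le> 1"
  by (auto simp: flat_exp_def)

lemma box_bump_bounds: "0 \<le> box_bump c a b x" "box_bump c a b x \<le> 1"
  unfolding box_bump_def
  by (auto intro!: prod_nonneg prod_le_1 mult_le_one mult_nonneg_nonneg flat_exp_0_bounds)

lemma box_bump_eq_0: "0 < c \<Longrightarrow> x \<notin> box a b \<Longrightarrow> box_bump c a b x = 0"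
  by (auto simp: box_bump_def box_def not_less flat_exp_def mult_le_0_iff)

lemma smooth_box_bump: "smooth (box_bump c a b)"
proof -
  have lin: "(\<lambda>x. c * (x \<bullet> i - a \<bullet> i)) \<in> bump_alg" "(\<lambda>x. c * (b \<bullet> i - x \<bullet> i)) \<in> bump_alg" for i
    using bump_alg.mult[OF bump_alg.const[of c] bump_alg.add[OF bump_alg.inner[of i] bump_alg.const[of "- (a \<bullet> i)"]]]
      bump_alg.mult[OF bump_alg.const[of c] bump_alg.add[OF bump_alg.inner[of "- i"] bump_alg.const[of "b \<bullet> i"]]]
    by (simp_all add: algebra_simps)
  show ?thesis
    unfolding box_bump_def[abs_def]
    by (intro smooth_bump_alg bump_alg_prod bump_alg.mult bump_alg.flat lin finite_Basis)
qed

lemma box_bump_test_function: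
  assumes "0 < c" "cbox a b \<subseteq> \<Omega>"
  shows "box_bump c a b \<in> test_functions \<Omega>"
proof -
  have sub: "closure {x. box_bump c a b x \<noteq> 0} \<subseteq> cbox a b"
    using box_bump_eq_0[OF assms(1)] box_subset_cbox by (intro closure_minimal) (auto, blast)
  then have "compact (closure {x. box_bump c a b x \<noteq> 0})"
    by (meson bounded_cbox bounded_subset closed_closure compact_eq_bounded_closed)
  with sub assms(2) smooth_box_bump show ?thesis
    by (auto simp: test_functions_def)
qed

lemma flat_exp_tendsto: "(\<lambda>k. flat_exp 0 (real (Suc k) * t)) \<longlonglongrightarrow> (if 0 < t then 1 else 0)"
proof (cases "0 < t")
  case True
  have "(\<lambda>k. exp (- (inverse (real (Suc k)) * inverse t))) \<longlonglongrightarrow> exp (- (0 * inverse t))"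
    by (intro tendsto_intros LIMSEQ_inverse_real_of_nat)
  moreover have "flat_exp 0 (real (Suc k) * t) = exp (- (inverse (real (Suc k)) * inverse t))" for k
    using True by (simp add: flat_exp_def mult_le_0_iff del: of_nat_Suc)
  ultimately show ?thesis using True by simp
qed (simp add: flat_exp_def mult_le_0_iff del: of_nat_Suc)

lemma box_bump_tendsto: "(\<lambda>k. box_bump (real (Suc k)) a b x) \<longlonglongrightarrow> indicator (box a b) x"
proof -
  have "(\<lambda>k. box_bump (real (Suc k)) a b x) \<longlonglongrightarrow>
      (\<Prod>i\<in>Basis. (if 0 < x \<bullet> i - a \<bullet> i then 1 else 0) * (if 0 < b \<bullet> i - x \<bullet> i then 1 else 0))"
    unfolding box_bump_def by (intro tendsto_prod tendsto_mult flat_exp_tendsto)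
  also have "(\<Prod>i\<in>Basis. (if 0 < x \<bullet> i - a \<bullet> i then 1 else 0) * (if 0 < b \<bullet> i - x \<bullet> i then 1 else 0))
      = (indicator (box a b) x :: real)"
  proof (cases "x \<in> box a b")
    case False
    then have "\<exists>i\<in>Basis. (if 0 < x \<bullet> i - a \<bullet> i then 1 else 0) * (if 0 < b \<bullet> i - x \<bullet> i then 1 else 0) = (0::real)"
      by (auto simp: box_def)
    then have "(\<Prod>i\<in>Basis. (if 0 < x \<bullet> i - a \<bullet> i then 1 else 0) * (if 0 < b \<bullet> i - x \<bullet> i then 1 else 0)) = (0::real)"
      by (intro prod_zero) auto
    then show ?thesis using False by (simp only: indicator_simps not_False_eq_True)
  qed (auto simp: box_def intro!: prod.neutral)
  finally show ?thesis .
qed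

lemma continuous_on_box_bump: "continuous_on UNIV (box_bump c a b)"
  using smooth_box_bump[unfolded smooth_def, THEN spec[of _ 0]] by simp

text \<open>\<open>ennreal\<close> cuts off negative values, so \<open>?P\<close> and
  \<open>?N\<close> are the measures with the positive and the negative part of \<open>h\<close> as
  densities. They agree on open boxes, which are stable under intersection and generate the Borel
  sets, so they coincide; the two densities then agree almost everywhere, which forces both to
  vanish.\<close>

lemma AE_eq_0_if_box_integrals_0:
  fixes h :: "'a::euclidean_space \<Rightarrow> real"
  assumes h: "integrable lborel h" and zero: "\<And>l u. (LINT x|lborel. indicator (box l u) x * h x) = 0"
  shows "AE x in lborel. h x = 0"
proof -
  have [measurable]: "h \<in> borel_measurable borel" using h by auto
  let ?P = "density lborel (\<lambda>x. ennreal (h x))" and ?N = "density lborel (\<lambda>x. ennreal (- h x))"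
  have fin: "(\<integral>\<^sup>+x. ennreal (h x) \<partial>lborel) < \<infinity>"
    using integrableD(2)[OF h] by (simp add: top.not_eq_extremum)
  have "?P = ?N"
  proof (rule measure_eqI_generator_eq[where E="range (\<lambda>(a, b). box a b::'a set)" and \<Omega>=UNIV
        and A="\<lambda>n. box (- real n *\<^sub>R One) (real n *\<^sub>R One)"])
    show "Int_stable (range (\<lambda>(a, b). box a b::'a set))"
      by (auto simp: Int_stable_def box_Int_box)
    show "sets ?P = sigma_sets UNIV (range (\<lambda>(a, b). box a b))"
         "sets ?N = sigma_sets UNIV (range (\<lambda>(a, b). box a b))"
      by (simp_all add: borel_eq_box)
    show "(\<Union>n. box (- real n *\<^sub>R One) (real n *\<^sub>R One)) = (UNIV :: 'a set)"
      using UN_box_eq_UNIV by simp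
  next
    fix X :: "'a set" assume "X \<in> range (\<lambda>(a, b). box a b)"
    then obtain l u where X: "X = box l u" by auto
    let ?h = "\<lambda>x. indicator X x * h x"
    have int: "integrable lborel ?h"
      using integrable_mult_indicator[of X lborel h] h X by simp
    have "(\<integral>\<^sup>+x. ennreal (?h x) \<partial>lborel) = (\<integral>\<^sup>+x. ennreal (- ?h x) \<partial>lborel)"
    proof -
      have "enn2real (\<integral>\<^sup>+x. ennreal (?h x) \<partial>lborel) = enn2real (\<integral>\<^sup>+x. ennreal (- ?h x) \<partial>lborel)"
        using zero[of l u] real_lebesgue_integral_def[OF int] X by simp
      moreover have "(\<integral>\<^sup>+x. ennreal (?h x) \<partial>lborel) \<noteq> top" "(\<integral>\<^sup>+x. ennreal (- ?h x) \<partial>lborel) \<noteq> top"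
        using integrableD[OF int] by (auto simp: top.not_eq_extremum)
      ultimately show ?thesis
        by (metis ennreal_enn2real_if)
    qed
    moreover have "ennreal (indicator X x * h x) = ennreal (h x) * indicator X x"
      "ennreal (- (indicator X x * h x)) = ennreal (- h x) * indicator X x" for x
      by (auto simp: indicator_def)
    ultimately show "emeasure ?P X = emeasure ?N X"
      using X by (simp add: emeasure_density)
  next
    fix n
    have "emeasure ?P (box (- real n *\<^sub>R One) (real n *\<^sub>R One)) \<le> emeasure ?P UNIV"
      by (intro emeasure_mono) auto
    also have "\<dots> < \<infinity>" using fin by (simp add: emeasure_density)
    finally show "emeasure ?P (box (- real n *\<^sub>R One) (real n *\<^sub>R One)) \<noteq> \<infinity>" by simp
  qed auto
  then have "AE x in lborel. ennreal (h x) = ennreal (- h x)"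
    using fin by (subst (asm) finite_density_unique) auto
  then show ?thesis
    by eventually_elim (smt (verit) ennreal_eq_0_iff ennreal_neg)
qed

lemma borel_measurable_lebesgue_onI:
  "h \<in> borel_measurable borel \<Longrightarrow> h \<in> borel_measurable (lebesgue_on S)"
  by (intro measurable_restrict_space1 measurable_completion) simp

text \<open>Bumps converge to the indicator of a box, so the integral of \<open>h\<close> vanishes
  over every box whose closed box lies in \<Omega>; the box criterion is then applied locally, on
  boxes that cover \<Omega>.\<close>

lemma AE_eq_0_if_test_integrals_0:
  fixes h :: "real ^ 'd \<Rightarrow> real"
  assumes \<Omega>: "open \<Omega>" and h: "integrable (lebesgue_on \<Omega>) h"
    and zero: "\<And>\<phi>. \<phi> \<in> test_functions \<Omega> \<Longrightarrow> (LINT x|lebesgue_on \<Omega>. h x * \<phi> x) = 0"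
  shows "AE x in lebesgue_on \<Omega>. h x = 0"
proof -
  have \<Omega>_sets [measurable]: "\<Omega> \<in> sets lebesgue" "\<Omega> \<in> sets borel" using \<Omega> by auto
  have box0: "(LINT x|lebesgue_on \<Omega>. indicator (box l u) x * h x) = 0" if "cbox l u \<subseteq> \<Omega>" for l u
  proof -
    have "(\<lambda>k. LINT x|lebesgue_on \<Omega>. h x * box_bump (real (Suc k)) l u x) \<longlonglongrightarrow>
        (LINT x|lebesgue_on \<Omega>. h x * indicator (box l u) x)"
    proof (rule integral_dominated_convergence)
      have [measurable]: "box_bump c l u \<in> borel_measurable (lebesgue_on \<Omega>)" for c
        using borel_measurable_continuous_onI[OF continuous_on_box_bump]
        by (rule borel_measurable_lebesgue_onI)
      have [measurable]: "h \<in> borel_measurable (lebesgue_on \<Omega>)" using h by auto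
      show "(\<lambda>x. h x * box_bump (real (Suc k)) l u x) \<in> borel_measurable (lebesgue_on \<Omega>)" for k
        by measurable
      have [measurable]: "box l u \<in> sets lebesgue" by simp
      have "indicator (box l u) \<in> borel_measurable (lebesgue_on \<Omega>)"
        by (intro measurable_restrict_space1) measurable
      then show "(\<lambda>x. h x * indicator (box l u) x) \<in> borel_measurable (lebesgue_on \<Omega>)"
        by measurable
      show "integrable (lebesgue_on \<Omega>) (\<lambda>x. \<bar>h x\<bar>)" using h by simp
      show "AE x in lebesgue_on \<Omega>. (\<lambda>k. h x * box_bump (real (Suc k)) l u x) \<longlonglongrightarrow> h x * indicator (box l u) x"
        by (intro AE_I2 tendsto_mult tendsto_const box_bump_tendsto)
      show "AE x in lebesgue_on \<Omega>. norm (h x * box_bump (real (Suc k)) l u x) \<le> \<bar>h x\<bar>" for k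
        using box_bump_bounds[of "real (Suc k)" l u] by (auto simp: abs_mult intro!: mult_left_le)
    qed
    moreover have "(LINT x|lebesgue_on \<Omega>. h x * box_bump (real (Suc k)) l u x) = 0" for k
      using that by (intro zero box_bump_test_function) auto
    ultimately show ?thesis
      by (simp add: LIMSEQ_const_iff mult.commute)
  qed
  have boxAE: "AE x in lborel. x \<in> box a b \<longrightarrow> h x = 0" if ab: "cbox a b \<subseteq> \<Omega>" for a b
  proof -
    let ?h = "\<lambda>x. indicator (box a b) x * h x"
    have box\<Omega>: "box a b \<subseteq> \<Omega>" using ab box_subset_cbox by blast
    have int\<Omega>: "integrable lebesgue (\<lambda>x. indicator \<Omega> x * h x)"
      using h integrable_restrict_space[of \<Omega> lebesgue h] by simp
    have int: "integrable lebesgue ?h"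
    proof -
      have "integrable lebesgue (\<lambda>x. indicator (box a b) x *\<^sub>R (indicator \<Omega> x * h x))"
        by (intro integrable_mult_indicator int\<Omega>) simp
      moreover have "indicator (box a b) x *\<^sub>R (indicator \<Omega> x * h x) = ?h x" for x
        using box\<Omega> by (cases "x \<in> box a b") auto
      ultimately show ?thesis by (simp only:)
    qed
    \<comment> \<open>The box criterion is stated for the measure \<open>lborel\<close>, which is
      not complete; the Lebesgue measurable function is therefore replaced by a Borel
      representative.\<close>
    then obtain h' where h' [measurable]: "h' \<in> borel_measurable lborel" and eq: "AE x in lborel. ?h x = h' x"
      using completion_ex_borel_measurable_real[of ?h lborel] by auto
    have eq': "AE x in lebesgue. ?h x = h' x"
      using eq by (rule AE_completion)
    have "integrable lebesgue h'"
      by (rule integrable_cong_AE_imp[OF int _ ]) (use eq' in \<open>auto simp: measurable_completion\<close>)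
    then have int': "integrable lborel h'"
      using integrable_completion[of h' lborel] by simp
    have "(LINT x|lborel. indicator (box l u) x * h' x) = 0" for l u
    proof -
      \<comment> \<open>The box \<open>box l u\<close> is arbitrary, but only its intersection with
        \<open>box a b\<close> matters, and that is again a box whose closed box lies in
        \<Omega>.\<close>
      obtain l' u' where lu: "box l u \<inter> box a b = box l' u'" "cbox l u \<inter> cbox a b = cbox l' u'"
        using box_Int_box Int_interval by blast
      have "(LINT x|lborel. indicator (box l u) x * h' x) = (LINT x|lebesgue. indicator (box l u) x * h' x)"
        by (subst integral_completion) auto
      also have "\<dots> = (LINT x|lebesgue. indicator (box l u) x * ?h x)"
      proof (rule integral_cong_AE)
        have m: "indicator (box l u) \<in> borel_measurable lebesgue"
            "?h \<in> borel_measurable lebesgue" "h' \<in> borel_measurable lebesgue"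
          using int h' by (auto simp: measurable_completion)
        show "(\<lambda>x. indicator (box l u) x * h' x) \<in> borel_measurable lebesgue"
          "(\<lambda>x. indicator (box l u) x * ?h x) \<in> borel_measurable lebesgue"
          by (rule borel_measurable_times[OF m(1,3)], rule borel_measurable_times[OF m(1,2)])
      qed (use eq' in \<open>auto elim: eventually_mono\<close>)
      also have "\<dots> = (LINT x|lebesgue. indicator \<Omega> x *\<^sub>R (indicator (box l' u') x * h x))"
        using box\<Omega> lu(1)[symmetric] by (intro Bochner_Integration.integral_cong) (auto simp: indicator_def)
      also have "\<dots> = (LINT x|lebesgue_on \<Omega>. indicator (box l' u') x * h x)"
        by (subst integral_restrict_space) auto
      also have "\<dots> = 0" using lu(2) ab by (intro box0) auto
      finally show ?thesis .
    qed
    from AE_eq_0_if_box_integrals_0[OF int' this] eq show ?thesis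
      by eventually_elim (auto simp: indicator_def)
  qed
  have cboxAE: "AE x in lborel. x \<in> cbox a b \<longrightarrow> h x = 0" if "cbox a b \<subseteq> \<Omega>" for a b
  proof -
    \<comment> \<open>The countable cover of \<Omega> used below consists of closed boxes, so the
      boundary faces have to be added back.\<close>
    have "cbox a b - box a b \<in> null_sets lborel"
      using negligible_frontier_interval[of a b] by (simp add: negligible_iff_null_sets null_sets_completion_iff)
    from AE_not_in[OF this] boxAE[OF that] show ?thesis
      by eventually_elim auto
  qed
  obtain D where D: "countable D" "D \<subseteq> Pow \<Omega>" "\<And>X. X \<in> D \<Longrightarrow> \<exists>a b. X = cbox a b" "\<Union>D = \<Omega>"
    using open_countable_Union_open_cbox[OF \<Omega>] by metis
  have "AE x in lborel. \<forall>X\<in>D. x \<in> X \<longrightarrow> h x = 0"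
    using D cboxAE by (subst AE_ball_countable) (auto, blast)
  then have "AE x in lborel. x \<in> \<Omega> \<longrightarrow> h x = 0"
    by eventually_elim (use D(4) in blast)
  then have "AE x in lebesgue. x \<in> \<Omega> \<longrightarrow> h x = 0"
    by (rule AE_completion)
  then show ?thesis
    by (subst AE_restrict_space_iff) auto
qed

section \<open>Square-integrable functions and test functions\<close>

lemma Lp2_iff:
  "h \<in> Lp 2 \<Omega> \<longleftrightarrow> h \<in> borel_measurable (lebesgue_on \<Omega>) \<and> integrable (lebesgue_on \<Omega>) (\<lambda>x. (norm (h x))\<^sup>2)"
  by (simp add: Lp_def powr_numeral)

lemma Lp2_measurable: "h \<in> Lp 2 \<Omega> \<Longrightarrow> h \<in> borel_measurable (lebesgue_on \<Omega>)"
  by (simp add: Lp2_iff)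

lemma Lp2_bounded_by:
  assumes "h \<in> borel_measurable (lebesgue_on \<Omega>)" "k \<in> Lp 2 \<Omega>"
    and "AE x in lebesgue_on \<Omega>. norm (h x) \<le> norm (k x)"
  shows "h \<in> Lp 2 \<Omega>"
  unfolding Lp2_iff
proof
  show "integrable (lebesgue_on \<Omega>) (\<lambda>x. (norm (h x))\<^sup>2)"
  proof (rule Bochner_Integration.integrable_bound)
    show "integrable (lebesgue_on \<Omega>) (\<lambda>x. (norm (k x))\<^sup>2)" using assms(2) by (simp add: Lp2_iff)
    show "(\<lambda>x. (norm (h x))\<^sup>2) \<in> borel_measurable (lebesgue_on \<Omega>)"
      using assms(1) by measurable
    show "AE x in lebesgue_on \<Omega>. norm ((norm (h x))\<^sup>2) \<le> norm ((norm (k x))\<^sup>2)"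
      using assms(3) by eventually_elim (simp add: power_mono)
  qed
qed fact

lemma Lp2_scaleR: "h \<in> Lp 2 \<Omega> \<Longrightarrow> (\<lambda>x. c *\<^sub>R h x) \<in> Lp 2 \<Omega>"
  by (auto simp: Lp2_iff power_mult_distrib)

lemma Lp2_add:
  assumes "h \<in> Lp 2 \<Omega>" "k \<in> Lp 2 \<Omega>"
  shows "(\<lambda>x. h x + k x) \<in> Lp 2 \<Omega>"
  unfolding Lp2_iff
proof
  have [measurable]: "h \<in> borel_measurable (lebesgue_on \<Omega>)" "k \<in> borel_measurable (lebesgue_on \<Omega>)"
    using assms by (auto simp: Lp2_iff)
  show "(\<lambda>x. h x + k x) \<in> borel_measurable (lebesgue_on \<Omega>)" by measurable
  have "(norm (h x + k x))\<^sup>2 \<le> 2 * (norm (h x))\<^sup>2 + 2 * (norm (k x))\<^sup>2" for x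
  proof -
    have "(norm (h x + k x))\<^sup>2 \<le> (norm (h x) + norm (k x))\<^sup>2"
      by (intro power_mono norm_triangle_ineq) auto
    also have "\<dots> \<le> 2 * (norm (h x))\<^sup>2 + 2 * (norm (k x))\<^sup>2"
      using zero_le_power2[of "norm (h x) - norm (k x)"] by (simp add: power2_eq_square algebra_simps)
    finally show ?thesis .
  qed
  moreover have "integrable (lebesgue_on \<Omega>) (\<lambda>x. 2 * (norm (h x))\<^sup>2 + 2 * (norm (k x))\<^sup>2)"
    using assms by (simp add: Lp2_iff)
  ultimately show "integrable (lebesgue_on \<Omega>) (\<lambda>x. (norm (h x + k x))\<^sup>2)"
    by (elim Bochner_Integration.integrable_bound) simp_all
qed

lemma Lp2_diff:
  assumes "h \<in> Lp 2 \<Omega>" "k \<in> Lp 2 \<Omega>"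
  shows "(\<lambda>x. h x - k x) \<in> Lp 2 \<Omega>"
  using Lp2_add[OF assms(1) Lp2_scaleR[OF assms(2), of "-1"]] by simp

lemma Lp2_inner:
  assumes "h \<in> Lp 2 \<Omega>" "k \<in> Lp 2 \<Omega>"
  shows "integrable (lebesgue_on \<Omega>) (\<lambda>x. h x \<bullet> k x)"
proof (rule Bochner_Integration.integrable_bound)
  have [measurable]: "h \<in> borel_measurable (lebesgue_on \<Omega>)" "k \<in> borel_measurable (lebesgue_on \<Omega>)"
    using assms by (auto simp: Lp2_iff)
  show "(\<lambda>x. h x \<bullet> k x) \<in> borel_measurable (lebesgue_on \<Omega>)" by measurable
  show "integrable (lebesgue_on \<Omega>) (\<lambda>x. (norm (h x))\<^sup>2 + (norm (k x))\<^sup>2)"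
    using assms by (auto simp: Lp2_iff)
  have "\<bar>h x \<bullet> k x\<bar> \<le> (norm (h x))\<^sup>2 + (norm (k x))\<^sup>2" for x
  proof -
    have "\<bar>h x \<bullet> k x\<bar> \<le> norm (h x) * norm (k x)" by (rule Cauchy_Schwarz_ineq2)
    also have "\<dots> \<le> (norm (h x))\<^sup>2 + (norm (k x))\<^sup>2"
      using sum_squares_bound[of "norm (h x)" "norm (k x)"] mult_nonneg_nonneg[OF norm_ge_zero[of "h x"] norm_ge_zero[of "k x"]]
      unfolding mult.assoc by linarith
    finally show ?thesis .
  qed
  then show "AE x in lebesgue_on \<Omega>. norm (h x \<bullet> k x) \<le> norm ((norm (h x))\<^sup>2 + (norm (k x))\<^sup>2)"
    by simp
qed

lemma Lp2_mult:
  "h \<in> Lp 2 \<Omega> \<Longrightarrow> k \<in> Lp 2 \<Omega> \<Longrightarrow> integrable (lebesgue_on \<Omega>) (\<lambda>x. h x * k x :: real)"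
  using Lp2_inner[of h \<Omega> k] by simp

lemma Lp2_component:
  fixes V :: "real ^ 'd \<Rightarrow> real ^ 'd"
  assumes "V \<in> Lp 2 \<Omega>" shows "(\<lambda>x. V x $ i) \<in> Lp 2 \<Omega>"
proof (rule Lp2_bounded_by[OF _ assms])
  have [measurable]: "V \<in> borel_measurable (lebesgue_on \<Omega>)" using assms by (rule Lp2_measurable)
  have "(\<lambda>x. V x \<bullet> axis i 1) \<in> borel_measurable (lebesgue_on \<Omega>)" by measurable
  then show "(\<lambda>x. V x $ i) \<in> borel_measurable (lebesgue_on \<Omega>)" by (simp add: inner_axis)
qed (simp add: component_le_norm_cart)

text \<open>The discriminant argument, isolated because it is needed for integrals and again for the
  minimiser of a Rayleigh quotient.\<close>

lemma quadratic_nonneg_imp_abs_le: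
  fixes a b c :: real
  assumes nn: "\<And>t. 0 \<le> a + 2 * t * b + t\<^sup>2 * c"
  shows "\<bar>b\<bar> \<le> sqrt a * sqrt c"
proof -
  have a: "0 \<le> a" using nn[of 0] by simp
  have c: "0 \<le> c"
  proof (rule ccontr)
    assume "\<not> 0 \<le> c"
    then have "c < 0" by simp
    \<comment> \<open>This t makes t^2 * c equal to -(a + 1); averaging the inequality over t and -t
      removes the linear term.\<close>
    have sq: "(sqrt ((a + 1) / (- c)))\<^sup>2 = (a + 1) / (- c)"
      using a \<open>c < 0\<close> by (simp add: divide_nonneg_pos del: divide_minus_right)
    have "0 \<le> a + (sqrt ((a + 1) / (- c)))\<^sup>2 * c"
      using nn[of "sqrt ((a + 1) / (- c))"] nn[of "- sqrt ((a + 1) / (- c))"] by simp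
    also have "\<dots> = - 1" unfolding sq using \<open>c < 0\<close> by (simp add: field_simps)
    finally show False by simp
  qed
  have "b\<^sup>2 \<le> a * c"
  proof (cases "c = 0")
    case True
    have "b = 0"
    proof (rule ccontr)
      assume "b \<noteq> 0"
      \<comment> \<open>With c = 0 the quadratic is affine in t, and it takes the value -1 at this
        point.\<close>
      then show False using nn[of "- (a + 1) / (2 * b)"] True by (simp add: field_simps)
    qed
    with True show ?thesis by simp
  next
    case False
    then have "0 \<le> c * (a + 2 * (- b / c) * b + (- b / c)\<^sup>2 * c)" using nn[of "- b / c"] c by simp
    also have "\<dots> = a * c - b\<^sup>2" using False by (simp add: power2_eq_square field_simps)
    finally show ?thesis by simp
  qed
  then have "sqrt (b\<^sup>2) \<le> sqrt (a * c)" by (rule real_sqrt_le_mono)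
  then show ?thesis by (simp add: real_sqrt_mult)
qed

text \<open>Formulated with three integrands so that the Euclidean product and the product weighted
  by the matrix field are both instances: it suffices that the pointwise quadratic form is
  nonnegative.\<close>

lemma integral_quadratic_Cauchy_Schwarz:
  fixes q11 q12 q22 :: "'a \<Rightarrow> real"
  assumes int: "integrable M q11" "integrable M q12" "integrable M q22"
    and nn: "\<And>t. AE x in M. 0 \<le> q11 x + 2 * t * q12 x + t\<^sup>2 * q22 x"
  shows "\<bar>integral\<^sup>L M q12\<bar> \<le> sqrt (integral\<^sup>L M q11) * sqrt (integral\<^sup>L M q22)"
proof (rule quadratic_nonneg_imp_abs_le)
  fix t
  have "0 \<le> (\<integral>x. q11 x + 2 * t * q12 x + t\<^sup>2 * q22 x \<partial>M)"
    using nn by (rule integral_nonneg_AE)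
  also have "\<dots> = integral\<^sup>L M q11 + 2 * t * integral\<^sup>L M q12 + t\<^sup>2 * integral\<^sup>L M q22"
    using int by simp
  finally show "0 \<le> integral\<^sup>L M q11 + 2 * t * integral\<^sup>L M q12 + t\<^sup>2 * integral\<^sup>L M q22" .
qed

definition L2_nrm :: "(real ^ 'd) set \<Rightarrow> (real ^ 'd \<Rightarrow> 'b::euclidean_space) \<Rightarrow> real" where
  "L2_nrm \<Omega> h = sqrt (ip \<Omega> h h)"

lemma L2_nrm_nonneg: "0 \<le> L2_nrm \<Omega> h"
  by (simp add: L2_nrm_def ip_def)

lemma L2_nrm_power2: "(L2_nrm \<Omega> h)\<^sup>2 = (LINT x|lebesgue_on \<Omega>. (norm (h x))\<^sup>2)"
  by (simp add: L2_nrm_def ip_def power2_norm_eq_inner)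

lemma L2_nrm_cong_AE:
  assumes "h \<in> borel_measurable (lebesgue_on \<Omega>)" "k \<in> borel_measurable (lebesgue_on \<Omega>)"
    "AE x in lebesgue_on \<Omega>. h x = k x"
  shows "L2_nrm \<Omega> h = L2_nrm \<Omega> k"
  unfolding L2_nrm_def ip_def
proof (intro arg_cong[of _ _ sqrt] integral_cong_AE)
  show "AE x in lebesgue_on \<Omega>. h x \<bullet> h x = k x \<bullet> k x"
    using assms(3) by eventually_elim simp
qed (use assms in measurable)

lemma ip_Cauchy_Schwarz:
  assumes "h \<in> Lp 2 \<Omega>" "k \<in> Lp 2 \<Omega>"
  shows "\<bar>ip \<Omega> h k\<bar> \<le> L2_nrm \<Omega> h * L2_nrm \<Omega> k"
  unfolding ip_def L2_nrm_def
proof (rule integral_quadratic_Cauchy_Schwarz)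
  fix t
  have "h x \<bullet> h x + 2 * t * (h x \<bullet> k x) + t\<^sup>2 * (k x \<bullet> k x) = (h x + t *\<^sub>R k x) \<bullet> (h x + t *\<^sub>R k x)" for x
    by (simp add: inner_add_left inner_add_right inner_commute algebra_simps power2_eq_square)
  then show "AE x in lebesgue_on \<Omega>. 0 \<le> h x \<bullet> h x + 2 * t * (h x \<bullet> k x) + t\<^sup>2 * (k x \<bullet> k x)"
    by simp
qed (use assms in \<open>auto intro: Lp2_inner\<close>)

lemma L2_nrm_triangle:
  assumes "h \<in> Lp 2 \<Omega>" "k \<in> Lp 2 \<Omega>"
  shows "L2_nrm \<Omega> (\<lambda>x. h x + k x) \<le> L2_nrm \<Omega> h + L2_nrm \<Omega> k"
proof (rule power2_le_imp_le)
  have "(L2_nrm \<Omega> (\<lambda>x. h x + k x))\<^sup>2 = (LINT x|lebesgue_on \<Omega>. (norm (h x))\<^sup>2 + 2 * (h x \<bullet> k x) + (norm (k x))\<^sup>2)"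
    unfolding L2_nrm_power2
    by (simp add: power2_norm_eq_inner inner_add_left inner_add_right inner_commute algebra_simps)
  also have "\<dots> = (L2_nrm \<Omega> h)\<^sup>2 + 2 * ip \<Omega> h k + (L2_nrm \<Omega> k)\<^sup>2"
    using assms Lp2_inner[OF assms] by (simp add: L2_nrm_power2 ip_def Lp2_iff)
  also have "\<dots> \<le> (L2_nrm \<Omega> h + L2_nrm \<Omega> k)\<^sup>2"
    using ip_Cauchy_Schwarz[OF assms] by (simp add: power2_sum)
  finally show "(L2_nrm \<Omega> (\<lambda>x. h x + k x))\<^sup>2 \<le> (L2_nrm \<Omega> h + L2_nrm \<Omega> k)\<^sup>2" .
qed (simp add: L2_nrm_nonneg)

lemma L2_nrm_minus: "L2_nrm \<Omega> (\<lambda>x. - h x) = L2_nrm \<Omega> h"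
  by (simp add: L2_nrm_def ip_def)

section \<open>Test functions: differences, classical partial derivatives, support and
  bounds\<close>

lemma times_cont_diff_differentiable:
  assumes "times_cont_diff (Suc k) h"
  shows "(h has_derivative frechet_derivative h (at x)) (at x)"
  using assms by (simp add: differentiable_on_def frechet_derivative_works)

lemma times_cont_diff_diff:
  assumes "times_cont_diff k h" "times_cont_diff k g"
  shows "times_cont_diff k (\<lambda>x. h x - g x)"
  using assms
proof (induction k arbitrary: h g)
  case (Suc k)
  note d = times_cont_diff_differentiable[OF Suc.prems(1)] times_cont_diff_differentiable[OF Suc.prems(2)]
  have "frechet_derivative (\<lambda>x. h x - g x) (at x) =
      (\<lambda>i. frechet_derivative h (at x) i - frechet_derivative g (at x) i)" for x
    using frechet_derivative_at[OF has_derivative_diff[OF d[of x]]] by simp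
  with Suc show ?case by (auto intro: differentiable_on_diff)
qed (auto intro: continuous_on_diff)

lemma test_functions_diff:
  assumes "\<phi> \<in> test_functions \<Omega>" "\<psi> \<in> test_functions \<Omega>"
  shows "(\<lambda>x. \<phi> x - \<psi> x) \<in> test_functions \<Omega>"
proof -
  let ?S = "closure {x. \<phi> x \<noteq> 0} \<union> closure {x. \<psi> x \<noteq> 0}"
  have S: "compact ?S" "?S \<subseteq> \<Omega>" using assms by (auto simp: test_functions_def)
  have sub: "closure {x. \<phi> x - \<psi> x \<noteq> 0} \<subseteq> ?S"
    unfolding closure_Un[symmetric] by (rule closure_mono) auto
  have "compact (closure {x. \<phi> x - \<psi> x \<noteq> 0})"
    using S(1) sub by (meson closed_closure compact_imp_bounded bounded_subset compact_eq_bounded_closed)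
  with sub S(2) assms show ?thesis
    by (auto simp: test_functions_def smooth_def intro: times_cont_diff_diff)
qed

definition partial :: "'d \<Rightarrow> (real ^ 'd \<Rightarrow> real) \<Rightarrow> real ^ 'd \<Rightarrow> real" where
  "partial i \<phi> x = frechet_derivative \<phi> (at x) (axis i 1)"

text \<open>The classical gradient, as opposed to \<open>grad\<close>, which is a choice among weak
  gradients and agrees with it only almost everywhere on \<Omega>.\<close>

definition cgrad :: "(real ^ 'd \<Rightarrow> real) \<Rightarrow> real ^ 'd \<Rightarrow> real ^ 'd" where
  "cgrad \<phi> x = (\<chi> i. partial i \<phi> x)"

context
  fixes \<Omega> :: "(real ^ 'd) set" and \<phi> :: "real ^ 'd \<Rightarrow> real"
  assumes \<phi>: "\<phi> \<in> test_functions \<Omega>"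
begin

lemma test_has_derivative: "(\<phi> has_derivative frechet_derivative \<phi> (at x)) (at x)"
  using \<phi> times_cont_diff_differentiable[of 0 \<phi>] by (simp add: test_functions_def smooth_def)

lemma test_partial_line:
  "((\<lambda>t. \<phi> (x + t *\<^sub>R axis i 1)) has_real_derivative partial i \<phi> (x + t *\<^sub>R axis i 1)) (at t)"
proof -
  let ?L = "frechet_derivative \<phi> (at (x + t *\<^sub>R axis i 1))"
  have "((\<lambda>t. \<phi> (x + t *\<^sub>R axis i 1)) has_derivative (\<lambda>s. ?L (s *\<^sub>R axis i 1))) (at t)"
    by (rule has_derivative_compose[of "\<lambda>t. x + t *\<^sub>R axis i 1" "\<lambda>s. s *\<^sub>R axis i 1" t UNIV \<phi>, OF _ test_has_derivative])
       (auto intro!: derivative_eq_intros)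
  moreover have "?L (s *\<^sub>R axis i 1) = s * partial i \<phi> (x + t *\<^sub>R axis i 1)" for s
    using linear_scale[OF has_derivative_linear[OF test_has_derivative]] by (simp add: partial_def)
  ultimately show ?thesis
    by (simp add: has_field_derivative_def mult_commute_abs)
qed

lemma test_continuous: "continuous_on UNIV \<phi>"
  using \<phi> by (auto simp: test_functions_def smooth_def dest: spec[of _ 0])

lemma partial_continuous: "continuous_on UNIV (partial i \<phi>)"
proof -
  have "times_cont_diff (Suc 0) \<phi>" using \<phi> by (simp add: test_functions_def smooth_def)
  moreover have "axis i 1 \<in> (Basis :: (real ^ 'd) set)" by (simp add: axis_in_Basis_iff)
  ultimately show ?thesis by (simp add: partial_def[abs_def])
qed

lemma test_borel [measurable]: "\<phi> \<in> borel_measurable borel" "partial i \<phi> \<in> borel_measurable borel"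
  using test_continuous partial_continuous by (auto intro: borel_measurable_continuous_onI)

lemma test_support:
  obtains S where "compact S" "S \<subseteq> \<Omega>" "\<And>x. x \<notin> S \<Longrightarrow> \<phi> x = 0" "\<And>x i. x \<notin> S \<Longrightarrow> partial i \<phi> x = 0"
proof
  let ?S = "closure {x. \<phi> x \<noteq> 0}"
  show "compact ?S" "?S \<subseteq> \<Omega>" using \<phi> by (auto simp: test_functions_def)
  show z: "\<phi> x = 0" if "x \<notin> ?S" for x using that closure_subset[of "{x. \<phi> x \<noteq> 0}"] by auto
  show "partial i \<phi> x = 0" if "x \<notin> ?S" for x i
  proof -
    have "(\<phi> has_derivative (\<lambda>_. 0)) (at x)"
    proof (rule has_derivative_transform_within_open)
      show "((\<lambda>_. 0) has_derivative (\<lambda>_. 0)) (at x)" by simp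
      show "open (- ?S)" by auto
      show "x \<in> - ?S" using that by simp
      show "0 = \<phi> y" if "y \<in> - ?S" for y using z[of y] that by simp
    qed
    then have "frechet_derivative \<phi> (at x) = (\<lambda>_. 0)" by (rule frechet_derivative_at[symmetric])
    then show ?thesis by (simp add: partial_def)
  qed
qed

lemma test_bounded:
  obtains K where "\<And>x. \<bar>\<phi> x\<bar> \<le> K" "\<And>x i. \<bar>partial i \<phi> x\<bar> \<le> K"
proof -
  obtain S where S: "compact S" "\<And>x. x \<notin> S \<Longrightarrow> \<phi> x = 0" "\<And>x i. x \<notin> S \<Longrightarrow> partial i \<phi> x = 0"
    using test_support by metis
  have bd: "\<exists>K. \<forall>x. \<bar>h x\<bar> \<le> K" if "continuous_on UNIV h" "\<And>x. x \<notin> S \<Longrightarrow> h x = 0" for h :: "real ^ 'd \<Rightarrow> real"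
  proof -
    have "bounded (h ` S)"
      using S(1) that(1) by (meson compact_continuous_image compact_imp_bounded continuous_on_subset top_greatest)
    then obtain K where K: "\<And>x. x \<in> S \<Longrightarrow> \<bar>h x\<bar> \<le> K" by (auto simp: bounded_iff)
    then have "\<bar>h x\<bar> \<le> max K 0" for x using that(2)[of x] by (cases "x \<in> S") (auto simp: le_max_iff_disj)
    then show ?thesis by blast
  qed
  obtain K0 where K0: "\<And>x. \<bar>\<phi> x\<bar> \<le> K0" using bd[OF test_continuous] S by blast
  have "\<exists>K. \<forall>x. \<bar>partial i \<phi> x\<bar> \<le> K" for i using bd[OF partial_continuous] S by blast
  then obtain K1 where K1: "\<And>i x. \<bar>partial i \<phi> x\<bar> \<le> K1 i" by metis
  show thesis
  proof
    show "\<bar>\<phi> x\<bar> \<le> K0 + (\<Sum>i\<in>UNIV. \<bar>K1 i\<bar>)" for x by (rule order_trans[OF K0]) (simp add: sum_nonneg)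
    show "\<bar>partial i \<phi> x\<bar> \<le> K0 + (\<Sum>i\<in>UNIV. \<bar>K1 i\<bar>)" for x i
      using K1[where i=i and x=x] K0[of x] member_le_sum[of i UNIV "\<lambda>i. \<bar>K1 i\<bar>"] by auto
  qed
qed

end

section \<open>Weak gradients\<close>

lemma integral_lebesgue_on_eq_lborel:
  fixes h :: "'a::euclidean_space \<Rightarrow> real"
  assumes "S \<in> sets lebesgue" "h \<in> borel_measurable borel" "\<And>x. x \<notin> S \<Longrightarrow> h x = 0"
  shows "(LINT x|lebesgue_on S. h x) = (LINT x|lborel. h x)"
proof -
  have "(LINT x|lebesgue_on S. h x) = (LINT x|lebesgue. indicator S x *\<^sub>R h x)"
    using assms(1) by (subst integral_restrict_space) auto
  also have "\<dots> = (LINT x|lebesgue. h x)"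
    by (intro Bochner_Integration.integral_cong) (auto simp: assms(3) indicator_def)
  also have "\<dots> = (LINT x|lborel. h x)"
    using assms(2) by (intro integral_completion) simp
  finally show ?thesis .
qed

lemma nn_integral_lebesgue_on_eq_lborel:
  fixes h :: "'a::euclidean_space \<Rightarrow> ennreal"
  assumes "S \<in> sets lebesgue" "h \<in> borel_measurable borel" "\<And>x. x \<notin> S \<Longrightarrow> h x = 0"
  shows "(\<integral>\<^sup>+x. h x \<partial>lebesgue_on S) = (\<integral>\<^sup>+x. h x \<partial>lborel)"
proof -
  have "(\<integral>\<^sup>+x. h x \<partial>lebesgue_on S) = (\<integral>\<^sup>+x. h x * indicator S x \<partial>lebesgue)"
    using assms(1) by (subst nn_integral_restrict_space) auto
  also have "\<dots> = (\<integral>\<^sup>+x. h x \<partial>lebesgue)"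
    by (intro nn_integral_cong) (auto simp: assms(3) indicator_def)
  also have "\<dots> = (\<integral>\<^sup>+x. h x \<partial>lborel)"
    by (rule nn_integral_completion)
  finally show ?thesis .
qed

text \<open>The integrals of the difference quotients vanish by translation invariance, so no Fubini argument is
  needed for integration by parts.\<close>

lemma integral_line_derivative_eq_0:
  fixes F F' :: "'a::euclidean_space \<Rightarrow> real"
  assumes deriv: "\<And>x t. ((\<lambda>t. F (x + t *\<^sub>R e)) has_real_derivative F' (x + t *\<^sub>R e)) (at t)"
    and meas [measurable]: "F \<in> borel_measurable borel" "F' \<in> borel_measurable borel"
    and bdd: "\<And>x. \<bar>F' x\<bar> \<le> K" "\<And>x. \<bar>F x\<bar> \<le> K"
    and supp: "\<And>x. R < norm x \<Longrightarrow> F x = 0" and e: "norm e = 1"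
  shows "(LINT x|lborel. F' x) = 0"
proof -
  let ?s = "\<lambda>k. inverse (real (Suc k))"
  let ?q = "\<lambda>k x. (F (x + ?s k *\<^sub>R e) - F x) / ?s k"
  have fin: "emeasure lborel (cball (0::'a) r) < top" for r
    using emeasure_bounded_finite[of "cball (0::'a) r"] by simp
  have intF: "integrable lborel F"
  proof (rule Bochner_Integration.integrable_bound[of _ "\<lambda>x. K * indicator (cball (0::'a) R) x"])
    show "integrable lborel (\<lambda>x. K * indicator (cball (0::'a) R) x)"
      by (intro integrable_mult_right integrable_real_indicator) (auto simp: fin)
    show "AE x in lborel. norm (F x) \<le> norm (K * indicator (cball (0::'a) R) x)"
      using bdd(2) supp by (intro AE_I2) (auto simp: indicator_def abs_mult order_trans[OF _ abs_ge_self])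
  qed simp
  \<comment> \<open>The shifts have length at most 1, so all quotients vanish outside the ball of
    radius R + 1; inside it the mean value theorem bounds them by K.\<close>
  have "(\<lambda>k. LINT x|lborel. ?q k x) \<longlonglongrightarrow> (LINT x|lborel. F' x)"
  proof (rule integral_dominated_convergence[where w="\<lambda>x. K * indicator (cball (0::'a) (R + 1)) x"])
    show "integrable lborel (\<lambda>x. K * indicator (cball (0::'a) (R + 1)) x)"
      by (intro integrable_mult_right integrable_real_indicator) (auto simp: fin)
    show "AE x in lborel. (\<lambda>k. ?q k x) \<longlonglongrightarrow> F' x"
    proof (rule AE_I2)
      fix x
      have "((\<lambda>h. (F (x + h *\<^sub>R e) - F x) / h) \<longlongrightarrow> F' x) (at 0)"
        using deriv[of x 0] by (simp add: has_field_derivative_iff)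
      moreover have "filterlim ?s (at 0) sequentially"
        unfolding filterlim_at using LIMSEQ_inverse_real_of_nat by auto
      ultimately show "(\<lambda>k. ?q k x) \<longlonglongrightarrow> F' x"
        by (rule filterlim_compose)
    qed
    show "AE x in lborel. norm (?q k x) \<le> K * indicator (cball (0::'a) (R + 1)) x" for k
    proof (rule AE_I2)
      fix x
      show "norm (?q k x) \<le> K * indicator (cball (0::'a) (R + 1)) x"
      proof (cases "x \<in> cball 0 (R + 1)")
        case True
        have "\<exists>z>0. z < ?s k \<and> F (x + ?s k *\<^sub>R e) - F (x + 0 *\<^sub>R e) = (?s k - 0) * F' (x + z *\<^sub>R e)"
          by (rule MVT2) (use deriv in auto)
        then obtain z where "F (x + ?s k *\<^sub>R e) - F x = ?s k * F' (x + z *\<^sub>R e)" by auto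
        then have "?q k x = F' (x + z *\<^sub>R e)" by (simp del: of_nat_Suc)
        then show ?thesis using True bdd(1) by simp
      next
        case False
        have "norm x \<le> norm (x + ?s k *\<^sub>R e) + norm (?s k *\<^sub>R e)"
          using norm_triangle_ineq4[of "x + ?s k *\<^sub>R e" "?s k *\<^sub>R e"] by simp
        moreover have "norm (?s k *\<^sub>R e) \<le> 1" using e by (simp add: inverse_le_1_iff)
        ultimately have "R < norm (x + ?s k *\<^sub>R e)" "R < norm x" using False by auto
        then show ?thesis using supp False by simp
      qed
    qed
  qed measurable
  moreover have "(LINT x|lborel. ?q k x) = 0" for k
  proof -
    have "(LINT x|lborel. F (?s k *\<^sub>R e + x)) = (LINT x|lborel. F x)"
      by (subst (2) lborel_distr_plus[of "?s k *\<^sub>R e", symmetric], subst integral_distr) auto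
    moreover have "integrable lborel (\<lambda>x. F (?s k *\<^sub>R e + x))"
      using intF by (subst (asm) lborel_distr_plus[of "?s k *\<^sub>R e", symmetric], subst (asm) integrable_distr_eq) auto
    ultimately show ?thesis using intF
      by (simp add: add.commute[of _ "_ *\<^sub>R e"])
  qed
  ultimately show ?thesis by (simp add: LIMSEQ_const_iff)
qed

lemma cgrad_measurable:
  assumes "\<phi> \<in> test_functions \<Omega>" shows "cgrad \<phi> \<in> borel_measurable borel"
  unfolding cgrad_def[abs_def]
  by (intro borel_measurable_continuous_onI continuous_on_vec_lambda partial_continuous[OF assms])

text \<open>The integrand is the derivative of \<phi>\<psi> along the i-th axis, and this product is
  a compactly supported function on the whole space.\<close>

lemma test_integral_parts:
  fixes \<Omega> :: "(real ^ 'd) set"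
  assumes "\<Omega> \<in> sets lebesgue" and \<phi>: "\<phi> \<in> test_functions \<Omega>" and \<psi>: "\<psi> \<in> test_functions \<Omega>"
  shows "(LINT x|lebesgue_on \<Omega>. \<phi> x * partial i \<psi> x + partial i \<phi> x * \<psi> x) = 0"
proof -
  note [measurable] = test_borel[OF \<phi>] test_borel[OF \<psi>]
  let ?F' = "\<lambda>x. \<phi> x * partial i \<psi> x + partial i \<phi> x * \<psi> x"
  obtain S where S: "compact S" "S \<subseteq> \<Omega>" "\<And>x. x \<notin> S \<Longrightarrow> \<phi> x = 0" "\<And>x i. x \<notin> S \<Longrightarrow> partial i \<phi> x = 0"
    by (rule test_support[OF \<phi>]) blast
  obtain R where R: "\<And>x. x \<in> S \<Longrightarrow> norm x \<le> R"
    using compact_imp_bounded[OF S(1)] by (auto simp: bounded_iff)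
  obtain K L where K: "\<And>x. \<bar>\<phi> x\<bar> \<le> K" "\<And>x i. \<bar>partial i \<phi> x\<bar> \<le> K"
    and L: "\<And>x. \<bar>\<psi> x\<bar> \<le> L" "\<And>x i. \<bar>partial i \<psi> x\<bar> \<le> L"
    by (metis test_bounded[OF \<phi>] test_bounded[OF \<psi>])
  have pos: "0 \<le> K" "0 \<le> L" using order_trans[OF abs_ge_zero K(1)] order_trans[OF abs_ge_zero L(1)] by auto
  have "(LINT x|lborel. ?F' x) = 0"
  proof (rule integral_line_derivative_eq_0)
    show "((\<lambda>t. \<phi> (x + t *\<^sub>R axis i 1) * \<psi> (x + t *\<^sub>R axis i 1)) has_real_derivative ?F' (x + t *\<^sub>R axis i 1)) (at t)" for x t
      using DERIV_mult[OF test_partial_line[OF \<phi>, where x=x and t=t and i=i] test_partial_line[OF \<psi>, where x=x and t=t and i=i]] by (simp add: algebra_simps)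
    show "\<bar>?F' x\<bar> \<le> 2 * (K * L)" for x
    proof -
      have "\<bar>?F' x\<bar> \<le> \<bar>\<phi> x\<bar> * \<bar>partial i \<psi> x\<bar> + \<bar>partial i \<phi> x\<bar> * \<bar>\<psi> x\<bar>"
        by (metis abs_mult abs_triangle_ineq)
      also have "\<dots> \<le> K * L + K * L"
        using K L pos by (intro add_mono mult_mono) auto
      finally show ?thesis by simp
    qed
    show "\<bar>\<phi> x * \<psi> x\<bar> \<le> 2 * (K * L)" for x
      using mult_mono[OF K(1)[of x] L(1)[of x]] pos mult_nonneg_nonneg[OF pos] unfolding abs_mult by linarith
    show "\<phi> x * \<psi> x = 0" if "R < norm x" for x
      using that R[of x] S(3)[of x] by fastforce
  qed (auto simp: norm_axis_1)
  moreover have "?F' x = 0" if "x \<notin> \<Omega>" for x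
    using S(3,4)[OF contra_subsetD[OF S(2) that]] by simp
  ultimately show ?thesis
    using assms(1) by (subst integral_lebesgue_on_eq_lborel) auto
qed

locale bounded_open =
  fixes \<Omega> :: "(real ^ 'd) set"
  assumes open_\<Omega>: "open \<Omega>" and bounded_\<Omega>: "bounded \<Omega>"
begin

abbreviation "M \<equiv> lebesgue_on \<Omega>"

lemma lmeasurable_\<Omega>: "\<Omega> \<in> lmeasurable"
  using open_\<Omega> bounded_\<Omega> by (simp add: lmeasurable_open)

lemma sets_\<Omega> [simp, measurable]: "\<Omega> \<in> sets lebesgue"
  using lmeasurable_\<Omega> by auto

sublocale finite_measure M
  by (rule finite_measure_lebesgue_on[OF lmeasurable_\<Omega>])

lemma bounded_Lp2:
  assumes "h \<in> borel_measurable M" "\<And>x. norm (h x) \<le> K"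
  shows "h \<in> Lp 2 \<Omega>"
  unfolding Lp2_iff
proof
  show "integrable M (\<lambda>x. (norm (h x))\<^sup>2)"
    by (rule integrable_const_bound[of _ "K\<^sup>2"])
      (use assms in \<open>auto intro!: power_mono AE_I2\<close>)
qed fact

lemma test_Lp2:
  assumes "\<phi> \<in> test_functions \<Omega>"
  shows "\<phi> \<in> Lp 2 \<Omega>" "partial i \<phi> \<in> Lp 2 \<Omega>" "cgrad \<phi> \<in> Lp 2 \<Omega>"
proof -
  note m = test_borel[OF assms] cgrad_measurable[OF assms]
  obtain K where K: "\<And>x. \<bar>\<phi> x\<bar> \<le> K" "\<And>x i. \<bar>partial i \<phi> x\<bar> \<le> K"
    using test_bounded[OF assms] by metis
  show "\<phi> \<in> Lp 2 \<Omega>" "partial i \<phi> \<in> Lp 2 \<Omega>"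
    using K m by (auto intro!: bounded_Lp2[of _ K] borel_measurable_lebesgue_onI)
  have "norm (cgrad \<phi> x) \<le> (\<Sum>i\<in>(UNIV::'d set). K)" for x
    by (rule order_trans[OF norm_le_l1_cart]) (intro sum_mono, simp add: cgrad_def K)
  then show "cgrad \<phi> \<in> Lp 2 \<Omega>"
    using m by (intro bounded_Lp2) (auto intro!: borel_measurable_lebesgue_onI)
qed

lemma has_weak_gradientD:
  "has_weak_gradient \<Omega> v V \<Longrightarrow> \<phi> \<in> test_functions \<Omega> \<Longrightarrow>
    (LINT x|M. v x * partial i \<phi> x) = - (LINT x|M. V x $ i * \<phi> x)"
  by (simp add: has_weak_gradient_def partial_def)

lemma has_weak_gradient_diff:
  assumes "v \<in> Lp 2 \<Omega>" "V \<in> Lp 2 \<Omega>" "has_weak_gradient \<Omega> v V"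
    and "w \<in> Lp 2 \<Omega>" "W \<in> Lp 2 \<Omega>" "has_weak_gradient \<Omega> w W"
  shows "has_weak_gradient \<Omega> (\<lambda>x. v x - w x) (\<lambda>x. V x - W x)"
  unfolding has_weak_gradient_def partial_def[symmetric]
proof safe
  fix \<phi> and i :: 'd assume \<phi>: "\<phi> \<in> test_functions \<Omega>"
  note int = Lp2_mult[OF assms(1) test_Lp2(2)[OF \<phi>]] Lp2_mult[OF assms(4) test_Lp2(2)[OF \<phi>]]
    Lp2_mult[OF Lp2_component[OF assms(2)] test_Lp2(1)[OF \<phi>]] Lp2_mult[OF Lp2_component[OF assms(5)] test_Lp2(1)[OF \<phi>]]
  show "(LINT x|M. (v x - w x) * partial i \<phi> x) = - (LINT x|M. (V x - W x) $ i * \<phi> x)"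
    using has_weak_gradientD[OF assms(3) \<phi>, of i] has_weak_gradientD[OF assms(6) \<phi>, of i] int
    by (simp add: left_diff_distrib)
qed

text \<open>This is where the fundamental lemma enters: it makes the choice in \<open>grad\<close>
  immaterial up to null sets.\<close>

lemma weak_gradient_unique:
  assumes "V \<in> Lp 2 \<Omega>" "has_weak_gradient \<Omega> v V" "W \<in> Lp 2 \<Omega>" "has_weak_gradient \<Omega> v W"
  shows "AE x in M. V x = W x"
proof -
  have "AE x in M. V x $ i - W x $ i = 0" for i
  proof (rule AE_eq_0_if_test_integrals_0[OF open_\<Omega>])
    have L2: "(\<lambda>x. V x $ i - W x $ i) \<in> Lp 2 \<Omega>"
      by (intro Lp2_diff Lp2_component assms)
    \<comment> \<open>Pairing with the constant 1, which is square integrable because \<Omega> has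
      finite measure, turns square integrability into integrability.\<close>
    have "(\<lambda>x. 1::real) \<in> Lp 2 \<Omega>" by (rule bounded_Lp2[of _ 1]) auto
    from Lp2_mult[OF L2 this] show "integrable M (\<lambda>x. V x $ i - W x $ i)" by simp
    fix \<phi> assume \<phi>: "\<phi> \<in> test_functions \<Omega>"
    show "(LINT x|M. (V x $ i - W x $ i) * \<phi> x) = 0"
      using has_weak_gradientD[OF assms(2) \<phi>, of i] has_weak_gradientD[OF assms(4) \<phi>, of i]
        Lp2_mult[OF Lp2_component[OF assms(1)] test_Lp2(1)[OF \<phi>], of i] Lp2_mult[OF Lp2_component[OF assms(3)] test_Lp2(1)[OF \<phi>], of i]
      by (simp add: left_diff_distrib)
  qed
  then have "AE x in M. \<forall>i. V x $ i - W x $ i = 0" by (simp add: AE_all_countable)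
  then show ?thesis by eventually_elim (simp add: vec_eq_iff)
qed

lemma H1_grad:
  assumes "v \<in> H1 \<Omega>" shows "grad \<Omega> v \<in> Lp 2 \<Omega>" "has_weak_gradient \<Omega> v (grad \<Omega> v)"
proof -
  have "\<exists>V. V \<in> Lp 2 \<Omega> \<and> has_weak_gradient \<Omega> v V" using assms by (auto simp: H1_def)
  from someI_ex[OF this] show "grad \<Omega> v \<in> Lp 2 \<Omega>" "has_weak_gradient \<Omega> v (grad \<Omega> v)"
    by (auto simp: grad_def)
qed

lemma H1_Lp2: "v \<in> H1 \<Omega> \<Longrightarrow> v \<in> Lp 2 \<Omega>"
  by (simp add: H1_def)

lemma H1_I: "v \<in> Lp 2 \<Omega> \<Longrightarrow> V \<in> Lp 2 \<Omega> \<Longrightarrow> has_weak_gradient \<Omega> v V \<Longrightarrow> v \<in> H1 \<Omega>"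
  by (auto simp: H1_def)

lemma grad_AE_eq:
  assumes "v \<in> Lp 2 \<Omega>" "V \<in> Lp 2 \<Omega>" "has_weak_gradient \<Omega> v V"
  shows "AE x in M. grad \<Omega> v x = V x"
  using weak_gradient_unique[OF H1_grad[OF H1_I[OF assms]] assms(2,3)] .

text \<open>Since \<open>grad\<close> is a choice, additivity can only be asserted almost
  everywhere; later manipulations of gradients of differences pass through this fact.\<close>

lemma H1_diff:
  assumes "v \<in> H1 \<Omega>" "w \<in> H1 \<Omega>"
  shows "(\<lambda>x. v x - w x) \<in> H1 \<Omega>" "AE x in M. grad \<Omega> (\<lambda>x. v x - w x) x = grad \<Omega> v x - grad \<Omega> w x"
proof -
  note d = Lp2_diff[OF H1_Lp2[OF assms(1)] H1_Lp2[OF assms(2)]] Lp2_diff[OF H1_grad(1)[OF assms(1)] H1_grad(1)[OF assms(2)]]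
    has_weak_gradient_diff[OF H1_Lp2[OF assms(1)] H1_grad[OF assms(1)] H1_Lp2[OF assms(2)] H1_grad[OF assms(2)]]
  show "(\<lambda>x. v x - w x) \<in> H1 \<Omega>" using d by (rule H1_I)
  show "AE x in M. grad \<Omega> (\<lambda>x. v x - w x) x = grad \<Omega> v x - grad \<Omega> w x" using d by (rule grad_AE_eq)
qed

lemma L2_nrm_grad_diff:
  assumes "v \<in> H1 \<Omega>" "w \<in> H1 \<Omega>"
  shows "L2_nrm \<Omega> (grad \<Omega> (\<lambda>x. v x - w x)) = L2_nrm \<Omega> (\<lambda>x. grad \<Omega> v x - grad \<Omega> w x)"
  using assms by (intro L2_nrm_cong_AE H1_diff(2) Lp2_measurable Lp2_diff H1_grad H1_diff(1))

lemma test_weak_gradient: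
  assumes \<phi>: "\<phi> \<in> test_functions \<Omega>"
  shows "has_weak_gradient \<Omega> \<phi> (cgrad \<phi>)"
  unfolding has_weak_gradient_def partial_def[symmetric]
proof safe
  fix \<psi> and i :: 'd assume \<psi>: "\<psi> \<in> test_functions \<Omega>"
  show "(LINT x|M. \<phi> x * partial i \<psi> x) = - (LINT x|M. cgrad \<phi> x $ i * \<psi> x)"
    using test_integral_parts[OF sets_\<Omega> \<phi> \<psi>, of i] Lp2_mult[OF test_Lp2(1)[OF \<phi>] test_Lp2(2)[OF \<psi>], of i]
      Lp2_mult[OF test_Lp2(2)[OF \<phi>] test_Lp2(1)[OF \<psi>], of i]
    by (simp add: cgrad_def)
qed

lemma test_H1: "\<phi> \<in> test_functions \<Omega> \<Longrightarrow> \<phi> \<in> H1 \<Omega>"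
  using test_Lp2 test_weak_gradient by (blast intro: H1_I)

lemma test_grad: "\<phi> \<in> test_functions \<Omega> \<Longrightarrow> AE x in M. grad \<Omega> \<phi> x = cgrad \<phi> x"
  by (intro grad_AE_eq test_Lp2 test_weak_gradient)

lemma H1_norm_bounds:
  "L2_nrm \<Omega> v \<le> H1_norm \<Omega> v" "L2_nrm \<Omega> (grad \<Omega> v) \<le> H1_norm \<Omega> v"
  "H1_norm \<Omega> v \<le> L2_nrm \<Omega> v + L2_nrm \<Omega> (grad \<Omega> v)"
proof -
  have nn: "0 \<le> ip \<Omega> v v" "0 \<le> ip \<Omega> (grad \<Omega> v) (grad \<Omega> v)" by (auto simp: ip_def)
  then show "L2_nrm \<Omega> v \<le> H1_norm \<Omega> v" "L2_nrm \<Omega> (grad \<Omega> v) \<le> H1_norm \<Omega> v"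
    by (auto simp: L2_nrm_def H1_norm_def)
  show "H1_norm \<Omega> v \<le> L2_nrm \<Omega> v + L2_nrm \<Omega> (grad \<Omega> v)"
    unfolding L2_nrm_def H1_norm_def using nn by (rule sqrt_add_le_add_sqrt)
qed

lemma H1_norm_nonneg: "0 \<le> H1_norm \<Omega> v"
  using H1_norm_bounds(1) L2_nrm_nonneg by (rule order_trans[rotated])

section \<open>Functions with zero boundary values as limits of test functions\<close>

lemma H10_H1: "v \<in> H10 \<Omega> \<Longrightarrow> v \<in> H1 \<Omega>"
  by (simp add: H10_def)

lemma H10_approx:
  assumes "v \<in> H10 \<Omega>"
  obtains \<phi> where "\<And>k::nat. \<phi> k \<in> test_functions \<Omega>" "(\<lambda>k. L2_nrm \<Omega> (\<lambda>x. v x - \<phi> k x)) \<longlonglongrightarrow> 0"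
    "(\<lambda>k. L2_nrm \<Omega> (\<lambda>x. grad \<Omega> v x - grad \<Omega> (\<phi> k) x)) \<longlonglongrightarrow> 0"
proof -
  obtain \<phi> where \<phi>: "\<And>k::nat. \<phi> k \<in> test_functions \<Omega>" and lim: "(\<lambda>k. H1_norm \<Omega> (\<lambda>x. v x - \<phi> k x)) \<longlonglongrightarrow> 0"
    using assms by (auto simp: H10_def)
  show thesis
  proof
    show "(\<lambda>k. L2_nrm \<Omega> (\<lambda>x. v x - \<phi> k x)) \<longlonglongrightarrow> 0"
      by (rule Lim_null_comparison[OF _ lim]) (auto simp: L2_nrm_nonneg intro!: always_eventually H1_norm_bounds)
    show "(\<lambda>k. L2_nrm \<Omega> (\<lambda>x. grad \<Omega> v x - grad \<Omega> (\<phi> k) x)) \<longlonglongrightarrow> 0"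
      by (rule Lim_null_comparison[OF _ lim])
        (auto simp: L2_nrm_nonneg L2_nrm_grad_diff[OF H10_H1[OF assms] test_H1[OF \<phi>], symmetric] intro!: always_eventually H1_norm_bounds)
  qed (rule \<phi>)
qed

text \<open>Makes the errors u - u_H and z - z_H admissible in the continuous problems. The
  approximating sequences are subtracted, and the triangle inequality is applied to values and
  gradients separately.\<close>

lemma H10_diff:
  assumes v: "v \<in> H10 \<Omega>" and w: "w \<in> H10 \<Omega>"
  shows "(\<lambda>x. v x - w x) \<in> H10 \<Omega>"
proof -
  obtain \<phi> where \<phi>: "\<And>k::nat. \<phi> k \<in> test_functions \<Omega>" "(\<lambda>k. L2_nrm \<Omega> (\<lambda>x. v x - \<phi> k x)) \<longlonglongrightarrow> 0"
    "(\<lambda>k. L2_nrm \<Omega> (\<lambda>x. grad \<Omega> v x - grad \<Omega> (\<phi> k) x)) \<longlonglongrightarrow> 0"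
    by (rule H10_approx[OF v]) blast
  obtain \<psi> where \<psi>: "\<And>k::nat. \<psi> k \<in> test_functions \<Omega>" "(\<lambda>k. L2_nrm \<Omega> (\<lambda>x. w x - \<psi> k x)) \<longlonglongrightarrow> 0"
    "(\<lambda>k. L2_nrm \<Omega> (\<lambda>x. grad \<Omega> w x - grad \<Omega> (\<psi> k) x)) \<longlonglongrightarrow> 0"
    by (rule H10_approx[OF w]) blast
  note v1 = H10_H1[OF v] and w1 = H10_H1[OF w] and \<phi>1 = test_H1[OF \<phi>(1)] and \<psi>1 = test_H1[OF \<psi>(1)]
  have tri: "L2_nrm \<Omega> (\<lambda>x. (a x - b x) - (c x - d x)) \<le> L2_nrm \<Omega> (\<lambda>x. a x - c x) + L2_nrm \<Omega> (\<lambda>x. b x - d x)"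
    if "a \<in> Lp 2 \<Omega>" "b \<in> Lp 2 \<Omega>" "c \<in> Lp 2 \<Omega>" "d \<in> Lp 2 \<Omega>" for a b c d :: "real ^ 'd \<Rightarrow> 'b::euclidean_space"
    using L2_nrm_triangle[OF Lp2_diff[OF that(1,3)] Lp2_diff[OF that(4,2)]] L2_nrm_minus[of \<Omega> "\<lambda>x. b x - d x"]
    by (simp add: algebra_simps)
  let ?e = "\<lambda>k. (L2_nrm \<Omega> (\<lambda>x. v x - \<phi> k x) + L2_nrm \<Omega> (\<lambda>x. w x - \<psi> k x)) +
    (L2_nrm \<Omega> (\<lambda>x. grad \<Omega> v x - grad \<Omega> (\<phi> k) x) + L2_nrm \<Omega> (\<lambda>x. grad \<Omega> w x - grad \<Omega> (\<psi> k) x))"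
  have "H1_norm \<Omega> (\<lambda>x. (v x - w x) - (\<phi> k x - \<psi> k x)) \<le> ?e k" for k
  proof (rule order_trans[OF H1_norm_bounds(3)], rule add_mono)
    show "L2_nrm \<Omega> (\<lambda>x. v x - w x - (\<phi> k x - \<psi> k x)) \<le> L2_nrm \<Omega> (\<lambda>x. v x - \<phi> k x) + L2_nrm \<Omega> (\<lambda>x. w x - \<psi> k x)"
      by (intro tri H1_Lp2 v1 w1 \<phi>1 \<psi>1)
    have "L2_nrm \<Omega> (grad \<Omega> (\<lambda>x. v x - w x - (\<phi> k x - \<psi> k x)))
        = L2_nrm \<Omega> (\<lambda>x. grad \<Omega> v x - grad \<Omega> w x - (grad \<Omega> (\<phi> k) x - grad \<Omega> (\<psi> k) x))"
    proof (rule L2_nrm_cong_AE)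
      show "AE x in M. grad \<Omega> (\<lambda>x. v x - w x - (\<phi> k x - \<psi> k x)) x = grad \<Omega> v x - grad \<Omega> w x - (grad \<Omega> (\<phi> k) x - grad \<Omega> (\<psi> k) x)"
        using H1_diff(2)[OF H1_diff(1)[OF v1 w1] H1_diff(1)[OF \<phi>1[of k] \<psi>1[of k]]] H1_diff(2)[OF v1 w1] H1_diff(2)[OF \<phi>1[of k] \<psi>1[of k]]
        by eventually_elim simp
    qed (intro Lp2_measurable Lp2_diff H1_grad H1_diff v1 w1 \<phi>1 \<psi>1)+
    also have "\<dots> \<le> L2_nrm \<Omega> (\<lambda>x. grad \<Omega> v x - grad \<Omega> (\<phi> k) x) + L2_nrm \<Omega> (\<lambda>x. grad \<Omega> w x - grad \<Omega> (\<psi> k) x)"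
      by (intro tri H1_grad v1 w1 \<phi>1 \<psi>1)
    finally show "L2_nrm \<Omega> (grad \<Omega> (\<lambda>x. v x - w x - (\<phi> k x - \<psi> k x))) \<le> \<dots>" .
  qed
  then have "\<forall>\<^sub>F k in sequentially. norm (H1_norm \<Omega> (\<lambda>x. (v x - w x) - (\<phi> k x - \<psi> k x))) \<le> ?e k"
    by (intro always_eventually allI) (simp only: real_norm_def abs_of_nonneg[OF H1_norm_nonneg])
  moreover have "?e \<longlonglongrightarrow> 0"
    using tendsto_add[OF tendsto_add[OF \<phi>(2) \<psi>(2)] tendsto_add[OF \<phi>(3) \<psi>(3)]] by simp
  ultimately have "(\<lambda>k. H1_norm \<Omega> (\<lambda>x. (v x - w x) - (\<phi> k x - \<psi> k x))) \<longlonglongrightarrow> 0"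
    by (rule Lim_null_comparison)
  then have "(\<forall>k. (\<lambda>x. \<phi> k x - \<psi> k x) \<in> test_functions \<Omega>) \<and>
      (\<lambda>k. H1_norm \<Omega> (\<lambda>x. (v x - w x) - (\<phi> k x - \<psi> k x))) \<longlonglongrightarrow> 0"
    using test_functions_diff[OF \<phi>(1) \<psi>(1)] by blast
  then show ?thesis
    unfolding H10_def using H1_diff(1)[OF v1 w1]
    by (intro CollectI conjI exI[where x="\<lambda>k x. \<phi> k x - \<psi> k x"]) blast+
qed

end

section \<open>Sobolev inequalities for test functions\<close>

text \<open>Square root on \<open>ennreal\<close> with infinite argument allowed, so that
  Cauchy-Schwarz and Tonelli can be iterated without integrability proofs.\<close>

definition esqrt :: "ennreal \<Rightarrow> ennreal" where
  "esqrt x = (if x = top then top else ennreal (sqrt (enn2real x)))"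

lemma esqrt_power2 [simp]: "(esqrt x)\<^sup>2 = x"
  by (cases x) (auto simp: esqrt_def power2_eq_square ennreal_mult[symmetric] ennreal_top_mult)

lemma esqrt_ennreal: "0 \<le> r \<Longrightarrow> esqrt (ennreal r) = ennreal (sqrt r)"
  by (simp add: esqrt_def)

lemma esqrt_measurable [measurable]: "esqrt \<in> borel_measurable borel"
  unfolding esqrt_def[abs_def] by measurable

lemma ennreal_power2_le_imp_le:
  fixes x y :: ennreal assumes "x\<^sup>2 \<le> y\<^sup>2" shows "x \<le> y"
proof (rule ccontr)
  assume "\<not> x \<le> y"
  then have less: "y < x" by simp
  then obtain b where b: "0 \<le> b" "y = ennreal b" by (cases y) auto
  show False
  proof (cases x)
    case (real a)
    then have "b < a" using less b by (simp add: ennreal_less_iff)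
    then show False using assms real b by (simp add: ennreal_power)
  next
    case top
    then show False using assms b by (simp add: ennreal_power power2_eq_square ennreal_top_mult top_unique ennreal_mult_eq_top_iff)
  qed
qed

lemma nn_integral_esqrt_mult:
  assumes [measurable]: "f \<in> borel_measurable M" "g \<in> borel_measurable M"
  shows "(\<integral>\<^sup>+x. esqrt (f x) * esqrt (g x) \<partial>M) \<le> esqrt (\<integral>\<^sup>+x. f x \<partial>M) * esqrt (\<integral>\<^sup>+x. g x \<partial>M)"
proof (rule ennreal_power2_le_imp_le)
  show "(\<integral>\<^sup>+x. esqrt (f x) * esqrt (g x) \<partial>M)\<^sup>2 \<le> (esqrt (\<integral>\<^sup>+x. f x \<partial>M) * esqrt (\<integral>\<^sup>+x. g x \<partial>M))\<^sup>2"
    using Cauchy_Schwarz_nn_integral[of "\<lambda>x. esqrt (f x)" M "\<lambda>x. esqrt (g x)"]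
    by (simp add: power_mult_distrib)
qed

text \<open>Every variable occurs in exactly two of the three factors, so each of the integrations,
  over c, then b, then a, is one Cauchy-Schwarz inequality. \<open>P\<close>, \<open>Q\<close> and
  \<open>S\<close> are the one-variable functions that these integrations leave behind.\<close>

lemma loomis_whitney_3:
  fixes F1 F2 F3 :: "real \<times> real \<Rightarrow> ennreal"
  assumes [measurable]: "F1 \<in> borel_measurable (lborel \<Otimes>\<^sub>M lborel)" "F2 \<in> borel_measurable (lborel \<Otimes>\<^sub>M lborel)"
    "F3 \<in> borel_measurable (lborel \<Otimes>\<^sub>M lborel)"
  shows "(\<integral>\<^sup>+a. \<integral>\<^sup>+b. \<integral>\<^sup>+c. esqrt (F3 (a, b)) * (esqrt (F1 (b, c)) * esqrt (F2 (a, c))) \<partial>lborel \<partial>lborel \<partial>lborel)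
    \<le> esqrt (\<integral>\<^sup>+b. \<integral>\<^sup>+c. F1 (b, c) \<partial>lborel \<partial>lborel) * (esqrt (\<integral>\<^sup>+a. \<integral>\<^sup>+c. F2 (a, c) \<partial>lborel \<partial>lborel) *
      esqrt (\<integral>\<^sup>+a. \<integral>\<^sup>+b. F3 (a, b) \<partial>lborel \<partial>lborel))"
proof -
  define P where "P b = (\<integral>\<^sup>+c. F1 (b, c) \<partial>lborel)" for b
  define Q where "Q a = (\<integral>\<^sup>+c. F2 (a, c) \<partial>lborel)" for a
  define S where "S a = (\<integral>\<^sup>+b. F3 (a, b) \<partial>lborel)" for a
  have sect: "(\<lambda>c. F (b, c)) \<in> borel_measurable lborel"
    if "F \<in> borel_measurable (lborel \<Otimes>\<^sub>M lborel)" for F :: "real \<times> real \<Rightarrow> ennreal" and b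
    by (rule measurable_compose[OF measurable_Pair1' that]) simp
  note sect = sect[OF assms(1)] sect[OF assms(2)] sect[OF assms(3)]
  have meas [measurable]: "P \<in> borel_measurable lborel" "Q \<in> borel_measurable lborel" "S \<in> borel_measurable lborel"
    unfolding P_def[abs_def] Q_def[abs_def] S_def[abs_def] by measurable
  have "(\<integral>\<^sup>+a. \<integral>\<^sup>+b. \<integral>\<^sup>+c. esqrt (F3 (a, b)) * (esqrt (F1 (b, c)) * esqrt (F2 (a, c))) \<partial>lborel \<partial>lborel \<partial>lborel)
      = (\<integral>\<^sup>+a. \<integral>\<^sup>+b. esqrt (F3 (a, b)) * (\<integral>\<^sup>+c. esqrt (F1 (b, c)) * esqrt (F2 (a, c)) \<partial>lborel) \<partial>lborel \<partial>lborel)"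
    by (intro nn_integral_cong nn_integral_cmult) measurable
  also have "\<dots> \<le> (\<integral>\<^sup>+a. \<integral>\<^sup>+b. esqrt (F3 (a, b)) * (esqrt (P b) * esqrt (Q a)) \<partial>lborel \<partial>lborel)"
    unfolding P_def Q_def by (intro nn_integral_mono mult_left_mono nn_integral_esqrt_mult sect) simp_all
  also have "\<dots> = (\<integral>\<^sup>+a. esqrt (Q a) * (\<integral>\<^sup>+b. esqrt (F3 (a, b)) * esqrt (P b) \<partial>lborel) \<partial>lborel)"
  proof (intro nn_integral_cong)
    fix a
    have "(\<integral>\<^sup>+b. esqrt (F3 (a, b)) * (esqrt (P b) * esqrt (Q a)) \<partial>lborel)
        = (\<integral>\<^sup>+b. esqrt (Q a) * (esqrt (F3 (a, b)) * esqrt (P b)) \<partial>lborel)"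
      by (simp only: mult_ac)
    also have "\<dots> = esqrt (Q a) * (\<integral>\<^sup>+b. esqrt (F3 (a, b)) * esqrt (P b) \<partial>lborel)"
      by (intro nn_integral_cmult) measurable
    finally show "(\<integral>\<^sup>+b. esqrt (F3 (a, b)) * (esqrt (P b) * esqrt (Q a)) \<partial>lborel) = \<dots>" .
  qed
  also have "\<dots> \<le> (\<integral>\<^sup>+a. esqrt (Q a) * (esqrt (S a) * esqrt (\<integral>\<^sup>+b. P b \<partial>lborel)) \<partial>lborel)"
    unfolding S_def by (intro nn_integral_mono mult_left_mono nn_integral_esqrt_mult sect meas) simp_all
  also have "\<dots> = (\<integral>\<^sup>+a. esqrt (Q a) * esqrt (S a) \<partial>lborel) * esqrt (\<integral>\<^sup>+b. P b \<partial>lborel)"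
    unfolding mult.assoc[symmetric] by (intro nn_integral_multc) measurable
  also have "\<dots> \<le> (esqrt (\<integral>\<^sup>+a. Q a \<partial>lborel) * esqrt (\<integral>\<^sup>+a. S a \<partial>lborel)) * esqrt (\<integral>\<^sup>+b. P b \<partial>lborel)"
    by (intro mult_right_mono nn_integral_esqrt_mult) auto
  finally show ?thesis
    by (simp add: P_def Q_def S_def mult_ac)
qed

section \<open>Lebesgue measure in coordinates for dimensions one, two and three\<close>

lemma Basis_real_cart: "(Basis :: (real ^ 'd) set) = range (\<lambda>i. axis i 1)"
  by (auto simp: Basis_vec_def)

lemma prod_Basis_cart: "(\<Prod>b\<in>Basis. (x :: real ^ 'd) \<bullet> b) = (\<Prod>i\<in>UNIV. x $ i)"
  unfolding Basis_real_cart by (subst prod.reindex) (auto simp: inj_on_def axis_eq_axis inner_axis)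

lemma nn_integral_cart_1:
  assumes U: "(UNIV :: 'd set) = {i}" and f: "f \<in> borel_measurable borel"
  shows "(\<integral>\<^sup>+x. f (x :: real ^ 'd) \<partial>lborel) = (\<integral>\<^sup>+a. f (\<chi> k. a) \<partial>lborel)"
proof -
  have k: "k = i" for k :: 'd using U by auto
  let ?T = "\<lambda>a. (\<chi> k. a) :: real ^ 'd"
  have T [measurable]: "?T \<in> borel_measurable borel"
    by (intro borel_measurable_continuous_onI continuous_on_vec_lambda continuous_on_id)
  have "lborel = distr lborel borel ?T"
  proof (rule lborel_eqI)
    fix l u :: "real ^ 'd" assume le: "\<And>b. b \<in> Basis \<Longrightarrow> l \<bullet> b \<le> u \<bullet> b"
    have "l $ i \<le> u $ i" using le[of "axis i 1"] by (simp add: Basis_real_cart inner_axis)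
    moreover have "?T -` box l u = {l $ i <..< u $ i}"
      by (auto simp: mem_box_cart) (metis k)+
    ultimately show "emeasure (distr lborel borel ?T) (box l u) = ennreal (\<Prod>b\<in>Basis. (u - l) \<bullet> b)"
      unfolding prod_Basis_cart U by (simp add: emeasure_distr)
  qed simp
  then show ?thesis
    using f by (subst (asm) eq_commute, subst nn_integral_distr[of ?T, symmetric]) (auto simp: )
qed

text \<open>\<open>T\<close> identifies pairs of reals with vectors over the two-element index type.
  The push-forward of the product measure gives every box its volume, which characterises
  \<open>lborel\<close>; Tonelli's theorem then yields the iterated integral.\<close>

lemma nn_integral_cart_2:
  assumes U: "(UNIV :: 'd set) = {i, j}" "i \<noteq> j" and f: "f \<in> borel_measurable borel"
  defines "T \<equiv> \<lambda>(a, b). (\<chi> k. if k = i then a else b) :: real ^ 'd"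
  shows "T \<in> borel_measurable (lborel \<Otimes>\<^sub>M lborel)"
    "(\<integral>\<^sup>+x. f x \<partial>lborel) = (\<integral>\<^sup>+a. \<integral>\<^sup>+b. f (T (a, b)) \<partial>lborel \<partial>lborel)"
proof -
  have all_UNIV: "(\<forall>m. P m) \<longleftrightarrow> P i \<and> P j" for P :: "'d \<Rightarrow> bool"
    using U(1) by (metis UNIV_I insertE singletonD)
  have "T \<in> borel_measurable borel"
    unfolding T_def case_prod_unfold
  proof (intro borel_measurable_continuous_onI continuous_on_vec_lambda)
    show "continuous_on UNIV (\<lambda>x :: real \<times> real. if m = i then fst x else snd x)" for m
      by (cases "m = i") (auto intro!: continuous_intros)
  qed
  then show T [measurable]: "T \<in> borel_measurable (lborel \<Otimes>\<^sub>M lborel)" by (simp add: lborel_prod)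
  have lborel_T: "lborel = distr (lborel \<Otimes>\<^sub>M lborel) borel T"
  proof (rule lborel_eqI)
    fix l u :: "real ^ 'd" assume lu: "\<And>b. b \<in> Basis \<Longrightarrow> l \<bullet> b \<le> u \<bullet> b"
    have le: "l $ m \<le> u $ m" for m using lu[of "axis m 1"] by (simp add: Basis_real_cart inner_axis)
    have "T -` box l u = {l $ i <..< u $ i} \<times> {l $ j <..< u $ j}"
      using U(2) by (auto simp: T_def mem_box_cart all_UNIV)
    then show "emeasure (distr (lborel \<Otimes>\<^sub>M lborel) borel T) (box l u) = ennreal (\<Prod>b\<in>Basis. (u - l) \<bullet> b)"
      unfolding prod_Basis_cart U(1) using U(2) le
      by (simp add: emeasure_distr space_pair_measure lborel.emeasure_pair_measure_Times ennreal_mult)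
  qed simp
  have "(\<integral>\<^sup>+x. f x \<partial>lborel) = (\<integral>\<^sup>+p. f (T p) \<partial>(lborel \<Otimes>\<^sub>M lborel))"
    using nn_integral_distr[OF T, of f] f unfolding lborel_T[symmetric] by simp
  also have "\<dots> = (\<integral>\<^sup>+a. \<integral>\<^sup>+b. f (T (a, b)) \<partial>lborel \<partial>lborel)"
    by (rule lborel.nn_integral_fst[OF measurable_compose[OF T f], symmetric])
  finally show "(\<integral>\<^sup>+x. f x \<partial>lborel) = (\<integral>\<^sup>+a. \<integral>\<^sup>+b. f (T (a, b)) \<partial>lborel \<partial>lborel)" .
qed

lemma nn_integral_cart_3:
  assumes U: "(UNIV :: 'd set) = {i, j, k}" "i \<noteq> j" "i \<noteq> k" "j \<noteq> k" and f: "f \<in> borel_measurable borel"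
  defines "T \<equiv> \<lambda>(a, b, c). (\<chi> m. if m = i then a else if m = j then b else c) :: real ^ 'd"
  shows "T \<in> borel_measurable (lborel \<Otimes>\<^sub>M (lborel \<Otimes>\<^sub>M lborel))"
    "(\<integral>\<^sup>+x. f x \<partial>lborel) = (\<integral>\<^sup>+a. \<integral>\<^sup>+b. \<integral>\<^sup>+c. f (T (a, b, c)) \<partial>lborel \<partial>lborel \<partial>lborel)"
proof -
  have all_UNIV: "(\<forall>m. P m) \<longleftrightarrow> P i \<and> P j \<and> P k" for P :: "'d \<Rightarrow> bool"
    using U(1) by (metis UNIV_I insertE singletonD)
  have "T \<in> borel_measurable borel"
    unfolding T_def case_prod_unfold
  proof (intro borel_measurable_continuous_onI continuous_on_vec_lambda)
    show "continuous_on UNIV (\<lambda>x :: real \<times> real \<times> real.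
        if m = i then fst x else if m = j then fst (snd x) else snd (snd x))" for m
      by (cases "m = i"; cases "m = j") (auto intro!: continuous_intros)
  qed
  then show T [measurable]: "T \<in> borel_measurable (lborel \<Otimes>\<^sub>M (lborel \<Otimes>\<^sub>M lborel))" by (simp add: lborel_prod)
  \<comment> \<open>The second factor of the nested product is itself a product, so its
    sigma-finiteness must be supplied to the box volume and to Tonelli's theorem.\<close>
  have sf: "sigma_finite_measure (lborel \<Otimes>\<^sub>M lborel :: (real \<times> real) measure)"
    by (simp add: lborel_prod sigma_finite_lborel)
  have lborel_T: "lborel = distr (lborel \<Otimes>\<^sub>M (lborel \<Otimes>\<^sub>M lborel)) borel T"
  proof (rule lborel_eqI)
    fix l u :: "real ^ 'd" assume lu: "\<And>b. b \<in> Basis \<Longrightarrow> l \<bullet> b \<le> u \<bullet> b"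
    have le: "l $ m \<le> u $ m" for m using lu[of "axis m 1"] by (simp add: Basis_real_cart inner_axis)
    have "T -` box l u = {l $ i <..< u $ i} \<times> ({l $ j <..< u $ j} \<times> {l $ k <..< u $ k})"
      using U(2-) by (auto simp: T_def mem_box_cart all_UNIV)
    moreover have "emeasure (lborel \<Otimes>\<^sub>M (lborel \<Otimes>\<^sub>M lborel)) (A \<times> (B \<times> C)) =
        emeasure lborel A * (emeasure lborel B * emeasure lborel C)"
      if "A \<in> sets lborel" "B \<in> sets lborel" "C \<in> sets lborel" for A B C :: "real set"
      using that sigma_finite_measure.emeasure_pair_measure_Times[OF sf that(1) pair_measureI[OF that(2,3)]]
        lborel.emeasure_pair_measure_Times[OF that(2,3)] by simp
    ultimately show "emeasure (distr (lborel \<Otimes>\<^sub>M (lborel \<Otimes>\<^sub>M lborel)) borel T) (box l u) = ennreal (\<Prod>b\<in>Basis. (u - l) \<bullet> b)"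
      unfolding prod_Basis_cart U(1) using U(2-) le
      by (simp add: emeasure_distr space_pair_measure ennreal_mult)
  qed simp
  have "(\<integral>\<^sup>+x. f x \<partial>lborel) = (\<integral>\<^sup>+p. f (T p) \<partial>(lborel \<Otimes>\<^sub>M (lborel \<Otimes>\<^sub>M lborel)))"
    using nn_integral_distr[OF T, of f] f unfolding lborel_T[symmetric] by simp
  also have "\<dots> = (\<integral>\<^sup>+a. \<integral>\<^sup>+q. f (T (a, q)) \<partial>(lborel \<Otimes>\<^sub>M lborel) \<partial>lborel)"
    by (rule sigma_finite_measure.nn_integral_fst[OF sf measurable_compose[OF T f], symmetric])
  also have "\<dots> = (\<integral>\<^sup>+a. \<integral>\<^sup>+b. \<integral>\<^sup>+c. f (T (a, b, c)) \<partial>lborel \<partial>lborel \<partial>lborel)"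
    by (intro nn_integral_cong lborel.nn_integral_fst[symmetric]
        measurable_compose[OF measurable_Pair1' measurable_compose[OF T f]]) simp
  finally show "(\<integral>\<^sup>+x. f x \<partial>lborel) = (\<integral>\<^sup>+a. \<integral>\<^sup>+b. \<integral>\<^sup>+c. f (T (a, b, c)) \<partial>lborel \<partial>lborel \<partial>lborel)" .
qed

text \<open>Fundamental theorem of calculus for \<phi>^s along a coordinate line, started where
  \<phi> vanishes. The right-hand side does not depend on \<open>t0\<close>, hence it is a function
  of the other coordinates only; this is what lets products of such bounds separate.\<close>

lemma test_line_bound:
  fixes \<phi> :: "real ^ 'd \<Rightarrow> real"
  assumes \<phi>: "\<phi> \<in> test_functions \<Omega>" and s: "0 < s"
  shows "ennreal (\<bar>\<phi> (x + t0 *\<^sub>R axis i 1)\<bar> ^ s) \<le>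
    (\<integral>\<^sup>+t. ennreal (real s * \<bar>\<phi> (x + t *\<^sub>R axis i 1)\<bar> ^ (s - 1) * \<bar>partial i \<phi> (x + t *\<^sub>R axis i 1)\<bar>) \<partial>lborel)"
proof -
  let ?p = "\<lambda>t. x + t *\<^sub>R axis i 1"
  let ?h' = "\<lambda>t. real s * \<phi> (?p t) ^ (s - 1) * partial i \<phi> (?p t)"
  obtain S where S: "compact S" "\<And>x. x \<notin> S \<Longrightarrow> \<phi> x = 0"
    by (rule test_support[OF \<phi>]) blast
  obtain R where R: "\<And>x. x \<in> S \<Longrightarrow> norm x \<le> R"
    using compact_imp_bounded[OF S(1)] by (auto simp: bounded_iff)
  \<comment> \<open>The start point at parameter -T has norm at least T - norm x > R, hence lies off
    the support, and -T \<le> t0.\<close>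
  define T where "T = \<bar>R\<bar> + norm x + \<bar>t0\<bar> + 1"
  have "T \<le> norm x + norm (?p (- T))"
    using norm_triangle_ineq4[of x "?p (- T)"] by (simp add: T_def norm_axis_1)
  then have "?p (- T) \<notin> S" using R[of "?p (- T)"] by (auto simp: T_def)
  then have z: "\<phi> (?p (- T)) = 0" by (rule S(2))
  have line: "isCont ?p t" for t by (intro continuous_intros)
  have "has_bochner_integral lborel (\<lambda>t. ?h' t * indicator {- T..t0} t) (\<phi> (?p t0) ^ s - \<phi> (?p (- T)) ^ s)"
  proof (rule has_bochner_integral_FTC_Icc_real)
    show "- T \<le> t0" unfolding T_def using norm_ge_zero[of x] by linarith
    show "DERIV (\<lambda>t. \<phi> (?p t) ^ s) t :> ?h' t" for t
      using DERIV_power[OF test_partial_line[OF \<phi>, where x=x and t=t and i=i], of s] by (simp add: mult_ac)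
    show "isCont ?h' t" for t
      using test_continuous[OF \<phi>] partial_continuous[OF \<phi>, of i]
      by (intro continuous_intros isCont_o2[OF line]) (auto simp: continuous_on_eq_continuous_at)
  qed
  then have int: "integrable lborel (\<lambda>t. ?h' t * indicator {- T..t0} t)"
    and eq: "(LINT t|lborel. ?h' t * indicator {- T..t0} t) = \<phi> (?p t0) ^ s"
    using z s by (auto simp: has_bochner_integral_iff)
  have "ennreal (\<bar>\<phi> (?p t0)\<bar> ^ s) = ennreal (norm (LINT t|lborel. ?h' t * indicator {- T..t0} t))"
    unfolding eq by (simp add: power_abs)
  also have "\<dots> \<le> (\<integral>\<^sup>+t. ennreal (norm (?h' t * indicator {- T..t0} t)) \<partial>lborel)"
    by (rule integral_norm_bound_ennreal[OF int])
  also have "\<dots> \<le> (\<integral>\<^sup>+t. ennreal (real s * \<bar>\<phi> (?p t)\<bar> ^ (s - 1) * \<bar>partial i \<phi> (?p t)\<bar>) \<partial>lborel)"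
  proof (intro nn_integral_mono ennreal_leI)
    fix t
    show "norm (?h' t * indicator {- T..t0} t) \<le> real s * \<bar>\<phi> (?p t)\<bar> ^ (s - 1) * \<bar>partial i \<phi> (?p t)\<bar>"
      by (cases "t \<in> {- T..t0}") (simp_all add: abs_mult power_abs)
  qed
  finally show ?thesis .
qed


section \<open>Moments of test functions in terms of the Dirichlet integral\<close>

context bounded_open begin

definition even_moment :: "(real ^ 'd \<Rightarrow> real) \<Rightarrow> nat \<Rightarrow> real" where
  "even_moment v s = (LINT x|M. v x ^ (2 * s))"

definition dirichlet :: "(real ^ 'd \<Rightarrow> real) \<Rightarrow> real" where
  "dirichlet \<phi> = (LINT x|M. (norm (cgrad \<phi> x))\<^sup>2)"

lemma dirichlet_nonneg: "0 \<le> dirichlet \<phi>"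
  by (simp add: dirichlet_def)

lemma even_moment_nonneg: "0 \<le> even_moment v s"
  by (simp add: even_moment_def)

lemma test_nn_integral_power:
  assumes \<phi>: "\<phi> \<in> test_functions \<Omega>"
  shows "(\<integral>\<^sup>+x. ennreal (\<phi> x ^ (2 * s)) \<partial>M) = ennreal (even_moment \<phi> s)"
  unfolding even_moment_def
proof (rule nn_integral_eq_integral)
  have [measurable]: "\<phi> \<in> borel_measurable M"
    using test_borel(1)[OF \<phi>] by (rule borel_measurable_lebesgue_onI)
  obtain K where K: "\<And>x. \<bar>\<phi> x\<bar> \<le> K"
    by (rule test_bounded[OF \<phi>]) blast
  show "integrable M (\<lambda>x. \<phi> x ^ (2 * s))"
  proof (rule integrable_const_bound[of _ "K ^ (2 * s)"])
    show "AE x in M. norm (\<phi> x ^ (2 * s)) \<le> K ^ (2 * s)"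
      using K by (intro AE_I2) (simp add: power_abs power_mono del: power_even_abs_numeral)
  qed measurable
qed simp

text \<open>The integrand of the line bound for \<phi>^s along axis i, kept in
  \<open>ennreal\<close> so that the order of integration may be changed freely.\<close>

definition line_density :: "nat \<Rightarrow> 'd \<Rightarrow> (real ^ 'd \<Rightarrow> real) \<Rightarrow> real ^ 'd \<Rightarrow> ennreal" where
  "line_density s i \<phi> x = ennreal (real s * \<bar>\<phi> x\<bar> ^ (s - 1) * \<bar>partial i \<phi> x\<bar>)"

lemma line_density_measurable:
  assumes \<phi>: "\<phi> \<in> test_functions \<Omega>"
  shows "line_density s i \<phi> \<in> borel_measurable borel"
  unfolding line_density_def[abs_def] using test_borel[OF \<phi>] by measurable

text \<open>Cauchy-Schwarz separates |\<phi>|^(s-1) from the partial derivative. The resulting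
  moment of exponent 2(s-1) is the volume for s = 1, one step lower in an induction for general s,
  and for s = 4 the very moment of exponent 6 that the three-dimensional inequality
  estimates.\<close>

lemma line_density_integral:
  assumes \<phi>: "\<phi> \<in> test_functions \<Omega>"
  shows "(\<integral>\<^sup>+x. line_density s i \<phi> x \<partial>lborel) \<le> ennreal (real s * sqrt (even_moment \<phi> (s - 1)) * sqrt (dirichlet \<phi>))"
proof -
  note [measurable] = borel_measurable_lebesgue_onI[OF test_borel(1)[OF \<phi>]] borel_measurable_lebesgue_onI[OF test_borel(2)[OF \<phi>]]
  have "line_density s i \<phi> x = 0" if "x \<notin> \<Omega>" for x
    using that by (rule_tac test_support[OF \<phi>]) (auto simp: line_density_def)
  then have "(\<integral>\<^sup>+x. line_density s i \<phi> x \<partial>lborel) = (\<integral>\<^sup>+x. line_density s i \<phi> x \<partial>M)"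
    by (intro nn_integral_lebesgue_on_eq_lborel[symmetric] line_density_measurable[OF \<phi>]) auto
  also have "\<dots> = (\<integral>\<^sup>+x. ennreal (real s) * (esqrt (ennreal (\<phi> x ^ (2 * (s - 1)))) * esqrt (ennreal ((partial i \<phi> x)\<^sup>2))) \<partial>M)"
  proof (rule nn_integral_cong)
    fix x
    have "sqrt (\<phi> x ^ (2 * (s - 1))) = \<bar>\<phi> x\<bar> ^ (s - 1)"
      by (simp add: power_even_eq power_abs)
    then show "line_density s i \<phi> x = ennreal (real s) * (esqrt (ennreal (\<phi> x ^ (2 * (s - 1)))) * esqrt (ennreal ((partial i \<phi> x)\<^sup>2)))"
      by (simp add: line_density_def esqrt_ennreal ennreal_mult mult.assoc)
  qed
  also have "\<dots> = ennreal (real s) * (\<integral>\<^sup>+x. esqrt (ennreal (\<phi> x ^ (2 * (s - 1)))) * esqrt (ennreal ((partial i \<phi> x)\<^sup>2)) \<partial>M)"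
    by (intro nn_integral_cmult) measurable
  also have "\<dots> \<le> ennreal (real s) * (esqrt (\<integral>\<^sup>+x. ennreal (\<phi> x ^ (2 * (s - 1))) \<partial>M) * esqrt (\<integral>\<^sup>+x. ennreal ((partial i \<phi> x)\<^sup>2) \<partial>M))"
    by (intro mult_left_mono nn_integral_esqrt_mult) auto
  also have "(\<integral>\<^sup>+x. ennreal ((partial i \<phi> x)\<^sup>2) \<partial>M) = ennreal (LINT x|M. (partial i \<phi> x)\<^sup>2)"
    using test_Lp2(2)[OF \<phi>, of i] by (intro nn_integral_eq_integral) (auto simp: Lp2_iff)
  also have "(\<integral>\<^sup>+x. ennreal (\<phi> x ^ (2 * (s - 1))) \<partial>M) = ennreal (even_moment \<phi> (s - 1))"
    by (rule test_nn_integral_power[OF \<phi>])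
  also have "ennreal (real s) * (esqrt (ennreal (even_moment \<phi> (s - 1))) * esqrt (ennreal (LINT x|M. (partial i \<phi> x)\<^sup>2)))
     = ennreal (real s * sqrt (even_moment \<phi> (s - 1)) * sqrt (LINT x|M. (partial i \<phi> x)\<^sup>2))"
    by (simp add: esqrt_ennreal even_moment_nonneg ennreal_mult mult.assoc)
  also have "\<dots> \<le> ennreal (real s * sqrt (even_moment \<phi> (s - 1)) * sqrt (dirichlet \<phi>))"
  proof (intro ennreal_leI mult_left_mono real_sqrt_le_mono)
    show "(LINT x|M. (partial i \<phi> x)\<^sup>2) \<le> dirichlet \<phi>"
      unfolding dirichlet_def
    proof (rule integral_mono)
      show "(partial i \<phi> x)\<^sup>2 \<le> (norm (cgrad \<phi> x))\<^sup>2" for x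
        using component_le_norm_cart[of "cgrad \<phi> x" i] by (simp add: cgrad_def abs_le_square_iff[symmetric])
    qed (use test_Lp2[OF \<phi>] in \<open>auto simp: Lp2_iff\<close>)
  qed (simp add: even_moment_nonneg)
  finally show ?thesis .
qed

text \<open>In one dimension the line bound with s = 1 is already the uniform bound |\<phi>| \<le>
  sqrt (vol * dirichlet); raising it to the power 2s and integrating contributes one more factor of
  the volume.\<close>

lemma test_sobolev_1:
  assumes U: "(UNIV :: 'd set) = {i}" and \<phi>: "\<phi> \<in> test_functions \<Omega>"
  shows "even_moment \<phi> s \<le> measure lebesgue \<Omega> ^ (s + 1) * dirichlet \<phi> ^ s"
proof -
  let ?D = "sqrt (measure lebesgue \<Omega>) * sqrt (dirichlet \<phi>)"
  have p0: "even_moment \<phi> 0 = measure lebesgue \<Omega>"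
    by (simp add: even_moment_def measure_restrict_space)
  have bound: "\<bar>\<phi> x\<bar> \<le> ?D" for x
  proof -
    have eq: "(axis i 1 :: real ^ 'd) = (\<chi> k. 1)" using U by (auto simp: vec_eq_iff axis_def)
    have line: "0 + t *\<^sub>R axis i 1 = ((\<chi> k. t) :: real ^ 'd)" for t
      unfolding eq by (simp add: vec_eq_iff)
    have x: "x = 0 + (x $ i) *\<^sub>R axis i 1"
      unfolding line using U by (simp add: vec_eq_iff) (metis UNIV_I singletonD)
    have "ennreal \<bar>\<phi> x\<bar> \<le> (\<integral>\<^sup>+t. line_density 1 i \<phi> (0 + t *\<^sub>R axis i 1) \<partial>lborel)"
      using test_line_bound[OF \<phi>, of 1 0 "x $ i" i] x by (simp add: line_density_def)
    also have "\<dots> = (\<integral>\<^sup>+x. line_density 1 i \<phi> x \<partial>lborel)"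
      unfolding line by (rule nn_integral_cart_1[OF U line_density_measurable[OF \<phi>], symmetric])
    also have "\<dots> \<le> ennreal ?D"
      using line_density_integral[OF \<phi>, of 1 i] by (simp add: p0)
    finally have "ennreal \<bar>\<phi> x\<bar> \<le> ennreal ?D" .
    then show ?thesis
      by (rule ennreal_le_iff[THEN iffD1, rotated]) (simp add: dirichlet_nonneg)
  qed
  have "even_moment \<phi> s \<le> (LINT x|M. (?D\<^sup>2) ^ s)"
    unfolding even_moment_def
  proof (rule integral_mono')
    show "\<phi> x ^ (2 * s) \<le> (?D\<^sup>2) ^ s" for x
    proof -
      have "(\<phi> x)\<^sup>2 \<le> ?D\<^sup>2"
        using bound[of x] by (rule abs_le_square_iff[THEN iffD1, OF order_trans[OF _ abs_ge_self]])
      then show ?thesis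
        unfolding power_mult by (rule power_mono) simp
    qed
  qed auto
  also have "\<dots> = measure lebesgue \<Omega> ^ (s + 1) * dirichlet \<phi> ^ s"
    by (simp add: measure_restrict_space power_mult_distrib dirichlet_nonneg)
  finally show ?thesis .
qed

text \<open>\<phi>^(2s) is the product of two copies of |\<phi>|^s, one bounded by a function of b,
  the other by a function of a, so the double integral factorises. Each factor contains the root of
  the moment of order s - 1, whence a recursion.\<close>

lemma test_sobolev_2_step:
  assumes U: "(UNIV :: 'd set) = {i, j}" "i \<noteq> j" and \<phi>: "\<phi> \<in> test_functions \<Omega>" and s: "0 < s"
  shows "even_moment \<phi> s \<le> (real s)\<^sup>2 * even_moment \<phi> (s - 1) * dirichlet \<phi>"
proof -
  define T where "T = (\<lambda>(a, b). (\<chi> k. if k = i then a else b) :: real ^ 'd)"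
  note T = nn_integral_cart_2[OF U, folded T_def]
  \<comment> \<open>Measurability of \<open>T\<close> was proved under a premise on an integrand; a
    constant function discharges it.\<close>
  note T_meas [measurable] = T(1)[OF borel_measurable_const]
  note [measurable] = line_density_measurable[OF \<phi>] test_borel(1)[OF \<phi>]
  let ?D = "real s * sqrt (even_moment \<phi> (s - 1)) * sqrt (dirichlet \<phi>)"
  have line: "T (0, b) + a *\<^sub>R axis i 1 = T (a, b)" "T (a, 0) + b *\<^sub>R axis j 1 = T (a, b)" for a b
    using U by (auto simp: T_def vec_eq_iff axis_def)
  define F1 where "F1 b = (\<integral>\<^sup>+a. line_density s i \<phi> (T (a, b)) \<partial>lborel)" for b
  define F2 where "F2 a = (\<integral>\<^sup>+b. line_density s j \<phi> (T (a, b)) \<partial>lborel)" for a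
  have [measurable]: "F1 \<in> borel_measurable lborel" "F2 \<in> borel_measurable lborel"
    unfolding F1_def[abs_def] F2_def[abs_def] by measurable
  have b1: "ennreal (\<bar>\<phi> (T (a, b))\<bar> ^ s) \<le> F1 b" for a b
    using test_line_bound[OF \<phi> s, of "T (0, b)" a i] by (simp add: line F1_def line_density_def)
  have b2: "ennreal (\<bar>\<phi> (T (a, b))\<bar> ^ s) \<le> F2 a" for a b
    using test_line_bound[OF \<phi> s, of "T (a, 0)" b j] by (simp add: line F2_def line_density_def)
  have I1: "(\<integral>\<^sup>+b. F1 b \<partial>lborel) \<le> ennreal ?D"
    using line_density_integral[OF \<phi>, of s i] unfolding F1_def
    by (subst lborel_pair.Fubini'[symmetric]) (auto simp: T(2)[OF line_density_measurable[OF \<phi>]])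
  have I2: "(\<integral>\<^sup>+a. F2 a \<partial>lborel) \<le> ennreal ?D"
    using line_density_integral[OF \<phi>, of s j] unfolding F2_def
    by (simp add: T(2)[OF line_density_measurable[OF \<phi>]])
  have "ennreal (even_moment \<phi> s) = (\<integral>\<^sup>+x. ennreal (\<phi> x ^ (2 * s)) \<partial>M)"
    by (rule test_nn_integral_power[OF \<phi>, symmetric])
  also have "\<dots> = (\<integral>\<^sup>+x. ennreal (\<phi> x ^ (2 * s)) \<partial>lborel)"
  proof (rule nn_integral_lebesgue_on_eq_lborel)
    show "ennreal (\<phi> x ^ (2 * s)) = 0" if "x \<notin> \<Omega>" for x
      using that s by (rule_tac test_support[OF \<phi>]) auto
  qed auto
  also have "\<dots> = (\<integral>\<^sup>+a. \<integral>\<^sup>+b. ennreal (\<phi> (T (a, b)) ^ (2 * s)) \<partial>lborel \<partial>lborel)"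
    by (rule T(2)) measurable
  also have "\<dots> \<le> (\<integral>\<^sup>+a. \<integral>\<^sup>+b. F1 b * F2 a \<partial>lborel \<partial>lborel)"
  proof (intro nn_integral_mono)
    fix a b
    have "ennreal (\<phi> (T (a, b)) ^ (2 * s)) = ennreal (\<bar>\<phi> (T (a, b))\<bar> ^ s) * ennreal (\<bar>\<phi> (T (a, b))\<bar> ^ s)"
      by (simp add: ennreal_mult[symmetric] power_add[symmetric] mult_2[symmetric] power_mult)
    also have "\<dots> \<le> F1 b * F2 a" by (intro mult_mono b1 b2) auto
    finally show "ennreal (\<phi> (T (a, b)) ^ (2 * s)) \<le> F1 b * F2 a" .
  qed
  also have "\<dots> = (\<integral>\<^sup>+b. F1 b \<partial>lborel) * (\<integral>\<^sup>+a. F2 a \<partial>lborel)"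
    by (simp add: nn_integral_multc nn_integral_cmult)
  also have "\<dots> \<le> ennreal ?D * ennreal ?D"
    by (intro mult_mono I1 I2) auto
  also have "\<dots> = ennreal ((real s)\<^sup>2 * even_moment \<phi> (s - 1) * dirichlet \<phi>)"
    by (simp add: ennreal_mult[symmetric] even_moment_nonneg dirichlet_nonneg power2_eq_square mult_ac)
  finally show ?thesis
    by (subst (asm) ennreal_le_iff) (auto simp: dirichlet_nonneg even_moment_nonneg)
qed

text \<open>The recursion stops at the zeroth moment, which is the volume, and the factors s^2
  accumulate to (s!)^2.\<close>

lemma test_sobolev_2:
  assumes U: "(UNIV :: 'd set) = {i, j}" "i \<noteq> j" and \<phi>: "\<phi> \<in> test_functions \<Omega>"
  shows "even_moment \<phi> s \<le> (fact s)\<^sup>2 * measure lebesgue \<Omega> * dirichlet \<phi> ^ s"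
proof (induction s)
  case 0
  show ?case by (simp add: even_moment_def measure_restrict_space)
next
  case (Suc s)
  have "even_moment \<phi> (Suc s) \<le> (real (Suc s))\<^sup>2 * even_moment \<phi> s * dirichlet \<phi>"
    using test_sobolev_2_step[OF U \<phi>, of "Suc s"] by simp
  also have "\<dots> \<le> (real (Suc s))\<^sup>2 * ((fact s)\<^sup>2 * measure lebesgue \<Omega> * dirichlet \<phi> ^ s) * dirichlet \<phi>"
    by (intro mult_right_mono mult_left_mono Suc dirichlet_nonneg) auto
  also have "\<dots> = (fact (Suc s))\<^sup>2 * measure lebesgue \<Omega> * dirichlet \<phi> ^ Suc s"
    by (simp add: power_mult_distrib mult_ac del: of_nat_Suc)
  finally show ?case .
qed

text \<open>Gagliardo--Nirenberg: \<open>\<phi>\<^sup>4\<close> is bounded by each of its three line integrals, and the Loomis--Whitney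
  inequality gives \<open>X \<le> (4 X\<^bsup>1/2\<^esup> G\<^bsup>1/2\<^esup>)\<^bsup>3/2\<^esup>\<close> with \<open>X = \<integral>\<phi>\<^sup>6\<close>, \<open>G = \<integral>|\<nabla>\<phi>|\<^sup>2\<close>.\<close>

lemma test_sobolev_3:
  assumes U: "(UNIV :: 'd set) = {i, j, k}" "i \<noteq> j" "i \<noteq> k" "j \<noteq> k" and \<phi>: "\<phi> \<in> test_functions \<Omega>"
  shows "even_moment \<phi> 3 \<le> 4096 * dirichlet \<phi> ^ 3"
proof -
  define T where "T = (\<lambda>(a, b, c). (\<chi> m. if m = i then a else if m = j then b else c) :: real ^ 'd)"
  note T = nn_integral_cart_3[OF U, folded T_def]
  note T_meas [measurable] = T(1)[OF borel_measurable_const]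
  note [measurable] = line_density_measurable[OF \<phi>] test_borel(1)[OF \<phi>]
  let ?X = "even_moment \<phi> 3" and ?G = "dirichlet \<phi>"
  let ?D = "4 * sqrt ?X * sqrt ?G"
  have line: "T (0, b, c) + a *\<^sub>R axis i 1 = T (a, b, c)" "T (a, 0, c) + b *\<^sub>R axis j 1 = T (a, b, c)"
     "T (a, b, 0) + c *\<^sub>R axis k 1 = T (a, b, c)" for a b c
    using U by (auto simp: T_def vec_eq_iff axis_def)
  define F1 where "F1 = (\<lambda>(b, c). \<integral>\<^sup>+a. line_density 4 i \<phi> (T (a, b, c)) \<partial>lborel)"
  define F2 where "F2 = (\<lambda>(a, c). \<integral>\<^sup>+b. line_density 4 j \<phi> (T (a, b, c)) \<partial>lborel)"
  define F3 where "F3 = (\<lambda>(a, b). \<integral>\<^sup>+c. line_density 4 k \<phi> (T (a, b, c)) \<partial>lborel)"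
  have meas [measurable]: "F1 \<in> borel_measurable (lborel \<Otimes>\<^sub>M lborel)" "F2 \<in> borel_measurable (lborel \<Otimes>\<^sub>M lborel)"
    "F3 \<in> borel_measurable (lborel \<Otimes>\<^sub>M lborel)"
    unfolding F1_def F2_def F3_def case_prod_unfold by measurable
  have b1: "ennreal (\<bar>\<phi> (T (a, b, c))\<bar> ^ 4) \<le> F1 (b, c)" for a b c
    using test_line_bound[OF \<phi>, of 4 "T (0, b, c)" a i] by (simp add: line F1_def line_density_def)
  have b2: "ennreal (\<bar>\<phi> (T (a, b, c))\<bar> ^ 4) \<le> F2 (a, c)" for a b c
    using test_line_bound[OF \<phi>, of 4 "T (a, 0, c)" b j] by (simp add: line F2_def line_density_def)
  have b3: "ennreal (\<bar>\<phi> (T (a, b, c))\<bar> ^ 4) \<le> F3 (a, b)" for a b c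
    using test_line_bound[OF \<phi>, of 4 "T (a, b, 0)" c k] by (simp add: line F3_def line_density_def)
  note D = line_density_integral[OF \<phi>, of 4, simplified, unfolded T(2)[OF line_density_measurable[OF \<phi>]]]
  have I3: "(\<integral>\<^sup>+a. \<integral>\<^sup>+b. F3 (a, b) \<partial>lborel \<partial>lborel) \<le> ennreal ?D"
    using D[of k] by (simp add: F3_def)
  have I2: "(\<integral>\<^sup>+a. \<integral>\<^sup>+c. F2 (a, c) \<partial>lborel \<partial>lborel) \<le> ennreal ?D"
  proof -
    have "(\<integral>\<^sup>+c. F2 (a, c) \<partial>lborel) = (\<integral>\<^sup>+b. \<integral>\<^sup>+c. line_density 4 j \<phi> (T (a, b, c)) \<partial>lborel \<partial>lborel)" for a
      unfolding F2_def prod.case by (rule lborel_pair.Fubini') measurable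
    then show ?thesis using D[of j] by simp
  qed
  have I1: "(\<integral>\<^sup>+b. \<integral>\<^sup>+c. F1 (b, c) \<partial>lborel \<partial>lborel) \<le> ennreal ?D"
  proof -
    have "(\<integral>\<^sup>+b. \<integral>\<^sup>+c. F1 (b, c) \<partial>lborel \<partial>lborel)
        = (\<integral>\<^sup>+b. \<integral>\<^sup>+a. \<integral>\<^sup>+c. line_density 4 i \<phi> (T (a, b, c)) \<partial>lborel \<partial>lborel \<partial>lborel)"
      unfolding F1_def prod.case by (intro nn_integral_cong lborel_pair.Fubini') measurable
    also have "\<dots> = (\<integral>\<^sup>+a. \<integral>\<^sup>+b. \<integral>\<^sup>+c. line_density 4 i \<phi> (T (a, b, c)) \<partial>lborel \<partial>lborel \<partial>lborel)"
      by (rule lborel_pair.Fubini') measurable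
    finally show ?thesis using D[of i] by simp
  qed
  have "ennreal ?X = (\<integral>\<^sup>+x. ennreal (\<phi> x ^ (2 * 3)) \<partial>M)"
    by (rule test_nn_integral_power[OF \<phi>, symmetric])
  also have "\<dots> = (\<integral>\<^sup>+x. ennreal (\<phi> x ^ (2 * 3)) \<partial>lborel)"
  proof (rule nn_integral_lebesgue_on_eq_lborel)
    show "ennreal (\<phi> x ^ (2 * 3)) = 0" if "x \<notin> \<Omega>" for x
      using that by (rule_tac test_support[OF \<phi>]) auto
  qed auto
  also have "\<dots> = (\<integral>\<^sup>+a. \<integral>\<^sup>+b. \<integral>\<^sup>+c. ennreal (\<phi> (T (a, b, c)) ^ (2 * 3)) \<partial>lborel \<partial>lborel \<partial>lborel)"
    by (rule T(2)) measurable
  also have "\<dots> \<le> (\<integral>\<^sup>+a. \<integral>\<^sup>+b. \<integral>\<^sup>+c. esqrt (F3 (a, b)) * (esqrt (F1 (b, c)) * esqrt (F2 (a, c))) \<partial>lborel \<partial>lborel \<partial>lborel)"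
  proof (intro nn_integral_mono, rule ennreal_power2_le_imp_le)
    fix a b c
    let ?y = "\<bar>\<phi> (T (a, b, c))\<bar>"
    \<comment> \<open>Comparing squares removes the roots: \<phi>^12 is a product of three copies of
      \<phi>^4, one for each line bound.\<close>
    have "(ennreal (\<phi> (T (a, b, c)) ^ (2 * 3)))\<^sup>2 = ennreal (?y ^ 4) * (ennreal (?y ^ 4) * ennreal (?y ^ 4))"
    proof -
      have "(\<phi> (T (a, b, c)) ^ (2 * 3))\<^sup>2 = ?y ^ 4 * (?y ^ 4 * ?y ^ 4)"
        unfolding power_even_abs_numeral[OF even_numeral] by (simp add: eval_nat_numeral)
      then have "(ennreal (\<phi> (T (a, b, c)) ^ (2 * 3)))\<^sup>2 = ennreal (?y ^ 4 * (?y ^ 4 * ?y ^ 4))"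
        unfolding ennreal_power[OF zero_le_even_power'] by (rule arg_cong)
      also have "\<dots> = ennreal (?y ^ 4) * (ennreal (?y ^ 4) * ennreal (?y ^ 4))"
        by (simp only: ennreal_mult' zero_le_power abs_ge_zero)
      finally show ?thesis .
    qed
    also have "\<dots> \<le> F3 (a, b) * (F1 (b, c) * F2 (a, c))"
      by (intro mult_mono b1 b2 b3) auto
    finally show "(ennreal (\<phi> (T (a, b, c)) ^ (2 * 3)))\<^sup>2 \<le> (esqrt (F3 (a, b)) * (esqrt (F1 (b, c)) * esqrt (F2 (a, c))))\<^sup>2"
      by (simp add: power_mult_distrib)
  qed
  also have "\<dots> \<le> esqrt (\<integral>\<^sup>+b. \<integral>\<^sup>+c. F1 (b, c) \<partial>lborel \<partial>lborel) * (esqrt (\<integral>\<^sup>+a. \<integral>\<^sup>+c. F2 (a, c) \<partial>lborel \<partial>lborel) *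
      esqrt (\<integral>\<^sup>+a. \<integral>\<^sup>+b. F3 (a, b) \<partial>lborel \<partial>lborel))"
    by (rule loomis_whitney_3[OF meas])
  finally have "(ennreal ?X)\<^sup>2 \<le> (esqrt (\<integral>\<^sup>+b. \<integral>\<^sup>+c. F1 (b, c) \<partial>lborel \<partial>lborel) * (esqrt (\<integral>\<^sup>+a. \<integral>\<^sup>+c. F2 (a, c) \<partial>lborel \<partial>lborel) *
      esqrt (\<integral>\<^sup>+a. \<integral>\<^sup>+b. F3 (a, b) \<partial>lborel \<partial>lborel)))\<^sup>2"
    by (rule power_mono) simp
  also have "\<dots> \<le> ennreal ?D * (ennreal ?D * ennreal ?D)"
    unfolding power_mult_distrib esqrt_power2 by (intro mult_mono I1 I2 I3) auto
  also have "\<dots> = ennreal (?D ^ 3)"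
    by (simp add: ennreal_mult[symmetric] even_moment_nonneg dirichlet_nonneg power3_eq_cube)
  finally have "?X\<^sup>2 \<le> ?D ^ 3"
    by (simp add: ennreal_power even_moment_nonneg dirichlet_nonneg)
  \<comment> \<open>A further squaring eliminates the roots in \<open>?D\<close>: X^4 \<le> (16 X
    G)^3, and 16^3 = 4096. Then X^3 is cancelled; X is a real number because \<phi> is bounded, and
    X = 0 is trivial.\<close>
  then have "(?X\<^sup>2)\<^sup>2 \<le> (?D ^ 3)\<^sup>2" by (intro power_mono) auto
  also have "\<dots> = (?D\<^sup>2) ^ 3" by (simp add: power_mult[symmetric])
  also have "?D\<^sup>2 = 16 * ?X * ?G" by (simp add: power_mult_distrib even_moment_nonneg dirichlet_nonneg)
  finally have *: "?X ^ 3 * ?X \<le> ?X ^ 3 * (4096 * ?G ^ 3)"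
    by (simp add: power_mult_distrib eval_nat_numeral mult_ac)
  show ?thesis
  proof (cases "?X = 0")
    case False
    then have "0 < ?X ^ 3" using even_moment_nonneg[of \<phi> 3] by simp
    then show ?thesis using * by (simp only: mult_le_cancel_left_pos)
  qed (simp add: dirichlet_nonneg)
qed

end

text \<open>A common upper bound for the constants of the one-, two- and three-dimensional inequalities.\<close>

definition sobolev_const :: "nat \<Rightarrow> real \<Rightarrow> real" where
  "sobolev_const k vol = 1 + vol + vol ^ (k + 1) + (fact k)\<^sup>2 * vol + 4096"

lemma sobolev_const_ge_1: "0 \<le> vol \<Longrightarrow> 1 \<le> sobolev_const k vol"
  by (simp add: sobolev_const_def)

section \<open>From test functions to \<open>H10\<close> and from even to general exponents\<close>

context bounded_open begin

text \<open>A subsequence of the approximating test functions converges almost everywhere, and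
  Fatou's lemma passes the bound to the limit; integrability of v^(2s) comes out of the same
  estimate.\<close>

lemma H10_even_moment:
  assumes v: "v \<in> H10 \<Omega>" and C: "\<And>\<phi>. \<phi> \<in> test_functions \<Omega> \<Longrightarrow> even_moment \<phi> s \<le> C * dirichlet \<phi> ^ s"
    and C0: "0 \<le> C"
  shows "integrable M (\<lambda>x. v x ^ (2 * s))" "even_moment v s \<le> C * L2_nrm \<Omega> (grad \<Omega> v) ^ (2 * s)"
proof -
  obtain \<phi> where \<phi>: "\<And>k::nat. \<phi> k \<in> test_functions \<Omega>" and lim0: "(\<lambda>k. L2_nrm \<Omega> (\<lambda>x. v x - \<phi> k x)) \<longlonglongrightarrow> 0"
    and lim1: "(\<lambda>k. L2_nrm \<Omega> (\<lambda>x. grad \<Omega> v x - grad \<Omega> (\<phi> k) x)) \<longlonglongrightarrow> 0"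
    by (rule H10_approx[OF v]) blast
  note v2 = H1_Lp2[OF H10_H1[OF v]] and v1 = H1_grad(1)[OF H10_H1[OF v]]
  have [measurable]: "v \<in> borel_measurable M" "\<phi> k \<in> borel_measurable M" for k
    using Lp2_measurable[OF v2] Lp2_measurable[OF test_Lp2(1)[OF \<phi>]] by auto
  have "(\<lambda>k. (L2_nrm \<Omega> (\<lambda>x. v x - \<phi> k x))\<^sup>2) \<longlonglongrightarrow> 0\<^sup>2"
    by (intro tendsto_power lim0)
  then have "(\<lambda>k. LINT x|M. norm ((v x - \<phi> k x)\<^sup>2)) \<longlonglongrightarrow> 0"
    by (simp add: L2_nrm_power2)
  moreover have "integrable M (\<lambda>x. (v x - \<phi> k x)\<^sup>2)" for k
    using Lp2_diff[OF v2 test_Lp2(1)[OF \<phi>]] by (auto simp: Lp2_iff)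
  ultimately obtain r :: "nat \<Rightarrow> nat" where r: "strict_mono r" and ae: "AE x in M. (\<lambda>k. (v x - \<phi> (r k) x)\<^sup>2) \<longlonglongrightarrow> 0"
    using tendsto_L1_AE_subseq[of M "\<lambda>k x. (v x - \<phi> k x)\<^sup>2"] by auto
  have aev: "AE x in M. (\<lambda>k. ennreal (\<phi> (r k) x ^ (2 * s))) \<longlonglongrightarrow> ennreal (v x ^ (2 * s))"
    using ae
  proof eventually_elim
    case (elim x)
    have "(\<lambda>k. sqrt ((v x - \<phi> (r k) x)\<^sup>2)) \<longlonglongrightarrow> sqrt 0"
      by (intro tendsto_real_sqrt elim)
    then have "(\<lambda>k. v x - \<phi> (r k) x) \<longlonglongrightarrow> 0"
      by (simp add: tendsto_rabs_zero_iff)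
    then have "(\<lambda>k. v x - (v x - \<phi> (r k) x)) \<longlonglongrightarrow> v x - 0"
      by (intro tendsto_diff tendsto_const)
    then show ?case
      by (intro tendsto_ennrealI tendsto_power) simp
  qed
  let ?E = "L2_nrm \<Omega> (grad \<Omega> v)"
  \<comment> \<open>An upper bound for the gradient norm of the k-th test function that converges to
    the gradient norm of v.\<close>
  let ?a = "\<lambda>k. ?E + L2_nrm \<Omega> (\<lambda>x. grad \<Omega> v x - grad \<Omega> (\<phi> k) x)"
  have bound: "even_moment (\<phi> k) s \<le> C * ?a k ^ (2 * s)" for k
  proof -
    have gk: "grad \<Omega> (\<phi> k) \<in> Lp 2 \<Omega>" by (rule H1_grad(1)[OF test_H1[OF \<phi>]])
    have "dirichlet (\<phi> k) = (L2_nrm \<Omega> (cgrad (\<phi> k)))\<^sup>2"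
      by (simp add: dirichlet_def L2_nrm_power2)
    also have "L2_nrm \<Omega> (cgrad (\<phi> k)) = L2_nrm \<Omega> (grad \<Omega> (\<phi> k))"
      by (intro L2_nrm_cong_AE[symmetric] test_grad[OF \<phi>] Lp2_measurable test_Lp2[OF \<phi>] gk)
    finally have "dirichlet (\<phi> k) = (L2_nrm \<Omega> (grad \<Omega> (\<phi> k)))\<^sup>2" .
    moreover have "L2_nrm \<Omega> (grad \<Omega> (\<phi> k)) \<le> ?a k"
      using L2_nrm_triangle[OF v1 Lp2_diff[OF gk v1]] L2_nrm_minus[of \<Omega> "\<lambda>x. grad \<Omega> v x - grad \<Omega> (\<phi> k) x"] by simp
    ultimately have "dirichlet (\<phi> k) ^ s \<le> ?a k ^ (2 * s)"
      unfolding power_mult by (auto intro!: power_mono simp: L2_nrm_nonneg)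
    then show ?thesis
      using C[OF \<phi>, of k] mult_left_mono[OF _ C0] by (meson order_trans)
  qed
  have "(\<integral>\<^sup>+x. ennreal (v x ^ (2 * s)) \<partial>M) = (\<integral>\<^sup>+x. liminf (\<lambda>k. ennreal (\<phi> (r k) x ^ (2 * s))) \<partial>M)"
  proof (rule nn_integral_cong_AE)
    show "AE x in M. ennreal (v x ^ (2 * s)) = liminf (\<lambda>k. ennreal (\<phi> (r k) x ^ (2 * s)))"
      using aev by eventually_elim (rule lim_imp_Liminf[OF sequentially_bot, symmetric])
  qed
  also have "\<dots> \<le> liminf (\<lambda>k. \<integral>\<^sup>+x. ennreal (\<phi> (r k) x ^ (2 * s)) \<partial>M)"
    by (intro nn_integral_liminf) measurable
  also have "\<dots> \<le> liminf (\<lambda>k. ennreal (C * ?a (r k) ^ (2 * s)))"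
    unfolding test_nn_integral_power[OF \<phi>] by (intro Liminf_mono always_eventually allI ennreal_leI bound)
  also have "\<dots> = ennreal (C * ?E ^ (2 * s))"
  proof (intro lim_imp_Liminf tendsto_ennrealI)
    have "(\<lambda>k. C * ?a (r k) ^ (2 * s)) \<longlonglongrightarrow> C * (?E + 0) ^ (2 * s)"
      using LIMSEQ_subseq_LIMSEQ[OF lim1 r] by (intro tendsto_intros) (simp add: o_def)
    then show "(\<lambda>k. C * ?a (r k) ^ (2 * s)) \<longlonglongrightarrow> C * ?E ^ (2 * s)" by simp
  qed simp
  finally have le: "(\<integral>\<^sup>+x. ennreal (v x ^ (2 * s)) \<partial>M) \<le> ennreal (C * ?E ^ (2 * s))" .
  show int: "integrable M (\<lambda>x. v x ^ (2 * s))"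
    by (rule integrableI_nonneg) (use le in \<open>auto simp: less_top[symmetric] top_unique\<close>)
  show "even_moment v s \<le> C * ?E ^ (2 * s)"
    using le C0 L2_nrm_nonneg[of \<Omega> "grad \<Omega> v"] unfolding even_moment_def
    by (subst (asm) nn_integral_eq_integral[OF int]) simp_all
qed

lemma sobolev:
  assumes v: "v \<in> H10 \<Omega>" and k: "1 \<le> k" "CARD('d) = 3 \<longrightarrow> k \<le> 6" and d: "CARD('d) \<in> {1, 2, 3}"
  shows "integrable M (\<lambda>x. \<bar>v x\<bar> ^ k)"
    "(LINT x|M. \<bar>v x\<bar> ^ k) \<le> (sobolev_const k (measure lebesgue \<Omega>) * L2_nrm \<Omega> (grad \<Omega> v)) ^ k"
proof -
  let ?vol = "measure lebesgue \<Omega>" and ?E = "L2_nrm \<Omega> (grad \<Omega> v)"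
  \<comment> \<open>One even exponent 2s \<ge> k suffices: s = k in dimensions one and two, where
    all moments are controlled, and s = 3 in dimension three, where 2s = 6 is the critical exponent
    and k \<le> 6 is used. The combination vol + C anticipates the interpolation below.\<close>
  have "\<exists>s C. 1 \<le> s \<and> k \<le> 2 * s \<and> 0 \<le> C \<and> ?vol + C \<le> sobolev_const k ?vol \<and>
      (\<forall>\<phi>\<in>test_functions \<Omega>. even_moment \<phi> s \<le> C * dirichlet \<phi> ^ s)"
  proof -
    consider "CARD('d) = 1" | "CARD('d) = 2" | "CARD('d) = 3" using d by auto
    then show ?thesis
    proof cases
      case 1
      then obtain i where "(UNIV :: 'd set) = {i}" by (auto simp: card_1_singleton_iff)
      then show ?thesis using k test_sobolev_1[of i _ k]
        by (intro exI[of _ k] exI[of _ "?vol ^ (k + 1)"]) (auto simp: sobolev_const_def)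
    next
      case 2
      then obtain i j where "(UNIV :: 'd set) = {i, j}" "i \<noteq> j" by (auto simp: card_2_iff)
      then show ?thesis using k test_sobolev_2[of i j _ k]
        by (intro exI[of _ k] exI[of _ "(fact k)\<^sup>2 * ?vol"]) (auto simp: sobolev_const_def)
    next
      case 3
      then obtain i j l where "(UNIV :: 'd set) = {i, j, l}" "i \<noteq> j" "i \<noteq> l" "j \<noteq> l" by (auto simp: card_3_iff)
      then show ?thesis using k 3 test_sobolev_3[of i j l]
        by (intro exI[of _ 3] exI[of _ 4096]) (auto simp: sobolev_const_def)
    qed
  qed
  then obtain s C where s: "1 \<le> s" "k \<le> 2 * s" and C: "0 \<le> C" "?vol + C \<le> sobolev_const k ?vol"
    and test: "\<And>\<phi>. \<phi> \<in> test_functions \<Omega> \<Longrightarrow> even_moment \<phi> s \<le> C * dirichlet \<phi> ^ s" by auto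
  note int = H10_even_moment(1)[OF v test C(1)] and le = H10_even_moment(2)[OF v test C(1)]
  have [measurable]: "v \<in> borel_measurable M" using Lp2_measurable[OF H1_Lp2[OF H10_H1[OF v]]] .
  have pw: "y ^ k \<le> 1 + y ^ (2 * s)" if "0 \<le> y" for y :: real
  proof (cases "y \<le> 1")
    case True
    then show ?thesis using that power_le_one[of y k] zero_le_power[OF that, of "2 * s"] by linarith
  next
    case False
    then have "y ^ k \<le> y ^ (2 * s)" by (intro power_increasing s(2)) simp
    then show ?thesis by simp
  qed
  show intk: "integrable M (\<lambda>x. \<bar>v x\<bar> ^ k)"
  proof (rule Bochner_Integration.integrable_bound)
    show "integrable M (\<lambda>x. 1 + v x ^ (2 * s))" using int by simp
    show "AE x in M. norm (\<bar>v x\<bar> ^ k) \<le> norm (1 + v x ^ (2 * s))"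
      using pw[of "\<bar>v _\<bar>"] by (intro AE_I2) (simp add: power_even_abs)
  qed measurable
  show "(LINT x|M. \<bar>v x\<bar> ^ k) \<le> (sobolev_const k ?vol * ?E) ^ k"
  proof (cases "?E = 0")
    case True
    then have "even_moment v s = 0" using le s(1) even_moment_nonneg[of v s] by (simp add: power_0_left)
    then have "AE x in M. v x ^ (2 * s) = 0"
      unfolding even_moment_def using int by (subst (asm) integral_nonneg_eq_0_iff_AE) auto
    then have "AE x in M. \<bar>v x\<bar> ^ k = 0"
      by eventually_elim (use k in auto)
    then have "(LINT x|M. \<bar>v x\<bar> ^ k) = 0" by (rule integral_eq_zero_AE)
    then show ?thesis using True k by simp
  next
    case False
    then have E: "0 < ?E" using L2_nrm_nonneg[of \<Omega> "grad \<Omega> v"] by simp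
    have S1: "1 \<le> sobolev_const k ?vol" by (rule sobolev_const_ge_1) simp
    \<comment> \<open>The inequality y^k \<le> 1 + y^(2s) is applied to y = |v| / E, because the
      claim is homogeneous in v and the elementary inequality is not. The leftover vol + C is at
      most S, and S \<le> S^k because S \<ge> 1.\<close>
    have "(LINT x|M. \<bar>v x\<bar> ^ k) \<le> (LINT x|M. ?E ^ k * (1 + v x ^ (2 * s) / ?E ^ (2 * s)))"
    proof (rule integral_mono[OF intk])
      show "integrable M (\<lambda>x. ?E ^ k * (1 + v x ^ (2 * s) / ?E ^ (2 * s)))" using int by simp
      fix x
      have "\<bar>v x\<bar> ^ k = ?E ^ k * (\<bar>v x\<bar> / ?E) ^ k" using E by (simp add: power_divide)
      also have "\<dots> \<le> ?E ^ k * (1 + (\<bar>v x\<bar> / ?E) ^ (2 * s))"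
        using E by (intro mult_left_mono pw) auto
      finally show "\<bar>v x\<bar> ^ k \<le> ?E ^ k * (1 + v x ^ (2 * s) / ?E ^ (2 * s))"
        by (simp add: power_divide power_even_abs)
    qed
    also have "\<dots> = ?E ^ k * (?vol + even_moment v s / ?E ^ (2 * s))"
      using int by (simp add: even_moment_def measure_restrict_space)
    also have "\<dots> \<le> ?E ^ k * (?vol + C)"
      using le E by (intro mult_left_mono add_left_mono) (auto simp: divide_le_eq)
    also have "\<dots> \<le> ?E ^ k * sobolev_const k ?vol ^ k"
      using C(2) self_le_power[OF S1, of k] k E by (intro mult_left_mono) auto
    finally show ?thesis by (simp add: power_mult_distrib mult.commute)
  qed
qed

end

section \<open>A generalised Hoelder inequality with equal exponents\<close>

lemma mult_le_sum_powers:
  fixes a b c h :: real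
  assumes "0 \<le> a" "0 \<le> b" "0 \<le> c" "0 \<le> h"
  shows "a * b * c * h ^ j \<le> a ^ (j + 3) + b ^ (j + 3) + c ^ (j + 3) + h ^ (j + 3)"
proof -
  \<comment> \<open>All factors are replaced by the largest of the four numbers, whose power j + 3
    is one of the summands.\<close>
  define m where "m = max (max a b) (max c h)"
  have m: "a \<le> m" "b \<le> m" "c \<le> m" "h \<le> m" "m = a \<or> m = b \<or> m = c \<or> m = h"
    unfolding m_def by linarith+
  have "a * b * c * h ^ j \<le> m * m * m * m ^ j"
    using assms m by (intro mult_mono power_mono) auto
  also have "\<dots> = m ^ (j + 3)" by (simp add: power_add eval_nat_numeral)
  also have "\<dots> \<le> a ^ (j + 3) + b ^ (j + 3) + c ^ (j + 3) + h ^ (j + 3)"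
  proof -
    have "0 \<le> a ^ (j + 3)" "0 \<le> b ^ (j + 3)" "0 \<le> c ^ (j + 3)" "0 \<le> h ^ (j + 3)"
      using assms by auto
    then show ?thesis using m(5) by (elim disjE) auto
  qed
  finally show ?thesis .
qed

text \<open>Hoelder's inequality for j + 3 factors in L^(j+3), up to a factor 4. Dividing each
  function by its norm bound makes each of the four integrals at most 1, which is where the 4 comes
  from.\<close>

lemma integral_mult_power_le:
  fixes a b c h :: "'a \<Rightarrow> real"
  assumes meas [measurable]: "a \<in> borel_measurable M" "b \<in> borel_measurable M" "c \<in> borel_measurable M" "h \<in> borel_measurable M"
    and int: "integrable M (\<lambda>x. \<bar>a x\<bar> ^ (j + 3))" "integrable M (\<lambda>x. \<bar>b x\<bar> ^ (j + 3))"
      "integrable M (\<lambda>x. \<bar>c x\<bar> ^ (j + 3))" "integrable M (\<lambda>x. \<bar>h x\<bar> ^ (j + 3))"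
  shows "integrable M (\<lambda>x. \<bar>a x\<bar> * \<bar>b x\<bar> * \<bar>c x\<bar> * \<bar>h x\<bar> ^ j)"
    and "\<lbrakk>(\<integral>x. \<bar>a x\<bar> ^ (j + 3) \<partial>M) \<le> A ^ (j + 3); (\<integral>x. \<bar>b x\<bar> ^ (j + 3) \<partial>M) \<le> B ^ (j + 3);
      (\<integral>x. \<bar>c x\<bar> ^ (j + 3) \<partial>M) \<le> C ^ (j + 3); (\<integral>x. \<bar>h x\<bar> ^ (j + 3) \<partial>M) \<le> H ^ (j + 3);
      0 \<le> A; 0 \<le> B; 0 \<le> C; 0 \<le> H\<rbrakk> \<Longrightarrow> (\<integral>x. \<bar>a x\<bar> * \<bar>b x\<bar> * \<bar>c x\<bar> * \<bar>h x\<bar> ^ j \<partial>M) \<le> 4 * (A * B * C * H ^ j)"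
proof -
  show prod: "integrable M (\<lambda>x. \<bar>a x\<bar> * \<bar>b x\<bar> * \<bar>c x\<bar> * \<bar>h x\<bar> ^ j)"
  proof (rule Bochner_Integration.integrable_bound)
    show "integrable M (\<lambda>x. \<bar>a x\<bar> ^ (j + 3) + \<bar>b x\<bar> ^ (j + 3) + \<bar>c x\<bar> ^ (j + 3) + \<bar>h x\<bar> ^ (j + 3))"
      by (intro Bochner_Integration.integrable_add int)
    show "AE x in M. norm (\<bar>a x\<bar> * \<bar>b x\<bar> * \<bar>c x\<bar> * \<bar>h x\<bar> ^ j)
        \<le> norm (\<bar>a x\<bar> ^ (j + 3) + \<bar>b x\<bar> ^ (j + 3) + \<bar>c x\<bar> ^ (j + 3) + \<bar>h x\<bar> ^ (j + 3))"
    proof (rule AE_I2)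
      fix x
      have "norm (\<bar>a x\<bar> * \<bar>b x\<bar> * \<bar>c x\<bar> * \<bar>h x\<bar> ^ j) = \<bar>a x\<bar> * \<bar>b x\<bar> * \<bar>c x\<bar> * \<bar>h x\<bar> ^ j" by simp
      also have "\<dots> \<le> \<bar>a x\<bar> ^ (j + 3) + \<bar>b x\<bar> ^ (j + 3) + \<bar>c x\<bar> ^ (j + 3) + \<bar>h x\<bar> ^ (j + 3)"
        by (rule mult_le_sum_powers) auto
      finally show "norm (\<bar>a x\<bar> * \<bar>b x\<bar> * \<bar>c x\<bar> * \<bar>h x\<bar> ^ j)
        \<le> norm (\<bar>a x\<bar> ^ (j + 3) + \<bar>b x\<bar> ^ (j + 3) + \<bar>c x\<bar> ^ (j + 3) + \<bar>h x\<bar> ^ (j + 3))"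
        unfolding real_norm_def by (rule order_trans[OF _ abs_ge_self])
    qed
  qed measurable
  have pos: "(\<integral>x. \<bar>a x\<bar> * \<bar>b x\<bar> * \<bar>c x\<bar> * \<bar>h x\<bar> ^ j \<partial>M) \<le> 4 * (A * B * C * H ^ j)"
    if le: "(\<integral>x. \<bar>a x\<bar> ^ (j + 3) \<partial>M) \<le> A ^ (j + 3)" "(\<integral>x. \<bar>b x\<bar> ^ (j + 3) \<partial>M) \<le> B ^ (j + 3)"
      "(\<integral>x. \<bar>c x\<bar> ^ (j + 3) \<partial>M) \<le> C ^ (j + 3)" "(\<integral>x. \<bar>h x\<bar> ^ (j + 3) \<partial>M) \<le> H ^ (j + 3)"
      and p: "0 < A" "0 < B" "0 < C" "0 < H" for A B C H
  proof -
    let ?s = "\<lambda>x. \<bar>a x\<bar> ^ (j + 3) / A ^ (j + 3) + \<bar>b x\<bar> ^ (j + 3) / B ^ (j + 3) + \<bar>c x\<bar> ^ (j + 3) / C ^ (j + 3) + \<bar>h x\<bar> ^ (j + 3) / H ^ (j + 3)"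
    have ints: "integrable M ?s"
      by (intro Bochner_Integration.integrable_add integrable_divide_zero impI int)
    have "(\<integral>x. \<bar>a x\<bar> * \<bar>b x\<bar> * \<bar>c x\<bar> * \<bar>h x\<bar> ^ j \<partial>M) \<le> (\<integral>x. (A * B * C * H ^ j) * ?s x \<partial>M)"
    proof (rule integral_mono[OF prod])
      fix x
      have "\<bar>a x\<bar> * \<bar>b x\<bar> * \<bar>c x\<bar> * \<bar>h x\<bar> ^ j = (A * B * C * H ^ j) * ((\<bar>a x\<bar> / A) * (\<bar>b x\<bar> / B) * (\<bar>c x\<bar> / C) * (\<bar>h x\<bar> / H) ^ j)"
        using p by (simp add: power_divide field_simps)
      also have "\<dots> \<le> (A * B * C * H ^ j) * ?s x"
        using p mult_le_sum_powers[of "\<bar>a x\<bar> / A" "\<bar>b x\<bar> / B" "\<bar>c x\<bar> / C" "\<bar>h x\<bar> / H" j]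
        by (intro mult_left_mono) (simp_all add: power_divide)
      finally show "\<bar>a x\<bar> * \<bar>b x\<bar> * \<bar>c x\<bar> * \<bar>h x\<bar> ^ j \<le> (A * B * C * H ^ j) * ?s x" .
    qed (intro integrable_mult_right ints)
    also have "\<dots> = (A * B * C * H ^ j) * ((\<integral>x. \<bar>a x\<bar> ^ (j + 3) \<partial>M) / A ^ (j + 3) + (\<integral>x. \<bar>b x\<bar> ^ (j + 3) \<partial>M) / B ^ (j + 3)
       + (\<integral>x. \<bar>c x\<bar> ^ (j + 3) \<partial>M) / C ^ (j + 3) + (\<integral>x. \<bar>h x\<bar> ^ (j + 3) \<partial>M) / H ^ (j + 3))"
      using int by simp
    also have "\<dots> \<le> (A * B * C * H ^ j) * (1 + 1 + 1 + 1)"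
      using p le by (intro mult_left_mono add_mono) (simp_all add: divide_le_eq_1_pos)
    finally show ?thesis by simp
  qed
  assume le: "(\<integral>x. \<bar>a x\<bar> ^ (j + 3) \<partial>M) \<le> A ^ (j + 3)" "(\<integral>x. \<bar>b x\<bar> ^ (j + 3) \<partial>M) \<le> B ^ (j + 3)"
      "(\<integral>x. \<bar>c x\<bar> ^ (j + 3) \<partial>M) \<le> C ^ (j + 3)" "(\<integral>x. \<bar>h x\<bar> ^ (j + 3) \<partial>M) \<le> H ^ (j + 3)"
      and nn: "0 \<le> A" "0 \<le> B" "0 \<le> C" "0 \<le> H"
  \<comment> \<open>A norm bound may vanish, for instance that of a zero error, and then cannot be
    divided by; all bounds are increased by 1/(n+1) and the limit is taken.\<close>
  let ?\<epsilon> = "\<lambda>n. inverse (real (Suc n))"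
  have "(\<integral>x. \<bar>a x\<bar> * \<bar>b x\<bar> * \<bar>c x\<bar> * \<bar>h x\<bar> ^ j \<partial>M)
      \<le> 4 * ((A + ?\<epsilon> n) * (B + ?\<epsilon> n) * (C + ?\<epsilon> n) * (H + ?\<epsilon> n) ^ j)" for n
  proof (rule pos)
    have up: "I \<le> (X + ?\<epsilon> n) ^ (j + 3)" if "I \<le> X ^ (j + 3)" "0 \<le> X" for I X :: real
      using that(1) by (rule order_trans) (intro power_mono that, simp)
    show "(\<integral>x. \<bar>a x\<bar> ^ (j + 3) \<partial>M) \<le> (A + ?\<epsilon> n) ^ (j + 3)" "(\<integral>x. \<bar>b x\<bar> ^ (j + 3) \<partial>M) \<le> (B + ?\<epsilon> n) ^ (j + 3)"
      "(\<integral>x. \<bar>c x\<bar> ^ (j + 3) \<partial>M) \<le> (C + ?\<epsilon> n) ^ (j + 3)" "(\<integral>x. \<bar>h x\<bar> ^ (j + 3) \<partial>M) \<le> (H + ?\<epsilon> n) ^ (j + 3)"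
      by (intro up le nn)+
  qed (use nn in \<open>auto intro!: add_nonneg_pos\<close>)
  then have le: "\<exists>N. \<forall>n\<ge>N. (\<integral>x. \<bar>a x\<bar> * \<bar>b x\<bar> * \<bar>c x\<bar> * \<bar>h x\<bar> ^ j \<partial>M)
      \<le> 4 * ((A + ?\<epsilon> n) * (B + ?\<epsilon> n) * (C + ?\<epsilon> n) * (H + ?\<epsilon> n) ^ j)" by blast
  have "(\<lambda>n. 4 * ((A + ?\<epsilon> n) * (B + ?\<epsilon> n) * (C + ?\<epsilon> n) * (H + ?\<epsilon> n) ^ j))
      \<longlonglongrightarrow> 4 * ((A + 0) * (B + 0) * (C + 0) * (H + 0) ^ j)"
    by (intro tendsto_intros LIMSEQ_inverse_real_of_nat)
  from LIMSEQ_le_const[OF this le]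
  show "(\<integral>x. \<bar>a x\<bar> * \<bar>b x\<bar> * \<bar>c x\<bar> * \<bar>h x\<bar> ^ j \<partial>M) \<le> 4 * (A * B * C * H ^ j)" by simp
qed

section \<open>Symmetric matrices: eigenvalues and coercivity\<close>

lemma symmetric_matrix_inner:
  fixes B :: "real ^ 'd ^ 'd"
  assumes "transpose B = B" shows "(B *v x) \<bullet> y = x \<bullet> (B *v y)"
  using dot_lmul_matrix[of x B y] assms by (metis transpose_matrix_vector inner_commute)

text \<open>Eigenvectors for distinct eigenvalues are orthogonal, hence independent, so there can be
  only finitely many.\<close>

lemma finite_eigenvalues:
  fixes B :: "real ^ 'd ^ 'd"
  assumes sym: "transpose B = B" shows "finite (eigenvalues B)"
proof -
  have "\<forall>l\<in>eigenvalues B. \<exists>v. v \<noteq> 0 \<and> B *v v = l *\<^sub>R v" by (simp add: eigenvalues_def)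
  then obtain w where w: "\<And>l. l \<in> eigenvalues B \<Longrightarrow> w l \<noteq> 0" "\<And>l. l \<in> eigenvalues B \<Longrightarrow> B *v w l = l *\<^sub>R w l"
    by metis
  have orth: "w l \<bullet> w m = 0" if "l \<in> eigenvalues B" "m \<in> eigenvalues B" "l \<noteq> m" for l m
    using symmetric_matrix_inner[OF sym, of "w l" "w m"] that w by simp
  have inj: "inj_on w (eigenvalues B)"
    by (rule inj_onI) (metis orth w(1) inner_eq_zero_iff)
  have "pairwise orthogonal (w ` eigenvalues B)"
    unfolding pairwise_def orthogonal_def using orth by (metis imageE)
  then have "independent (w ` eigenvalues B)"
    using w(1) by (intro pairwise_orthogonal_independent) auto
  then have "finite (w ` eigenvalues B)"
    by (rule independent_imp_finite)
  then show ?thesis using inj by (rule finite_imageD)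
qed

text \<open>A minimiser of the Rayleigh quotient on the unit sphere is an eigenvector. Finiteness of the spectrum
  is needed because \<open>Min\<close> is unspecified on infinite sets.\<close>

lemma Min_eigenvalues_le:
  fixes B :: "real ^ 'd ^ 'd"
  assumes sym: "transpose B = B"
  shows "Min (eigenvalues B) * (norm v)\<^sup>2 \<le> (B *v v) \<bullet> v"
proof -
  let ?Q = "\<lambda>v. (B *v v) \<bullet> v"
  have cont: "continuous_on (sphere 0 1) ?Q"
    by (intro continuous_intros linear_continuous_on_compose[OF continuous_on_id] matrix_vector_mul_linear)
  have "\<exists>x. x \<in> sphere (0 :: real ^ 'd) 1"
    by (rule exI[of _ "axis undefined 1"]) (simp add: norm_axis_1)
  then obtain w where w: "w \<in> sphere 0 1" and min: "\<And>y. y \<in> sphere 0 1 \<Longrightarrow> ?Q w \<le> ?Q y"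
    using continuous_attains_inf[OF compact_sphere _ cont] by (metis empty_iff)
  define m where "m = ?Q w"
  have Q_ge: "m * (norm y)\<^sup>2 \<le> ?Q y" for y
  proof (cases "y = 0")
    case False
    have "m \<le> ?Q ((1 / norm y) *\<^sub>R y)"
      unfolding m_def using False by (intro min) simp
    also have "\<dots> = ?Q y / (norm y)\<^sup>2"
      by (simp add: matrix_vector_mult_scaleR power2_eq_square)
    finally show ?thesis using False by (simp add: field_simps)
  qed simp
  have "(B *v w - m *\<^sub>R w) \<bullet> y = 0" for y
  proof -
    \<comment> \<open>The constant term is zero because m is the value at the unit vector w, and
      nonnegativity is minimality; the discriminant bound then forces the linear coefficient to
      vanish for every y.\<close>
    have "0 \<le> 0 + 2 * t * ((B *v w - m *\<^sub>R w) \<bullet> y) + t\<^sup>2 * (?Q y - m * (norm y)\<^sup>2)" for t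
    proof -
      have "0 \<le> ?Q (w + t *\<^sub>R y) - m * (norm (w + t *\<^sub>R y))\<^sup>2" using Q_ge by simp
      also have "\<dots> = 2 * t * ((B *v w - m *\<^sub>R w) \<bullet> y) + t\<^sup>2 * (?Q y - m * (norm y)\<^sup>2)"
      proof -
        have "(B *v y) \<bullet> w = (B *v w) \<bullet> y"
          using symmetric_matrix_inner[OF sym, of y w] by (simp add: inner_commute)
        moreover have "w \<bullet> w = 1" using w by (simp add: norm_eq_1)
        ultimately show ?thesis
          unfolding power2_norm_eq_inner
          by (simp add: matrix_vector_right_distrib matrix_vector_mult_scaleR inner_add_left inner_add_right
              inner_diff_left inner_commute[of y w] m_def[symmetric] algebra_simps power2_eq_square)
      qed
      finally show ?thesis by simp
    qed
    from quadratic_nonneg_imp_abs_le[OF this] show ?thesis by simp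
  qed
  then have "B *v w = m *\<^sub>R w"
    by (metis eq_iff_diff_eq_0 inner_eq_zero_iff)
  moreover have "w \<noteq> 0" using w by auto
  ultimately have "m \<in> eigenvalues B" by (auto simp: eigenvalues_def)
  then have "Min (eigenvalues B) \<le> m" by (rule Min_le[OF finite_eigenvalues[OF sym]])
  then have "Min (eigenvalues B) * (norm v)\<^sup>2 \<le> m * (norm v)\<^sup>2" by (rule mult_right_mono) simp
  also have "\<dots> \<le> ?Q v" by (rule Q_ge)
  finally show ?thesis .
qed

lemma ELL_coercive:
  assumes "ELL \<Omega> A \<mu>0 \<mu>1" "x \<in> \<Omega>"
  shows "\<mu>0 * (norm v)\<^sup>2 \<le> (A x *v v) \<bullet> v"
proof -
  have "ereal \<mu>0 \<le> ereal (Min (eigenvalues (A x)))"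
    using assms unfolding ELL_def by (auto intro: INF_lower)
  then have "\<mu>0 * (norm v)\<^sup>2 \<le> Min (eigenvalues (A x)) * (norm v)\<^sup>2" by (intro mult_right_mono) auto
  also have "\<dots> \<le> (A x *v v) \<bullet> v" using assms by (intro Min_eigenvalues_le) (auto simp: ELL_def)
  finally show ?thesis .
qed

section \<open>Composition with the nonlinearity: measurability and mean values\<close>

lemma caratheodory_measurable:
  fixes g :: "'a \<Rightarrow> real \<Rightarrow> real"
  assumes g: "\<And>\<xi>. (\<lambda>x. g x \<xi>) \<in> borel_measurable M" and cont: "\<And>x. x \<in> space M \<Longrightarrow> continuous_on UNIV (g x)"
    and u [measurable]: "u \<in> borel_measurable M"
  shows "(\<lambda>x. g x (u x)) \<in> borel_measurable M"
proof (rule borel_measurable_LIMSEQ_real)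
  \<comment> \<open>u is rounded down to multiples of 1/(k+1). With countably many values the
    composition is measurable piece by piece, and continuity in the second argument gives the
    limit.\<close>
  let ?q = "\<lambda>k y. real_of_int \<lfloor>real (Suc k) * y\<rfloor> / real (Suc k)"
  show "(\<lambda>x. g x (?q k (u x))) \<in> borel_measurable M" for k
    by (rule measurable_compose_countable[where f="\<lambda>i x. g x (real_of_int i / real (Suc k))" and g="\<lambda>x. \<lfloor>real (Suc k) * u x\<rfloor>"])
      (auto intro: g)
  fix x assume x: "x \<in> space M"
  have "(\<lambda>k. ?q k (u x)) \<longlonglongrightarrow> u x"
  proof (rule real_tendsto_sandwich)
    show "(\<lambda>k. u x - inverse (real (Suc k))) \<longlonglongrightarrow> u x"
      using tendsto_diff[OF tendsto_const LIMSEQ_inverse_real_of_nat, of "u x"] by simp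
    show "\<forall>\<^sub>F k in sequentially. u x - inverse (real (Suc k)) \<le> ?q k (u x)"
    proof (intro always_eventually allI)
      fix k
      have "real (Suc k) * u x - 1 \<le> real_of_int \<lfloor>real (Suc k) * u x\<rfloor>" by linarith
      then have "(real (Suc k) * u x - 1) / real (Suc k) \<le> ?q k (u x)"
        by (rule divide_right_mono) simp
      then show "u x - inverse (real (Suc k)) \<le> ?q k (u x)"
        by (simp add: diff_divide_distrib inverse_eq_divide del: of_nat_Suc)
    qed
    show "\<forall>\<^sub>F k in sequentially. ?q k (u x) \<le> u x"
    proof (intro always_eventually allI)
      fix k
      have "real_of_int \<lfloor>real (Suc k) * u x\<rfloor> \<le> real (Suc k) * u x" by (rule of_int_floor_le)
      then show "?q k (u x) \<le> u x"
        by (simp add: divide_le_eq mult.commute del: of_nat_Suc)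
    qed
  qed simp
  then show "(\<lambda>k. g x (?q k (u x))) \<longlonglongrightarrow> g x (u x)"
    using cont[OF x] by (intro isCont_tendsto_compose[of _ "g x"]) (auto simp: continuous_on_eq_continuous_at)
qed

text \<open>Besides the usual conclusion, the intermediate point is no farther from b than a is;
  this distance produces the second factor |s - t| in the Taylor remainder. The order of a and b is
  left open, and a = b is allowed.\<close>

lemma mean_value_between:
  fixes f f' :: "real \<Rightarrow> real"
  assumes "\<And>t. (f has_real_derivative f' t) (at t)"
  obtains \<xi> where "f a - f b = f' \<xi> * (a - b)" "\<bar>\<xi>\<bar> \<le> max \<bar>a\<bar> \<bar>b\<bar>" "\<bar>\<xi> - b\<bar> \<le> \<bar>a - b\<bar>"
proof -
  consider "a < b" | "a = b" | "b < a" by linarith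
  then show thesis
  proof cases
    case 1
    then obtain z where "a < z" "z < b" "f b - f a = (b - a) * f' z"
      using MVT2[of a b f f'] assms by blast
    then show thesis by (intro that[of z]) (auto simp: algebra_simps)
  next
    case 2
    then show thesis by (intro that[of a]) auto
  next
    case 3
    then obtain z where "b < z" "z < a" "f a - f b = (a - b) * f' z"
      using MVT2[of b a f f'] assms by blast
    then show thesis by (intro that[of z]) (auto simp: algebra_simps)
  qed
qed

section \<open>The goal-error estimate\<close>

text \<open>Norms of the data over the whole space do not mention \<Omega>, so they can enter a
  constant that is fixed before the domain.\<close>

lemma L2_nrm_zero_outside:
  assumes "\<Omega> \<in> sets lebesgue" "zero_outside \<Omega> h"
  shows "L2_nrm \<Omega> h = L2_nrm UNIV h"
proof -
  have "ip \<Omega> h h = (LINT x|lebesgue. indicator \<Omega> x *\<^sub>R (h x \<bullet> h x))"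
    unfolding ip_def using assms(1) by (subst integral_restrict_space) auto
  also have "\<dots> = (LINT x|lebesgue. h x \<bullet> h x)"
    using assms(2) by (intro Bochner_Integration.integral_cong) (auto simp: zero_outside_def indicator_def)
  also have "\<dots> = ip UNIV h h"
    by (simp add: ip_def lebesgue_on_UNIV_eq)
  finally show ?thesis by (simp add: L2_nrm_def)
qed

text \<open>Only finiteness of the integral matters, so a crude bound is enough: each row has norm
  at most that of the matrix, and there are \<open>CARD('a)\<close> rows.\<close>

lemma matrix_vector_mult_Lp2:
  fixes A :: "real ^ 'a \<Rightarrow> real ^ 'a ^ 'a"
  assumes A: "A \<in> Linf \<Omega>" and V: "V \<in> Lp 2 \<Omega>"
  shows "(\<lambda>x. A x *v V x) \<in> Lp 2 \<Omega>"
proof -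
  have meas: "A \<in> borel_measurable (lebesgue_on \<Omega>)" "V \<in> borel_measurable (lebesgue_on \<Omega>)"
    using A Lp2_measurable[OF V] by (auto simp: Linf_def)
  have "(\<lambda>x. A x $ i) \<in> borel_measurable (lebesgue_on \<Omega>)" for i
    by (rule measurable_compose[OF meas(1)]) (intro borel_measurable_continuous_onI continuous_intros)
  then have "(\<lambda>x. (A x *v V x) \<bullet> axis i 1) \<in> borel_measurable (lebesgue_on \<Omega>)" for i
    using meas(2) by (simp add: inner_axis matrix_vector_mul_component)
  then have m: "(\<lambda>x. A x *v V x) \<in> borel_measurable (lebesgue_on \<Omega>)"
    by (subst borel_measurable_euclidean_space) (auto simp: Basis_real_cart)
  obtain K where K: "AE x in lebesgue_on \<Omega>. norm (A x) \<le> K" using A by (auto simp: Linf_def)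
  let ?c = "real CARD('a) * K"
  have le: "norm (B *v v) \<le> real CARD('a) * norm B * norm v" for B :: "real ^ 'a ^ 'a" and v
  proof -
    have "norm (B *v v) \<le> (\<Sum>i\<in>UNIV. \<bar>(B *v v) $ i\<bar>)" by (rule norm_le_l1_cart)
    also have "\<dots> \<le> (\<Sum>i\<in>(UNIV :: 'a set). norm B * norm v)"
    proof (rule sum_mono)
      fix i
      have "\<bar>(B *v v) $ i\<bar> \<le> norm (B $ i) * norm v"
        unfolding matrix_vector_mul_component by (rule Cauchy_Schwarz_ineq2)
      also have "\<dots> \<le> norm B * norm v" by (intro mult_right_mono Finite_Cartesian_Product.norm_nth_le) simp
      finally show "\<bar>(B *v v) $ i\<bar> \<le> norm B * norm v" .
    qed
    finally show ?thesis by simp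
  qed
  show ?thesis
  proof (rule Lp2_bounded_by[OF m Lp2_scaleR[OF V, of ?c]])
    show "AE x in lebesgue_on \<Omega>. norm (A x *v V x) \<le> norm (?c *\<^sub>R V x)"
      using K
    proof eventually_elim
      case (elim x)
      have "norm (A x *v V x) \<le> real CARD('a) * norm (A x) * norm (V x)" by (rule le)
      also have "\<dots> \<le> ?c * norm (V x)" using elim by (intro mult_right_mono mult_left_mono) auto
      also have "\<dots> \<le> norm (?c *\<^sub>R V x)" by (simp add: mult_right_mono abs_ge_self)
      finally show ?case .
    qed
  qed
qed

text \<open>Used to gather separate powers of order n + 1 into the power of one sum, the shape in
  which Hoelder bounds can be multiplied.\<close>

lemma power_add_power_le:
  fixes x y :: real assumes "0 \<le> x" "0 \<le> y" "1 \<le> k"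
  shows "x ^ k + y ^ k \<le> (x + y) ^ k"
  using \<open>1 \<le> k\<close>
proof (induction k rule: dec_induct)
  case (step k)
  have "x ^ Suc k + y ^ Suc k \<le> x * (x ^ k + y ^ k) + y * (x ^ k + y ^ k)"
    using assms by (simp add: distrib_left)
  also have "\<dots> = (x + y) * (x ^ k + y ^ k)" by (simp add: distrib_right)
  also have "\<dots> \<le> (x + y) * (x + y) ^ k" using step assms by (intro mult_left_mono) auto
  finally show ?case by simp
qed simp

text \<open>A non-integrable function has integral 0 by convention, so pointwise domination by an
  integrable function already gives the bound.\<close>

lemma integral_abs_le_integral:
  fixes f g :: "'a \<Rightarrow> real"
  assumes g: "integrable M g" and le: "\<And>x. x \<in> space M \<Longrightarrow> \<bar>f x\<bar> \<le> g x"
  shows "\<bar>integral\<^sup>L M f\<bar> \<le> integral\<^sup>L M g"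
proof -
  have "\<bar>integral\<^sup>L M f\<bar> \<le> (\<integral>x. \<bar>f x\<bar> \<partial>M)" by (rule integral_abs_bound)
  also have "\<dots> \<le> integral\<^sup>L M g"
    using g le by (intro integral_mono') (auto intro: order_trans[OF abs_ge_zero])
  finally show ?thesis .
qed

section \<open>The bilinear form, the energy norm and a priori bounds\<close>

locale semilinear_problem = bounded_open \<Omega> for \<Omega> :: "(real ^ 'd) set" +
  fixes A :: "real ^ 'd \<Rightarrow> real ^ 'd ^ 'd" and \<mu>0 \<mu>1 :: real and b :: "real ^ 'd \<Rightarrow> real \<Rightarrow> real"
    and n :: nat and R :: real
  assumes dim: "CARD('d) \<in> {1, 2, 3}" and ell: "ELL \<Omega> A \<mu>0 \<mu>1" and car: "CAR \<Omega> b" and mon: "MON \<Omega> b"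
    and gc: "GC \<Omega> b n R"
begin

abbreviation "vol \<equiv> measure lebesgue \<Omega>"
abbreviation "E v \<equiv> L2_nrm \<Omega> (grad \<Omega> v)"
abbreviation "S \<equiv> sobolev_const (n + 1) vol"

lemma \<mu>0_pos: "0 < \<mu>0" and A_Linf: "A \<in> Linf \<Omega>" and A_sym: "x \<in> \<Omega> \<Longrightarrow> transpose (A x) = A x"
  using ell by (auto simp: ELL_def)

lemma n_ge_2: "2 \<le> n" and R_pos: "0 < R"
  using gc by (auto simp: GC_def)

lemma space_M: "space M = \<Omega>"
  by simp

text \<open>n - 2 + 3 is n + 1, written in the form j + 3 of the Hoelder inequality with j = n - 2.
  In dimension three, n \<le> 5 gives exactly the range up to the critical exponent 6.\<close>

lemma sobolev_n:
  assumes "v \<in> H10 \<Omega>"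
  shows "integrable M (\<lambda>x. \<bar>v x\<bar> ^ (n - 2 + 3))" "(LINT x|M. \<bar>v x\<bar> ^ (n - 2 + 3)) \<le> (S * E v) ^ (n - 2 + 3)"
proof -
  have "n - 2 + 3 = n + 1" "CARD('d) = 3 \<longrightarrow> n + 1 \<le> 6" using n_ge_2 gc by (auto simp: GC_def)
  then show "integrable M (\<lambda>x. \<bar>v x\<bar> ^ (n - 2 + 3))" "(LINT x|M. \<bar>v x\<bar> ^ (n - 2 + 3)) \<le> (S * E v) ^ (n - 2 + 3)"
    using sobolev[OF assms, of "n + 1"] dim by simp_all
qed

lemma S_ge_1: "1 \<le> S"
  by (rule sobolev_const_ge_1) simp

lemma E_nonneg: "0 \<le> E v"
  by (rule L2_nrm_nonneg)

lemma H10_grad: "v \<in> H10 \<Omega> \<Longrightarrow> grad \<Omega> v \<in> Lp 2 \<Omega>"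
  by (intro H1_grad H10_H1)

lemma H10_measurable: "v \<in> H10 \<Omega> \<Longrightarrow> v \<in> borel_measurable M"
  by (intro Lp2_measurable H1_Lp2 H10_H1)

lemma a_form_integrable:
  assumes "V \<in> Lp 2 \<Omega>" "W \<in> Lp 2 \<Omega>" shows "integrable M (\<lambda>x. (A x *v V x) \<bullet> W x)"
  by (intro Lp2_inner matrix_vector_mult_Lp2 A_Linf assms)

lemma a_form_sym: "a_form \<Omega> A v w = a_form \<Omega> A w v"
  unfolding a_form_def ip_def
proof (intro Bochner_Integration.integral_cong refl)
  fix x assume "x \<in> space M"
  then show "(A x *v grad \<Omega> v x) \<bullet> grad \<Omega> w x = (A x *v grad \<Omega> w x) \<bullet> grad \<Omega> v x"
    using symmetric_matrix_inner[OF A_sym, of x "grad \<Omega> v x" "grad \<Omega> w x"] by (simp only: space_M inner_commute)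
qed

lemma a_form_diff_right:
  assumes "u \<in> H10 \<Omega>" "v \<in> H10 \<Omega>" "w \<in> H10 \<Omega>"
  shows "a_form \<Omega> A u (\<lambda>x. v x - w x) = a_form \<Omega> A u v - a_form \<Omega> A u w"
proof -
  have "a_form \<Omega> A u (\<lambda>x. v x - w x) = (LINT x|M. (A x *v grad \<Omega> u x) \<bullet> (grad \<Omega> v x - grad \<Omega> w x))"
    unfolding a_form_def ip_def
  proof (rule integral_cong_AE)
    show "AE x in M. (A x *v grad \<Omega> u x) \<bullet> grad \<Omega> (\<lambda>x. v x - w x) x = (A x *v grad \<Omega> u x) \<bullet> (grad \<Omega> v x - grad \<Omega> w x)"
      using H1_diff(2)[OF H10_H1[OF assms(2)] H10_H1[OF assms(3)]] by eventually_elim simp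
  qed (intro borel_measurable_integrable a_form_integrable H10_grad H10_diff Lp2_diff assms)+
  also have "\<dots> = a_form \<Omega> A u v - a_form \<Omega> A u w"
    using a_form_integrable[OF H10_grad[OF assms(1)] H10_grad[OF assms(2)]]
      a_form_integrable[OF H10_grad[OF assms(1)] H10_grad[OF assms(3)]]
    by (simp add: a_form_def ip_def inner_diff_right)
  finally show ?thesis .
qed

lemma a_form_diff_left:
  assumes "u \<in> H10 \<Omega>" "v \<in> H10 \<Omega>" "w \<in> H10 \<Omega>"
  shows "a_form \<Omega> A (\<lambda>x. v x - w x) u = a_form \<Omega> A v u - a_form \<Omega> A w u"
  using a_form_diff_right[OF assms] by (simp add: a_form_sym[of _ u])

lemma a_form_coercive:
  assumes "v \<in> H10 \<Omega>" shows "\<mu>0 * (E v)\<^sup>2 \<le> a_form \<Omega> A v v"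
proof -
  have "(LINT x|M. \<mu>0 * (norm (grad \<Omega> v x))\<^sup>2) \<le> a_form \<Omega> A v v"
    unfolding a_form_def ip_def
    by (intro integral_mono a_form_integrable H10_grad assms)
      (use H10_grad[OF assms] in \<open>auto simp: Lp2_iff intro: ELL_coercive[OF ell]\<close>)
  then show ?thesis by (simp add: L2_nrm_power2)
qed

lemma a_form_nonneg: "v \<in> H10 \<Omega> \<Longrightarrow> 0 \<le> a_form \<Omega> A v v"
  using a_form_coercive \<mu>0_pos by (meson mult_nonneg_nonneg less_imp_le order_trans zero_le_power2)

lemma norm_A_nonneg: "v \<in> H10 \<Omega> \<Longrightarrow> 0 \<le> norm_A \<Omega> A v"
  by (simp add: norm_A_def a_form_nonneg)

lemma E_le_norm_A:
  assumes "v \<in> H10 \<Omega>" shows "sqrt \<mu>0 * E v \<le> norm_A \<Omega> A v"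
proof -
  have "sqrt (\<mu>0 * (E v)\<^sup>2) \<le> sqrt (a_form \<Omega> A v v)" by (intro real_sqrt_le_mono a_form_coercive assms)
  then show ?thesis using E_nonneg[of v] by (simp add: norm_A_def real_sqrt_mult)
qed

text \<open>The quadratic form of A(x) at V + tW is nonnegative by coercivity, and symmetry of A(x)
  merges its two mixed terms.\<close>

lemma a_form_Cauchy_Schwarz:
  assumes "v \<in> H10 \<Omega>" "w \<in> H10 \<Omega>"
  shows "\<bar>a_form \<Omega> A v w\<bar> \<le> norm_A \<Omega> A v * norm_A \<Omega> A w"
  unfolding a_form_def ip_def norm_A_def
proof (rule integral_quadratic_Cauchy_Schwarz)
  fix t
  show "AE x in M. 0 \<le> (A x *v grad \<Omega> v x) \<bullet> grad \<Omega> v x + 2 * t * ((A x *v grad \<Omega> v x) \<bullet> grad \<Omega> w x)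
      + t\<^sup>2 * ((A x *v grad \<Omega> w x) \<bullet> grad \<Omega> w x)"
  proof (rule AE_I2)
    fix x assume "x \<in> space M"
    then have x: "x \<in> \<Omega>" by simp
    let ?V = "grad \<Omega> v x" and ?W = "grad \<Omega> w x"
    have "0 \<le> \<mu>0 * (norm (?V + t *\<^sub>R ?W))\<^sup>2" using \<mu>0_pos by simp
    also have "\<dots> \<le> (A x *v (?V + t *\<^sub>R ?W)) \<bullet> (?V + t *\<^sub>R ?W)" by (rule ELL_coercive[OF ell x])
    also have "\<dots> = (A x *v ?V) \<bullet> ?V + 2 * t * ((A x *v ?V) \<bullet> ?W) + t\<^sup>2 * ((A x *v ?W) \<bullet> ?W)"
      using symmetric_matrix_inner[OF A_sym[OF x], of ?W ?V]
      by (simp add: matrix_vector_right_distrib matrix_vector_mult_scaleR inner_add_left inner_add_right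
          inner_commute[of ?W] algebra_simps power2_eq_square)
    finally show "0 \<le> (A x *v ?V) \<bullet> ?V + 2 * t * ((A x *v ?V) \<bullet> ?W) + t\<^sup>2 * ((A x *v ?W) \<bullet> ?W)" .
  qed
qed (intro a_form_integrable H10_grad assms)+

lemma lin_functional_diff:
  assumes h: "h \<in> Lp 2 \<Omega>" "hh \<in> Lp 2 \<Omega>" and v: "v \<in> H10 \<Omega>" "w \<in> H10 \<Omega>"
  shows "lin_functional \<Omega> h hh (\<lambda>x. v x - w x) = lin_functional \<Omega> h hh v - lin_functional \<Omega> h hh w"
proof -
  have "ip \<Omega> hh (grad \<Omega> (\<lambda>x. v x - w x)) = (LINT x|M. hh x \<bullet> (grad \<Omega> v x - grad \<Omega> w x))"
    unfolding ip_def
  proof (rule integral_cong_AE)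
    show "AE x in M. hh x \<bullet> grad \<Omega> (\<lambda>x. v x - w x) x = hh x \<bullet> (grad \<Omega> v x - grad \<Omega> w x)"
      using H1_diff(2)[OF H10_H1[OF v(1)] H10_H1[OF v(2)]] by eventually_elim simp
  qed (intro borel_measurable_integrable Lp2_inner H10_grad H10_diff Lp2_diff h v)+
  also have "\<dots> = ip \<Omega> hh (grad \<Omega> v) - ip \<Omega> hh (grad \<Omega> w)"
    using Lp2_inner[OF h(2) H10_grad[OF v(1)]] Lp2_inner[OF h(2) H10_grad[OF v(2)]]
    by (simp add: ip_def inner_diff_right)
  finally show ?thesis
    using Lp2_mult[OF h(1) H1_Lp2[OF H10_H1[OF v(1)]]] Lp2_mult[OF h(1) H1_Lp2[OF H10_H1[OF v(2)]]]
    by (simp add: lin_functional_def ip_def right_diff_distrib)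
qed

text \<open>The premise is an inequality because monotonicity is used to discard the lower-order
  term; in this form it serves the continuous and discrete primal problems and the dual one.
  Coercivity bounds the square of \<open>E v\<close> by the data times \<open>E v\<close>, and one
  factor is cancelled.\<close>

lemma energy_bound:
  assumes v: "v \<in> H10 \<Omega>" and h: "h \<in> Lp 2 \<Omega>" "hh \<in> Lp 2 \<Omega>" "zero_outside \<Omega> h" "zero_outside \<Omega> hh"
    and le: "a_form \<Omega> A v v \<le> lin_functional \<Omega> h hh v"
  shows "E v \<le> (L2_nrm UNIV h * sobolev_const 2 vol + L2_nrm UNIV hh) / \<mu>0"
proof -
  let ?K = "L2_nrm UNIV h * sobolev_const 2 vol + L2_nrm UNIV hh"
  have S2: "0 \<le> sobolev_const 2 vol"
    by (rule order_trans[OF zero_le_one sobolev_const_ge_1]) simp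
  \<comment> \<open>The Friedrichs inequality is the case k = 2 of the Sobolev bound, with a
    constant depending on the volume alone.\<close>
  have "(L2_nrm \<Omega> v)\<^sup>2 \<le> (sobolev_const 2 vol * E v)\<^sup>2"
    using sobolev(2)[OF v, of 2] dim by (simp add: L2_nrm_power2)
  then have P: "L2_nrm \<Omega> v \<le> sobolev_const 2 vol * E v"
    by (rule power2_le_imp_le) (intro mult_nonneg_nonneg E_nonneg S2)
  have "\<mu>0 * (E v)\<^sup>2 \<le> lin_functional \<Omega> h hh v"
    using a_form_coercive[OF v] le by simp
  also have "\<dots> \<le> L2_nrm \<Omega> h * L2_nrm \<Omega> v + L2_nrm \<Omega> hh * E v"
    unfolding lin_functional_def
    using ip_Cauchy_Schwarz[OF h(1) H1_Lp2[OF H10_H1[OF v]]] ip_Cauchy_Schwarz[OF h(2) H10_grad[OF v]] by linarith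
  also have "\<dots> \<le> L2_nrm \<Omega> h * (sobolev_const 2 vol * E v) + L2_nrm \<Omega> hh * E v"
    by (intro add_right_mono mult_left_mono P L2_nrm_nonneg)
  also have "\<dots> = E v * ?K"
    using L2_nrm_zero_outside[OF sets_\<Omega> h(3)] L2_nrm_zero_outside[OF sets_\<Omega> h(4)] by (simp add: algebra_simps)
  finally have le2: "E v * (\<mu>0 * E v) \<le> E v * ?K" by (simp add: power2_eq_square mult_ac)
  have "\<mu>0 * E v \<le> ?K"
  proof (cases "E v = 0")
    case True
    have "0 \<le> ?K" by (intro add_nonneg_nonneg mult_nonneg_nonneg L2_nrm_nonneg S2)
    then show ?thesis using True by simp
  next
    case False
    then show ?thesis using le2 E_nonneg[of v] by simp
  qed
  then show ?thesis using \<mu>0_pos by (simp add: le_divide_eq mult.commute)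
qed

section \<open>Pointwise bounds on the nonlinearity\<close>

lemma dxi_derivative:
  assumes "x \<in> \<Omega>" shows "(dxi j b x has_real_derivative dxi (Suc j) b x \<xi>) (at \<xi>)"
proof -
  have "smooth (dxi j b x)" using car assms unfolding CAR_def by blast
  then have "times_cont_diff (Suc 0) (dxi j b x)" unfolding smooth_def by blast
  then have "dxi j b x differentiable at \<xi>" by (simp add: differentiable_on_def)
  then show ?thesis by (simp add: DERIV_deriv_iff_real_differentiable[symmetric] dxi_def)
qed

lemma dxi_0: "dxi 0 b x = b x"
  by (simp add: dxi_def)

lemma dxi_measurable:
  assumes "v \<in> borel_measurable M" shows "(\<lambda>x. dxi j b x (v x)) \<in> borel_measurable M"
proof (rule caratheodory_measurable[OF _ _ assms])
  show "continuous_on UNIV (dxi j b x)" if "x \<in> space M" for x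
    using dxi_derivative[of x j] that by (intro continuous_at_imp_continuous_on) (auto intro: DERIV_isCont)
qed (use car in \<open>simp add: CAR_def\<close>)

text \<open>A bound h \<ge> 1 absorbs the additive 1 of the growth condition into the power, at the
  cost of the factor 2; h will be a pointwise weight.\<close>

lemma dxi_bound:
  assumes "x \<in> \<Omega>" "k \<le> n" "\<bar>\<xi>\<bar> \<le> h" "1 \<le> h"
  shows "\<bar>dxi k b x \<xi>\<bar> \<le> 2 * R * h ^ (n - k)"
proof -
  have "\<bar>dxi k b x \<xi>\<bar> \<le> R * (1 + \<bar>\<xi>\<bar> ^ (n - k))" using gc assms by (simp add: GC_def)
  also have "\<dots> \<le> R * (h ^ (n - k) + h ^ (n - k))"
    using assms R_pos by (intro mult_left_mono add_mono one_le_power power_mono) auto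
  finally show ?thesis by simp
qed

lemma b_lipschitz:
  assumes "x \<in> \<Omega>" "\<bar>s\<bar> \<le> h" "\<bar>t\<bar> \<le> h" "1 \<le> h"
  shows "\<bar>b x s - b x t\<bar> \<le> 2 * R * h ^ (n - 1) * \<bar>s - t\<bar>"
proof -
  obtain \<xi> where \<xi>: "dxi 0 b x s - dxi 0 b x t = dxi (Suc 0) b x \<xi> * (s - t)" "\<bar>\<xi>\<bar> \<le> max \<bar>s\<bar> \<bar>t\<bar>"
    by (rule mean_value_between[OF dxi_derivative[OF assms(1), of 0]]) blast
  have "\<bar>b x s - b x t\<bar> = \<bar>dxi 1 b x \<xi>\<bar> * \<bar>s - t\<bar>" using \<xi>(1) by (simp add: dxi_0 abs_mult)
  also have "\<dots> \<le> 2 * R * h ^ (n - 1) * \<bar>s - t\<bar>"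
    using \<xi>(2) assms n_ge_2 by (intro mult_right_mono dxi_bound) auto
  finally show ?thesis .
qed

text \<open>Two successive mean values: the first writes b(s) - b(t) as b'(\<xi>)(s - t), the second
  compares b'(\<xi>) with b'(t). The distance of \<xi> and t is at most |s - t|, and \<xi> and
  \<eta> stay within the bound h.\<close>

lemma b_taylor:
  assumes "x \<in> \<Omega>" "\<bar>s\<bar> \<le> h" "\<bar>t\<bar> \<le> h" "1 \<le> h"
  shows "\<bar>dxi 1 b x t * (s - t) - (b x s - b x t)\<bar> \<le> 2 * R * h ^ (n - 2) * \<bar>s - t\<bar> * \<bar>s - t\<bar>"
proof -
  obtain \<xi> where \<xi>: "dxi 0 b x s - dxi 0 b x t = dxi (Suc 0) b x \<xi> * (s - t)" "\<bar>\<xi>\<bar> \<le> max \<bar>s\<bar> \<bar>t\<bar>" "\<bar>\<xi> - t\<bar> \<le> \<bar>s - t\<bar>"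
    by (rule mean_value_between[OF dxi_derivative[OF assms(1), of 0]]) blast
  obtain \<eta> where \<eta>: "dxi 1 b x \<xi> - dxi 1 b x t = dxi (Suc 1) b x \<eta> * (\<xi> - t)" "\<bar>\<eta>\<bar> \<le> max \<bar>\<xi>\<bar> \<bar>t\<bar>"
    by (rule mean_value_between[OF dxi_derivative[OF assms(1), of 1]]) blast
  have "dxi 1 b x t * (s - t) - (b x s - b x t) = - ((dxi 1 b x \<xi> - dxi 1 b x t) * (s - t))"
    using \<xi>(1) by (simp add: dxi_0 algebra_simps)
  then have "\<bar>dxi 1 b x t * (s - t) - (b x s - b x t)\<bar> = \<bar>dxi 2 b x \<eta>\<bar> * \<bar>\<xi> - t\<bar> * \<bar>s - t\<bar>"
    using \<eta>(1) by (simp add: abs_mult numeral_2_eq_2)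
  also have "\<dots> \<le> 2 * R * h ^ (n - 2) * \<bar>s - t\<bar> * \<bar>s - t\<bar>"
  proof (intro mult_right_mono mult_mono)
    show "\<bar>dxi 2 b x \<eta>\<bar> \<le> 2 * R * h ^ (n - 2)"
    proof (rule dxi_bound[OF assms(1) n_ge_2 _ assms(4)])
      have "\<bar>\<xi>\<bar> \<le> h" by (rule order_trans[OF \<xi>(2)]) (simp add: assms)
      then show "\<bar>\<eta>\<bar> \<le> h" by (intro order_trans[OF \<eta>(2)]) (simp add: assms)
    qed
    show "0 \<le> 2 * R * h ^ (n - 2)" using R_pos assms(4) by simp
  qed (use \<xi>(3) in simp_all)
  finally show ?thesis .
qed

lemma b_mult_self_nonneg:
  assumes "x \<in> \<Omega>" shows "0 \<le> b x s * s"
proof -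
  obtain \<xi> where \<xi>: "dxi 0 b x s - dxi 0 b x 0 = dxi (Suc 0) b x \<xi> * (s - 0)"
    by (rule mean_value_between[OF dxi_derivative[OF assms(1), of 0]]) blast
  have "b x 0 = 0" "0 \<le> dxi 1 b x \<xi>" using mon assms by (auto simp: MON_def)
  then have eq: "b x s = dxi 1 b x \<xi> * s" using \<xi> by (simp add: dxi_0)
  show ?thesis
    unfolding eq mult.assoc using \<open>0 \<le> dxi 1 b x \<xi>\<close> by (intro mult_nonneg_nonneg zero_le_square)
qed

section \<open>Integrals of products weighted by the solutions\<close>

abbreviation "weight u w \<equiv> (\<lambda>x. 1 + \<bar>u x\<bar> + \<bar>w x\<bar>)"

text \<open>The weight dominates 1, |u| and |w|, as the pointwise bounds on derivatives of b
  require, and its L^(n+1) norm is controlled by the volume and the gradient norms. The factor 3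
  comes from replacing three summands by their maximum.\<close>

lemma weight:
  assumes u: "u \<in> H10 \<Omega>" and w: "w \<in> H10 \<Omega>"
  shows "weight u w \<in> borel_measurable M" "integrable M (\<lambda>x. \<bar>weight u w x\<bar> ^ (n - 2 + 3))"
    "\<lbrakk>E u \<le> K; E w \<le> K\<rbrakk> \<Longrightarrow> (LINT x|M. \<bar>weight u w x\<bar> ^ (n - 2 + 3)) \<le> (3 * (1 + vol + 2 * S * K)) ^ (n - 2 + 3)"
proof -
  let ?k = "n - 2 + 3"
  note [measurable] = H10_measurable[OF u] H10_measurable[OF w]
  show "weight u w \<in> borel_measurable M" by measurable
  note iu = sobolev_n[OF u] and iw = sobolev_n[OF w]
  have pw: "\<bar>weight u w x\<bar> ^ ?k \<le> 3 ^ ?k * (1 + \<bar>u x\<bar> ^ ?k + \<bar>w x\<bar> ^ ?k)" for x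
  proof -
    define m where "m = max 1 (max \<bar>u x\<bar> \<bar>w x\<bar>)"
    have m: "1 \<le> m" "\<bar>u x\<bar> \<le> m" "\<bar>w x\<bar> \<le> m" "m = 1 \<or> m = \<bar>u x\<bar> \<or> m = \<bar>w x\<bar>"
      unfolding m_def by linarith+
    have "\<bar>weight u w x\<bar> ^ ?k \<le> (3 * m) ^ ?k" using m(1-3) by (intro power_mono) auto
    also have "\<dots> = 3 ^ ?k * m ^ ?k" by (rule power_mult_distrib)
    also have "m ^ ?k \<le> 1 + \<bar>u x\<bar> ^ ?k + \<bar>w x\<bar> ^ ?k"
    proof -
      have "0 \<le> \<bar>u x\<bar> ^ ?k" "0 \<le> \<bar>w x\<bar> ^ ?k" by auto
      then show ?thesis using m(4) by (elim disjE) (simp_all del: zero_le_power_abs)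
    qed
    finally show ?thesis by simp
  qed
  have int: "integrable M (\<lambda>x. 3 ^ ?k * (1 + \<bar>u x\<bar> ^ ?k + \<bar>w x\<bar> ^ ?k))"
    using iu(1) iw(1) by simp
  show intw: "integrable M (\<lambda>x. \<bar>weight u w x\<bar> ^ ?k)"
  proof (rule Bochner_Integration.integrable_bound[OF int])
    show "AE x in M. norm (\<bar>weight u w x\<bar> ^ ?k) \<le> norm (3 ^ ?k * (1 + \<bar>u x\<bar> ^ ?k + \<bar>w x\<bar> ^ ?k))"
    proof (rule AE_I2)
      fix x
      have "norm (\<bar>weight u w x\<bar> ^ ?k) = \<bar>weight u w x\<bar> ^ ?k"
        unfolding real_norm_def by (rule abs_of_nonneg) simp
      also note pw
      also have "3 ^ ?k * (1 + \<bar>u x\<bar> ^ ?k + \<bar>w x\<bar> ^ ?k) \<le> norm (3 ^ ?k * (1 + \<bar>u x\<bar> ^ ?k + \<bar>w x\<bar> ^ ?k))"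
        unfolding real_norm_def by (rule abs_ge_self)
      finally show "norm (\<bar>weight u w x\<bar> ^ ?k) \<le> norm (3 ^ ?k * (1 + \<bar>u x\<bar> ^ ?k + \<bar>w x\<bar> ^ ?k))" .
    qed
  qed measurable
  assume K: "E u \<le> K" "E w \<le> K"
  have S0: "0 \<le> S * K" using S_ge_1 K(1) E_nonneg[of u] by (intro mult_nonneg_nonneg) auto
  have "(LINT x|M. \<bar>weight u w x\<bar> ^ ?k) \<le> (LINT x|M. 3 ^ ?k * (1 + \<bar>u x\<bar> ^ ?k + \<bar>w x\<bar> ^ ?k))"
    by (intro integral_mono intw int pw)
  also have "\<dots> = 3 ^ ?k * (vol + (LINT x|M. \<bar>u x\<bar> ^ ?k) + (LINT x|M. \<bar>w x\<bar> ^ ?k))"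
    using iu(1) iw(1) by (simp add: measure_restrict_space)
  \<comment> \<open>The volume is replaced by (1 + vol)^k, so that all three terms are k-th powers
    and superadditivity of the power can merge them.\<close>
  also have "\<dots> \<le> 3 ^ ?k * ((1 + vol) ^ ?k + (S * K) ^ ?k + (S * K) ^ ?k)"
  proof (intro mult_left_mono add_mono)
    show "vol \<le> (1 + vol) ^ ?k" using self_le_power[of "1 + vol" ?k] by simp
    show "(LINT x|M. \<bar>u x\<bar> ^ ?k) \<le> (S * K) ^ ?k"
      using K(1) S_ge_1 E_nonneg[of u] by (intro order_trans[OF iu(2)] power_mono mult_left_mono mult_nonneg_nonneg) auto
    show "(LINT x|M. \<bar>w x\<bar> ^ ?k) \<le> (S * K) ^ ?k"
      using K(2) S_ge_1 E_nonneg[of w] by (intro order_trans[OF iw(2)] power_mono mult_left_mono mult_nonneg_nonneg) auto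
  qed simp
  also have "\<dots> \<le> 3 ^ ?k * (1 + vol + S * K + S * K) ^ ?k"
  proof (rule mult_left_mono)
    have "(1 + vol) ^ ?k + (S * K) ^ ?k + (S * K) ^ ?k \<le> (1 + vol + S * K) ^ ?k + (S * K) ^ ?k"
      using S0 by (intro add_right_mono power_add_power_le) auto
    also have "\<dots> \<le> (1 + vol + S * K + S * K) ^ ?k"
      using S0 by (intro power_add_power_le) auto
    finally show "(1 + vol) ^ ?k + (S * K) ^ ?k + (S * K) ^ ?k \<le> (1 + vol + S * K + S * K) ^ ?k" .
  qed simp
  also have "\<dots> = (3 * (1 + vol + 2 * S * K)) ^ ?k"
    by (simp only: power_mult_distrib[symmetric]) (simp add: algebra_simps)
  finally show "(LINT x|M. \<bar>weight u w x\<bar> ^ ?k) \<le> (3 * (1 + vol + 2 * S * K)) ^ ?k" .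
qed

text \<open>In each integrand the exponents add up to n + 1. To fit the Hoelder inequality, three
  single factors are written separately, borrowed from the weight where necessary, so that the
  remaining power is always weight^(n-2).\<close>

lemma weighted_integral:
  assumes h: "u \<in> H10 \<Omega>" "w \<in> H10 \<Omega>" "E u \<le> K" "E w \<le> K"
    and v: "v1 \<in> H10 \<Omega>" "v2 \<in> H10 \<Omega>" "v3 \<in> H10 \<Omega>"
  defines "H \<equiv> 3 * (1 + vol + 2 * S * K)"
  shows "integrable M (\<lambda>x. weight u w x ^ n * \<bar>v2 x\<bar>)"
    and "integrable M (\<lambda>x. weight u w x ^ (n - 1) * \<bar>v1 x\<bar> * \<bar>v2 x\<bar>)"
    and "(LINT x|M. weight u w x ^ (n - 1) * \<bar>v1 x\<bar> * \<bar>v2 x\<bar>) \<le> 4 * (H ^ (n - 1) * (S * E v1) * (S * E v2))"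
    and "integrable M (\<lambda>x. weight u w x ^ (n - 2) * \<bar>v1 x\<bar> * \<bar>v2 x\<bar> * \<bar>v3 x\<bar>)"
    and "(LINT x|M. weight u w x ^ (n - 2) * \<bar>v1 x\<bar> * \<bar>v2 x\<bar> * \<bar>v3 x\<bar>) \<le> 4 * (H ^ (n - 2) * (S * E v1) * (S * E v2) * (S * E v3))"
proof -
  note wt = weight[OF h(1,2)]
  note m = H10_measurable[OF v(1)] H10_measurable[OF v(2)] H10_measurable[OF v(3)]
  note s1 = sobolev_n[OF v(1)] and s2 = sobolev_n[OF v(2)] and s3 = sobolev_n[OF v(3)]
  have nn: "0 \<le> S * E v" for v using S_ge_1 E_nonneg[of v] by (intro mult_nonneg_nonneg) auto
  have H: "0 \<le> H" unfolding H_def using S_ge_1 h(3) E_nonneg[of u]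
    by (intro mult_nonneg_nonneg add_nonneg_nonneg) auto
  obtain j where n: "n = Suc (Suc j)" using n_ge_2 by (metis Suc_le_D numeral_2_eq_2 Suc_le_mono)
  have pos: "\<bar>weight u w x\<bar> = weight u w x" for x by simp
  have e1: "weight u w x ^ n * \<bar>v2 x\<bar> = \<bar>weight u w x\<bar> * \<bar>weight u w x\<bar> * \<bar>v2 x\<bar> * \<bar>weight u w x\<bar> ^ (n - 2)"
    and e2: "weight u w x ^ (n - 1) * \<bar>v1 x\<bar> * \<bar>v2 x\<bar> = \<bar>weight u w x\<bar> * \<bar>v1 x\<bar> * \<bar>v2 x\<bar> * \<bar>weight u w x\<bar> ^ (n - 2)"
    and e3: "weight u w x ^ (n - 2) * \<bar>v1 x\<bar> * \<bar>v2 x\<bar> * \<bar>v3 x\<bar> = \<bar>v1 x\<bar> * \<bar>v2 x\<bar> * \<bar>v3 x\<bar> * \<bar>weight u w x\<bar> ^ (n - 2)" for x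
    unfolding pos n by (simp_all add: mult_ac)
  show "integrable M (\<lambda>x. weight u w x ^ n * \<bar>v2 x\<bar>)"
    unfolding e1 by (rule integral_mult_power_le(1)[OF wt(1) wt(1) m(2) wt(1) wt(2) wt(2) s2(1) wt(2)])
  show "integrable M (\<lambda>x. weight u w x ^ (n - 1) * \<bar>v1 x\<bar> * \<bar>v2 x\<bar>)"
    unfolding e2 by (rule integral_mult_power_le(1)[OF wt(1) m(1) m(2) wt(1) wt(2) s1(1) s2(1) wt(2)])
  show "integrable M (\<lambda>x. weight u w x ^ (n - 2) * \<bar>v1 x\<bar> * \<bar>v2 x\<bar> * \<bar>v3 x\<bar>)"
    unfolding e3 by (rule integral_mult_power_le(1)[OF m wt(1) s1(1) s2(1) s3(1) wt(2)])
  have "H * (S * E v1) * (S * E v2) * H ^ (n - 2) = H ^ (n - 1) * (S * E v1) * (S * E v2)"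
    unfolding n by (simp add: mult_ac)
  note H1 = this
  note I1 = integral_mult_power_le(2)[OF wt(1) m(1) m(2) wt(1) wt(2) s1(1) s2(1) wt(2) wt(3)[OF h(3,4)] s1(2) s2(2) wt(3)[OF h(3,4)], folded H_def, OF H nn nn H]
  show "(LINT x|M. weight u w x ^ (n - 1) * \<bar>v1 x\<bar> * \<bar>v2 x\<bar>) \<le> 4 * (H ^ (n - 1) * (S * E v1) * (S * E v2))"
    unfolding e2 H1[symmetric] by (rule I1)
  have "(S * E v1) * (S * E v2) * (S * E v3) * H ^ (n - 2) = H ^ (n - 2) * (S * E v1) * (S * E v2) * (S * E v3)"
    by (simp add: mult_ac)
  note H2 = this
  note I2 = integral_mult_power_le(2)[OF m wt(1) s1(1) s2(1) s3(1) wt(2) s1(2) s2(2) s3(2) wt(3)[OF h(3,4)], folded H_def, OF nn nn nn H]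
  show "(LINT x|M. weight u w x ^ (n - 2) * \<bar>v1 x\<bar> * \<bar>v2 x\<bar> * \<bar>v3 x\<bar>) \<le> 4 * (H ^ (n - 2) * (S * E v1) * (S * E v2) * (S * E v3))"
    unfolding e3 H2[symmetric] by (rule I2)
qed

text \<open>Needed before the weak equations can be rearranged: an integral of a difference splits
  into two integrals only when both terms are integrable.\<close>

lemma nonlinear_integrable:
  assumes "u \<in> H10 \<Omega>" "v \<in> H10 \<Omega>" "z \<in> H10 \<Omega>"
  shows "integrable M (\<lambda>x. b x (u x) * v x)" "integrable M (\<lambda>x. dxi 1 b x (u x) * z x * v x)"
proof -
  \<comment> \<open>The weight is built from u alone, and the bound on its gradient norm is that
    norm itself; only the integrability parts are used.\<close>
  note wi = weighted_integral[OF assms(1) assms(1) order_refl order_refl assms(3) assms(2) assms(2)]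
  show "integrable M (\<lambda>x. b x (u x) * v x)"
  proof (rule Bochner_Integration.integrable_bound)
    show "integrable M (\<lambda>x. 2 * R * (weight u u x ^ n * \<bar>v x\<bar>))"
      by (intro integrable_mult_right wi)
    show "AE x in M. norm (b x (u x) * v x) \<le> norm (2 * R * (weight u u x ^ n * \<bar>v x\<bar>))"
    proof (rule AE_I2)
      fix x assume "x \<in> space M"
      then have "\<bar>dxi 0 b x (u x)\<bar> \<le> 2 * R * weight u u x ^ (n - 0)" by (intro dxi_bound) auto
      then have "\<bar>b x (u x)\<bar> * \<bar>v x\<bar> \<le> 2 * R * weight u u x ^ n * \<bar>v x\<bar>" by (intro mult_right_mono) (auto simp: dxi_0)
      then show "norm (b x (u x) * v x) \<le> norm (2 * R * (weight u u x ^ n * \<bar>v x\<bar>))"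
        unfolding real_norm_def abs_mult[of "b x (u x)"] by (intro order_trans[OF _ abs_ge_self]) (simp add: mult.assoc)
    qed
    show "(\<lambda>x. b x (u x) * v x) \<in> borel_measurable M"
      using dxi_measurable[OF H10_measurable[OF assms(1)], of 0] H10_measurable[OF assms(2)]
      unfolding dxi_0 by (rule borel_measurable_times)
  qed
  show "integrable M (\<lambda>x. dxi 1 b x (u x) * z x * v x)"
  proof (rule Bochner_Integration.integrable_bound)
    show "integrable M (\<lambda>x. 2 * R * (weight u u x ^ (n - 1) * \<bar>z x\<bar> * \<bar>v x\<bar>))"
      by (intro integrable_mult_right wi)
    show "AE x in M. norm (dxi 1 b x (u x) * z x * v x) \<le> norm (2 * R * (weight u u x ^ (n - 1) * \<bar>z x\<bar> * \<bar>v x\<bar>))"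
    proof (rule AE_I2)
      fix x assume "x \<in> space M"
      then have d: "\<bar>dxi 1 b x (u x)\<bar> \<le> 2 * R * weight u u x ^ (n - 1)"
        using n_ge_2 by (intro dxi_bound) auto
      have "norm (dxi 1 b x (u x) * z x * v x) = \<bar>dxi 1 b x (u x)\<bar> * (\<bar>z x\<bar> * \<bar>v x\<bar>)"
        by (simp only: real_norm_def abs_mult mult.assoc)
      also have "\<dots> \<le> 2 * R * weight u u x ^ (n - 1) * (\<bar>z x\<bar> * \<bar>v x\<bar>)"
        by (rule mult_right_mono[OF d]) simp
      also have "\<dots> = 2 * R * (weight u u x ^ (n - 1) * \<bar>z x\<bar> * \<bar>v x\<bar>)"
        by (simp only: mult.assoc)
      also have "\<dots> \<le> norm \<dots>"
        unfolding real_norm_def by (rule abs_ge_self)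
      finally show "norm (dxi 1 b x (u x) * z x * v x) \<le> norm (2 * R * (weight u u x ^ (n - 1) * \<bar>z x\<bar> * \<bar>v x\<bar>))" .
    qed
    show "(\<lambda>x. dxi 1 b x (u x) * z x * v x) \<in> borel_measurable M"
      by (intro borel_measurable_times dxi_measurable H10_measurable assms)
  qed
qed

section \<open>Stability, error representation and the final estimate\<close>

lemma primal_energy_bound:
  assumes "primal_solution X \<Omega> A b f ff u" "X \<subseteq> H10 \<Omega>"
    and f: "f \<in> Lp 2 \<Omega>" "ff \<in> Lp 2 \<Omega>" "zero_outside \<Omega> f" "zero_outside \<Omega> ff"
  shows "E u \<le> (L2_nrm UNIV f * sobolev_const 2 vol + L2_nrm UNIV ff) / \<mu>0"
proof -
  have u: "u \<in> H10 \<Omega>" and eq: "a_form \<Omega> A u u + ip \<Omega> (\<lambda>x. b x (u x)) u = lin_functional \<Omega> f ff u"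
    using assms(1,2) by (auto simp: primal_solution_def)
  \<comment> \<open>The solution is its own test function, and b(u)u \<ge> 0 pointwise by
    monotonicity. As u lies in \<open>X\<close>, this covers the continuous and the discrete problem
    at once.\<close>
  have "0 \<le> ip \<Omega> (\<lambda>x. b x (u x)) u"
    unfolding ip_def by (intro integral_nonneg_AE AE_I2) (simp add: b_mult_self_nonneg)
  with eq show ?thesis by (intro energy_bound u f) simp
qed

text \<open>The linearised term b'(w)z^2 is nonnegative whatever w is, so the bound is uniform in
  the linearisation point and hence in the discretisation.\<close>

lemma dual_energy_bound:
  assumes "dual_solution (H10 \<Omega>) \<Omega> A b g gg w z"
    and g: "g \<in> Lp 2 \<Omega>" "gg \<in> Lp 2 \<Omega>" "zero_outside \<Omega> g" "zero_outside \<Omega> gg"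
  shows "E z \<le> (L2_nrm UNIV g * sobolev_const 2 vol + L2_nrm UNIV gg) / \<mu>0"
proof -
  have z: "z \<in> H10 \<Omega>" and eq: "a_form \<Omega> A z z + ip \<Omega> (\<lambda>x. dxi 1 b x (w x) * z x) z = lin_functional \<Omega> g gg z"
    using assms(1) by (auto simp: dual_solution_def)
  have "0 \<le> ip \<Omega> (\<lambda>x. dxi 1 b x (w x) * z x) z"
    unfolding ip_def using mon by (intro integral_nonneg_AE AE_I2) (simp add: mult.assoc MON_def)
  with eq show ?thesis by (intro energy_bound z g) simp
qed

lemma goal_error_identity:
  assumes u: "primal_solution (H10 \<Omega>) \<Omega> A b f ff u" and w: "primal_solution X \<Omega> A b f ff w"
    and z: "dual_solution (H10 \<Omega>) \<Omega> A b g gg w z" and zH: "zH \<in> X" and X: "X \<subseteq> H10 \<Omega>"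
    and g: "g \<in> Lp 2 \<Omega>" "gg \<in> Lp 2 \<Omega>"
  shows "lin_functional \<Omega> g gg u - lin_functional \<Omega> g gg w =
      a_form \<Omega> A (\<lambda>x. u x - w x) (\<lambda>x. z x - zH x)
      + (LINT x|M. (b x (u x) - b x (w x)) * (z x - zH x))
      + (LINT x|M. (dxi 1 b x (w x) * (u x - w x) - (b x (u x) - b x (w x))) * z x)"
proof -
  let ?e = "\<lambda>x. u x - w x"
  have H: "u \<in> H10 \<Omega>" "w \<in> H10 \<Omega>" "z \<in> H10 \<Omega>" "zH \<in> H10 \<Omega>"
    using u w z zH X by (auto simp: primal_solution_def dual_solution_def)
  have e: "?e \<in> H10 \<Omega>" by (intro H10_diff H)
  note iu = nonlinear_integrable(1)[OF H(1) H(3) H(3)] nonlinear_integrable(1)[OF H(1) H(4) H(4)]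
    and iw = nonlinear_integrable(1)[OF H(2) H(3) H(3)] nonlinear_integrable(1)[OF H(2) H(4) H(4)]
    and id = nonlinear_integrable(2)[OF H(2) H(3) e]
  have "lin_functional \<Omega> g gg u - lin_functional \<Omega> g gg w = lin_functional \<Omega> g gg ?e"
    by (rule lin_functional_diff[OF g H(1,2), symmetric])
  also have "\<dots> = a_form \<Omega> A z ?e + (LINT x|M. dxi 1 b x (w x) * z x * (u x - w x))"
    using z e by (simp add: dual_solution_def ip_def)
  finally have dual: "lin_functional \<Omega> g gg u - lin_functional \<Omega> g gg w =
      a_form \<Omega> A ?e z + (LINT x|M. dxi 1 b x (w x) * z x * (u x - w x))"
    by (simp add: a_form_sym)
  have "a_form \<Omega> A u zH + (LINT x|M. b x (u x) * zH x) = a_form \<Omega> A w zH + (LINT x|M. b x (w x) * zH x)"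
    using u w zH H(4) by (simp add: primal_solution_def ip_def)
  then have orth: "a_form \<Omega> A ?e zH + (LINT x|M. b x (u x) * zH x) - (LINT x|M. b x (w x) * zH x) = 0"
    using a_form_diff_left[OF H(4) H(1) H(2)] by simp
  have "(LINT x|M. (b x (u x) - b x (w x)) * (z x - zH x)) =
      (LINT x|M. b x (u x) * z x - b x (u x) * zH x - (b x (w x) * z x - b x (w x) * zH x))"
    by (simp add: algebra_simps)
  also have "\<dots> = ((LINT x|M. b x (u x) * z x) - (LINT x|M. b x (u x) * zH x)) - ((LINT x|M. b x (w x) * z x) - (LINT x|M. b x (w x) * zH x))"
    using iu iw by simp
  finally have I1: "(LINT x|M. (b x (u x) - b x (w x)) * (z x - zH x)) = \<dots>" .
  have "(LINT x|M. (dxi 1 b x (w x) * (u x - w x) - (b x (u x) - b x (w x))) * z x) =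
      (LINT x|M. dxi 1 b x (w x) * (u x - w x) * z x - (b x (u x) * z x - b x (w x) * z x))"
    by (simp add: algebra_simps)
  also have "\<dots> = (LINT x|M. dxi 1 b x (w x) * (u x - w x) * z x) - ((LINT x|M. b x (u x) * z x) - (LINT x|M. b x (w x) * z x))"
    using iu iw id by simp
  finally have I2: "(LINT x|M. (dxi 1 b x (w x) * (u x - w x) - (b x (u x) - b x (w x))) * z x) = \<dots>" .
  have I3: "(LINT x|M. dxi 1 b x (w x) * (u x - w x) * z x) = (LINT x|M. dxi 1 b x (w x) * z x * (u x - w x))"
    by (simp add: mult_ac)
  \<comment> \<open>The integrals of b(u)z and b(w)z cancel between \<open>I1\<close> and
    \<open>I2\<close>; what remains is the dual equation minus the orthogonality relation.\<close>
  show ?thesis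
    unfolding dual a_form_diff_right[OF e H(3) H(4)] I1 I2 I3 using orth by linarith
qed

text \<open>Origin of the constants: 8 is the 2 of the growth bound times the 4 of the Hoelder
  inequality; each \<open>H10\<close> factor contributes one \<open>S\<close>; the weight
  contributes \<open>H\<close> to the power n - 1 or n - 2; and 1/\<mu>0 converts a product of two
  gradient norms into energy norms. The third factor z of the quadratic term is absorbed into the
  constant through \<open>L\<close>.\<close>

theorem goal_error_estimate:
  assumes u: "primal_solution (H10 \<Omega>) \<Omega> A b f ff u" and w: "primal_solution X \<Omega> A b f ff w"
    and z: "dual_solution (H10 \<Omega>) \<Omega> A b g gg w z" and zH: "zH \<in> X" and X: "X \<subseteq> H10 \<Omega>"
    and f: "f \<in> Lp 2 \<Omega>" "ff \<in> Lp 2 \<Omega>" "zero_outside \<Omega> f" "zero_outside \<Omega> ff"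
    and g: "g \<in> Lp 2 \<Omega>" "gg \<in> Lp 2 \<Omega>" "zero_outside \<Omega> g" "zero_outside \<Omega> gg"
  defines "K \<equiv> (L2_nrm UNIV f * sobolev_const 2 vol + L2_nrm UNIV ff) / \<mu>0"
    and "L \<equiv> (L2_nrm UNIV g * sobolev_const 2 vol + L2_nrm UNIV gg) / \<mu>0"
  defines "H \<equiv> 3 * (1 + vol + 2 * S * K)"
  shows "\<bar>lin_functional \<Omega> g gg u - lin_functional \<Omega> g gg w\<bar> \<le>
    (1 + 8 * R * H ^ (n - 1) * S\<^sup>2 / \<mu>0) * (norm_A \<Omega> A (\<lambda>x. u x - w x) * norm_A \<Omega> A (\<lambda>x. z x - zH x))
    + 8 * R * H ^ (n - 2) * S ^ 3 * L / \<mu>0 * (norm_A \<Omega> A (\<lambda>x. u x - w x))\<^sup>2"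
proof -
  let ?e = "\<lambda>x. u x - w x" and ?\<zeta> = "\<lambda>x. z x - zH x"
  let ?ne = "norm_A \<Omega> A ?e" and ?n\<zeta> = "norm_A \<Omega> A ?\<zeta>"
  have V: "u \<in> H10 \<Omega>" "w \<in> H10 \<Omega>" "z \<in> H10 \<Omega>" "zH \<in> H10 \<Omega>"
    using u w z zH X by (auto simp: primal_solution_def dual_solution_def)
  have e: "?e \<in> H10 \<Omega>" and \<zeta>: "?\<zeta> \<in> H10 \<Omega>" by (intro H10_diff V)+
  have Ku: "E u \<le> K" and Kw: "E w \<le> K"
    unfolding K_def by (rule primal_energy_bound[OF u order_refl f], rule primal_energy_bound[OF w X f])
  have Lz: "E z \<le> L" unfolding L_def by (rule dual_energy_bound[OF z g])
  have H0: "0 \<le> H" unfolding H_def using S_ge_1 Ku E_nonneg[of u]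
    by (intro mult_nonneg_nonneg add_nonneg_nonneg) auto
  have S0: "0 \<le> S" using S_ge_1 by simp
  have Ee: "E ?e \<le> ?ne / sqrt \<mu>0" and E\<zeta>: "E ?\<zeta> \<le> ?n\<zeta> / sqrt \<mu>0"
    using E_le_norm_A[OF e] E_le_norm_A[OF \<zeta>] \<mu>0_pos by (auto simp: le_divide_eq mult.commute)
  note w1 = weighted_integral(2,3)[OF V(1,2) Ku Kw e \<zeta> \<zeta>, folded H_def]
    and w2 = weighted_integral(4,5)[OF V(1,2) Ku Kw e e V(3), folded H_def]
  have "\<bar>LINT x|M. (b x (u x) - b x (w x)) * ?\<zeta> x\<bar> \<le> (LINT x|M. 2 * R * (weight u w x ^ (n - 1) * \<bar>?e x\<bar> * \<bar>?\<zeta> x\<bar>))"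
  proof (rule integral_abs_le_integral[OF integrable_mult_right[OF w1(1)]])
    fix x assume "x \<in> space M"
    then have "\<bar>b x (u x) - b x (w x)\<bar> \<le> 2 * R * weight u w x ^ (n - 1) * \<bar>?e x\<bar>" by (intro b_lipschitz) auto
    from mult_right_mono[OF this, of "\<bar>?\<zeta> x\<bar>"]
    show "\<bar>(b x (u x) - b x (w x)) * ?\<zeta> x\<bar> \<le> 2 * R * (weight u w x ^ (n - 1) * \<bar>?e x\<bar> * \<bar>?\<zeta> x\<bar>)"
      by (simp add: abs_mult mult.assoc)
  qed
  also have "\<dots> \<le> 2 * R * (4 * (H ^ (n - 1) * (S * E ?e) * (S * E ?\<zeta>)))"
    unfolding integral_mult_right_zero using w1(2) R_pos by (intro mult_left_mono) auto
  also have "\<dots> = 8 * R * H ^ (n - 1) * S\<^sup>2 * (E ?e * E ?\<zeta>)"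
    by (simp add: power2_eq_square mult_ac)
  also have "\<dots> \<le> 8 * R * H ^ (n - 1) * S\<^sup>2 * ((?ne / sqrt \<mu>0) * (?n\<zeta> / sqrt \<mu>0))"
    using R_pos H0 Ee E\<zeta> E_nonneg[of ?e] E_nonneg[of ?\<zeta>] by (intro mult_left_mono mult_mono) auto
  also have "\<dots> = 8 * R * H ^ (n - 1) * S\<^sup>2 / \<mu>0 * (?ne * ?n\<zeta>)"
    using \<mu>0_pos by simp
  finally have I1: "\<bar>LINT x|M. (b x (u x) - b x (w x)) * ?\<zeta> x\<bar> \<le> \<dots>" .
  have "\<bar>LINT x|M. (dxi 1 b x (w x) * ?e x - (b x (u x) - b x (w x))) * z x\<bar>
      \<le> (LINT x|M. 2 * R * (weight u w x ^ (n - 2) * \<bar>?e x\<bar> * \<bar>?e x\<bar> * \<bar>z x\<bar>))"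
  proof (rule integral_abs_le_integral[OF integrable_mult_right[OF w2(1)]])
    fix x assume "x \<in> space M"
    then have "\<bar>dxi 1 b x (w x) * ?e x - (b x (u x) - b x (w x))\<bar> \<le> 2 * R * weight u w x ^ (n - 2) * \<bar>?e x\<bar> * \<bar>?e x\<bar>"
      by (intro b_taylor) auto
    from mult_right_mono[OF this, of "\<bar>z x\<bar>"]
    show "\<bar>(dxi 1 b x (w x) * ?e x - (b x (u x) - b x (w x))) * z x\<bar> \<le> 2 * R * (weight u w x ^ (n - 2) * \<bar>?e x\<bar> * \<bar>?e x\<bar> * \<bar>z x\<bar>)"
      by (simp add: abs_mult mult.assoc)
  qed
  also have "\<dots> \<le> 2 * R * (4 * (H ^ (n - 2) * (S * E ?e) * (S * E ?e) * (S * E z)))"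
    unfolding integral_mult_right_zero using w2(2) R_pos by (intro mult_left_mono) auto
  also have "\<dots> = 8 * R * H ^ (n - 2) * S ^ 3 * (E z * (E ?e)\<^sup>2)"
    by (simp add: power2_eq_square power3_eq_cube mult_ac)
  also have "\<dots> \<le> 8 * R * H ^ (n - 2) * S ^ 3 * (L * (?ne / sqrt \<mu>0)\<^sup>2)"
    using R_pos H0 S0 Ee Lz E_nonneg[of ?e] E_nonneg[of z] by (intro mult_left_mono mult_mono power_mono) auto
  also have "\<dots> = 8 * R * H ^ (n - 2) * S ^ 3 * L / \<mu>0 * ?ne\<^sup>2"
    using \<mu>0_pos by (simp add: power_divide)
  finally have I2: "\<bar>LINT x|M. (dxi 1 b x (w x) * ?e x - (b x (u x) - b x (w x))) * z x\<bar> \<le> \<dots>" .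
  show ?thesis
    unfolding goal_error_identity[OF u w z zH X g(1,2)]
    using I1 I2 a_form_Cauchy_Schwarz[OF e \<zeta>] by (simp add: distrib_right)
qed

end

text \<open>The order of quantifiers expresses what \<open>C_est\<close> may depend on: it is chosen
  after the volume, the data, \<open>M\<close>, \<open>n\<close>, \<open>R\<close>, \<open>p\<close>
  and \<mu>0, but before the domain, the coefficients, the triangulation and the solutions.\<close>

theorem theorem7:
  fixes vol p \<mu>0 R :: real and M :: ereal and n :: nat
    and f g :: "real ^ 'd \<Rightarrow> real" and ff gg :: "real ^ 'd \<Rightarrow> real ^ 'd"
  assumes "CARD('d) \<in> {1, 2, 3}"
  shows "\<exists>C_est > 0.
    \<forall>(\<Omega> :: (real ^ 'd) set) A \<mu>1 b \<T> m u u_H z z_H.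
      bounded_Lipschitz_domain \<Omega> \<and> measure lebesgue \<Omega> = vol \<and>
      f \<in> Lp 2 \<Omega> \<and> g \<in> Lp 2 \<Omega> \<and> ff \<in> Lp 2 \<Omega> \<and> gg \<in> Lp 2 \<Omega> \<and>
      zero_outside \<Omega> f \<and> zero_outside \<Omega> g \<and> zero_outside \<Omega> ff \<and> zero_outside \<Omega> gg \<and>
      RHS \<Omega> p f ff g gg \<and> ELL \<Omega> A \<mu>0 \<mu>1 \<and> CAR \<Omega> b \<and> MON \<Omega> b \<and> GC \<Omega> b n R \<and>
      conforming_triangulation_of \<T> \<Omega> \<and> 1 \<le> m \<and>
      primal_solution (H10 \<Omega>) \<Omega> A b f ff u \<and> Linf_norm \<Omega> u = M \<and>
      primal_solution (fem_space \<Omega> \<T> m) \<Omega> A b f ff u_H \<and>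
      dual_solution (H10 \<Omega>) \<Omega> A b g gg u_H z \<and>
      dual_solution (fem_space \<Omega> \<T> m) \<Omega> A b g gg u_H z_H
      \<longrightarrow>
      \<bar>lin_functional \<Omega> g gg u - lin_functional \<Omega> g gg u_H\<bar>
        \<le> C_est * (norm_A \<Omega> A (\<lambda>x. u x - u_H x) * norm_A \<Omega> A (\<lambda>x. z x - z_H x)
                   + (norm_A \<Omega> A (\<lambda>x. u x - u_H x))\<^sup>2)"
proof -
  define S where "S = sobolev_const (n + 1) vol"
  define K where "K = (L2_nrm UNIV f * sobolev_const 2 vol + L2_nrm UNIV ff) / \<mu>0"
  define L where "L = (L2_nrm UNIV g * sobolev_const 2 vol + L2_nrm UNIV gg) / \<mu>0"
  define H where "H = 3 * (1 + vol + 2 * S * K)"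
  define C1 where "C1 = 8 * R * H ^ (n - 1) * S\<^sup>2 / \<mu>0"
  define C2 where "C2 = 8 * R * H ^ (n - 2) * S ^ 3 * L / \<mu>0"
  \<comment> \<open>The parameters are arbitrary reals at this point, before the hypotheses are
    available, so \<open>C1\<close> and \<open>C2\<close> may have any sign; absolute values and the
    summand 1 make the constant positive unconditionally.\<close>
  let ?C = "1 + \<bar>C1\<bar> + \<bar>C2\<bar>"
  have main: "\<bar>lin_functional \<Omega> g gg u - lin_functional \<Omega> g gg u_H\<bar>
      \<le> ?C * (norm_A \<Omega> A (\<lambda>x. u x - u_H x) * norm_A \<Omega> A (\<lambda>x. z x - z_H x) + (norm_A \<Omega> A (\<lambda>x. u x - u_H x))\<^sup>2)"
    if dom: "bounded_Lipschitz_domain \<Omega>" and vol: "measure lebesgue \<Omega> = vol"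
      and f: "f \<in> Lp 2 \<Omega>" "ff \<in> Lp 2 \<Omega>" "zero_outside \<Omega> f" "zero_outside \<Omega> ff"
      and g: "g \<in> Lp 2 \<Omega>" "gg \<in> Lp 2 \<Omega>" "zero_outside \<Omega> g" "zero_outside \<Omega> gg"
      and data: "ELL \<Omega> A \<mu>0 \<mu>1" "CAR \<Omega> b" "MON \<Omega> b" "GC \<Omega> b n R"
      and u: "primal_solution (H10 \<Omega>) \<Omega> A b f ff u" and u_H: "primal_solution (fem_space \<Omega> \<T> m) \<Omega> A b f ff u_H"
      and z: "dual_solution (H10 \<Omega>) \<Omega> A b g gg u_H z" and z_H: "dual_solution (fem_space \<Omega> \<T> m) \<Omega> A b g gg u_H z_H"
    for \<Omega> :: "(real ^ 'd) set" and A \<mu>1 b \<T> m u u_H z z_H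
  proof -
    interpret semilinear_problem \<Omega> A \<mu>0 \<mu>1 b n R
      using dom data assms by unfold_locales (auto simp: bounded_Lipschitz_domain_def)
    have X: "fem_space \<Omega> \<T> m \<subseteq> H10 \<Omega>" by (auto simp: fem_space_def)
    have sol: "u \<in> H10 \<Omega>" "u_H \<in> H10 \<Omega>" "z \<in> H10 \<Omega>" "z_H \<in> fem_space \<Omega> \<T> m" "z_H \<in> H10 \<Omega>"
      using u u_H z z_H X by (auto simp: primal_solution_def dual_solution_def)
    let ?x = "norm_A \<Omega> A (\<lambda>x. u x - u_H x) * norm_A \<Omega> A (\<lambda>x. z x - z_H x)"
      and ?y = "(norm_A \<Omega> A (\<lambda>x. u x - u_H x))\<^sup>2"
    have xy: "0 \<le> ?x" "0 \<le> ?y"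
      using norm_A_nonneg[OF H10_diff[OF sol(1,2)]] norm_A_nonneg[OF H10_diff[OF sol(3,5)]] by auto
    have "\<bar>lin_functional \<Omega> g gg u - lin_functional \<Omega> g gg u_H\<bar> \<le> (1 + C1) * ?x + C2 * ?y"
      using goal_error_estimate[OF u u_H z sol(4) X f g]
      unfolding C1_def C2_def H_def K_def L_def S_def vol .
    also have "\<dots> \<le> ?C * ?x + ?C * ?y"
    proof (rule add_mono)
      show "(1 + C1) * ?x \<le> ?C * ?x" by (rule mult_right_mono[OF _ xy(1)]) linarith
      show "C2 * ?y \<le> ?C * ?y" by (rule mult_right_mono[OF _ xy(2)]) linarith
    qed
    also have "\<dots> = ?C * (?x + ?y)" by (rule distrib_left[symmetric])
    finally show ?thesis .
  qed
  show ?thesis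
  proof (rule exI[of _ ?C], intro conjI allI impI, goal_cases)
    case 1
    show ?case by linarith
  next
    case 2
    then show ?case by (elim conjE) (rule main)
  qed
qed

end
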